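(* Let $M$ be the germ at the origin of a rigid hypersurface $\operatorname{Re} z_3=F(z_1,\bar z_1,z_2,\bar z_2)$ in $\mathbb{C}^3$ of the class $\mathfrak{C}_{2,1}$, with $F_{1\bar 1}>0$ everywhere. Assume that $S_1=0$ and $S_{\bar 1}=0$, where $S:=\left(F_{1\bar 2}/F_{1\bar 1}\right)_1$, and that $F_{1\bar 1}$ depends only on $z_2,\bar z_2$. Then $M$ is real-analytic.
   Context: Notation: subscripts $1,\bar 1,2,\bar 2$ denote partial derivatives with respect to $z_1,\bar z_1,z_2,\bar z_2$, respectively. "Smooth" means $C^\infty$. All objects are considered as germs, so domains may be shrunk. Rigid hypersurface germ: the germ at the origin in $\mathbb{C}^3$ of a real hypersurface $\operatorname{Re} z_3=F(z_1,\bar z_1,z_2,\bar z_2)$, where $F$ (the graphing function) is a smooth real-valued function near $0\in\mathbb{C}^2$ with $F(0)=0$; a priori $F$ is only assumed $C^\infty$. Class $\mathfrak{C}_{2,1}$: connected 5-dimensional CR-hypersurfaces that are 2-nondegenerate and uniformly Levi degenerate of rank 1 (the Levi form has rank exactly 1 at every point). For a rigid hypersurface $\operatorname{Re} z_3=F$ in $\mathbb{C}^3$ with $F_{1\bar 1}>0$, uniform Levi degeneracy of rank 1 is the condition $F_{1\bar 1}F_{2\bar 2}-|F_{1\bar 2}|^2=0$ (complex homogeneous Monge–Ampère equation), and, given this, 2-nondegeneracy is expressed as $S\ne 0$ everywhere, where $S:=\left(F_{1\bar 2}/F_{1\bar 1}\right)_1$. *)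

theory Defs
  imports "HOL-Analysis.Analysis"
begin

section \<open>Smooth and real-analytic maps\<close>

text \<open>For an open set \<open>U\<close> of a Euclidean space, \<open>Ck_on k f U\<close> says that \<open>f\<close> is \<open>k\<close> times
  continuously differentiable on \<open>U\<close>; higher derivatives are taken as iterated directional
  derivatives.\<close>

primrec Ck_on ::
  "nat \<Rightarrow> ('a::euclidean_space \<Rightarrow> 'b::real_normed_vector) \<Rightarrow> 'a set \<Rightarrow> bool"
where
  "Ck_on 0 f U \<longleftrightarrow> continuous_on U f"
| "Ck_on (Suc k) f U \<longleftrightarrow>
     (\<forall>p\<in>U. f differentiable (at p)) \<and>
     (\<forall>v. Ck_on k (\<lambda>p. frechet_derivative f (at p) v) U)"

definition smooth_on :: "('a::euclidean_space \<Rightarrow> 'b::real_normed_vector) \<Rightarrow> 'a set \<Rightarrow> bool"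
  where "smooth_on f U \<longleftrightarrow> (\<forall>k. Ck_on k f U)"

text \<open>Multi-indices are functions \<open>\<alpha>\<close> from vectors to naturals vanishing off the orthonormal basis
  \<open>Basis\<close>; only the values on \<open>Basis\<close> matter. Near each point the function is the (unconditionally
  convergent) sum of a power series in the real coordinates.\<close>

definition multi_indices :: "('a::euclidean_space \<Rightarrow> nat) set"
  where "multi_indices = {\<alpha>. \<forall>b. b \<notin> Basis \<longrightarrow> \<alpha> b = 0}"

definition real_analytic_on :: "('a::euclidean_space \<Rightarrow> real) \<Rightarrow> 'a set \<Rightarrow> bool"
  where "real_analytic_on f U \<longleftrightarrow>
    (\<forall>p\<in>U. \<exists>c r. r > 0 \<and>
       (\<forall>x\<in>ball p r. ((\<lambda>\<alpha>. c \<alpha> * (\<Prod>b\<in>Basis. ((x - p) \<bullet> b) ^ \<alpha> b)) has_sum f x) multi_indices))"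

text \<open>The germ at \<open>p\<close> of a subset \<open>M\<close> of \<open>\<complex>\<^sup>n\<close> (or of any Euclidean space) is a real-analytic real
  hypersurface if \<open>M\<close> has, near \<open>p\<close>, a real-analytic defining function with nowhere vanishing
  differential.\<close>

definition real_analytic_hypersurface_germ :: "'a::euclidean_space set \<Rightarrow> 'a \<Rightarrow> bool"
  where "real_analytic_hypersurface_germ M p \<longleftrightarrow>
    p \<in> M \<and>
    (\<exists>W r. open W \<and> p \<in> W \<and> real_analytic_on r W \<and>
       (\<forall>q\<in>W. \<exists>v. frechet_derivative r (at q) v \<noteq> 0) \<and>
       M \<inter> W = {q \<in> W. r q = 0})"

section \<open>Wirtinger derivatives\<close>

definition dz :: "'n::finite \<Rightarrow> (complex^'n \<Rightarrow> complex) \<Rightarrow> complex^'n \<Rightarrow> complex"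
  where "dz j f p =
    (frechet_derivative f (at p) (axis j 1) - \<i> * frechet_derivative f (at p) (axis j \<i>)) / 2"

definition dzb :: "'n::finite \<Rightarrow> (complex^'n \<Rightarrow> complex) \<Rightarrow> complex^'n \<Rightarrow> complex"
  where "dzb j f p =
    (frechet_derivative f (at p) (axis j 1) + \<i> * frechet_derivative f (at p) (axis j \<i>)) / 2"

section \<open>Rigid hypersurfaces in \<open>\<complex>\<^sup>3\<close>\<close>

definition rigid_hypersurface :: "(complex^2) set \<Rightarrow> (complex^2 \<Rightarrow> real) \<Rightarrow> (complex^3) set"
  where "rigid_hypersurface U F =
    {z. vector [z $ 1, z $ 2] \<in> U \<and> Re (z $ 3) = F (vector [z $ 1, z $ 2])}"

text \<open>The mixed second derivative \<open>F\<^sub>j\<^sub>k\<close>, the index \<open>k\<close> being barred.\<close>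

definition mixed :: "(complex^2 \<Rightarrow> real) \<Rightarrow> 2 \<Rightarrow> 2 \<Rightarrow> complex^2 \<Rightarrow> complex"
  where "mixed F j k = dzb k (dz j (\<lambda>p. complex_of_real (F p)))"

text \<open>Take the defining function \<open>\<rho> = F - Re z\<^sub>3\<close> and the frame
  \<open>L\<^sub>j = \<partial>/\<partial>z\<^sub>j + 2 F\<^sub>j \<partial>/\<partial>z\<^sub>3\<close> (\<open>j = 1, 2\<close>) of the bundle of (1,0)-vectors tangent to the
  hypersurface. As \<open>\<rho>\<close> is the sum of \<open>F\<close> and a pluriharmonic function of \<open>z\<^sub>3\<close>, the Levi form
  has in this frame the matrix of the mixed second derivatives of \<open>F\<close>.\<close>

definition levi_matrix :: "(complex^2 \<Rightarrow> real) \<Rightarrow> complex^2 \<Rightarrow> complex^2^2"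
  where "levi_matrix F p = (\<chi> j k. mixed F j k p)"

text \<open>Finite nondegeneracy in the sense of Baouendi, Ebenfelt and Rothschild: \<open>M\<close> is
  \<open>k\<close>-nondegenerate at a point if \<open>k\<close> is the least number for which the vectors obtained by
  applying at most \<open>k\<close> of the conjugate fields to the complex gradient \<open>\<rho>\<^sub>z\<close> span \<open>\<complex>\<^sup>3\<close>.
  Here \<open>\<rho>\<^sub>z = (F\<^sub>1, F\<^sub>2, -1/2)\<close> does not depend on \<open>z\<^sub>3\<close>, so the conjugate of \<open>L\<^sub>j\<close> acts on it as
  the derivative with respect to the conjugate of \<open>z\<^sub>j\<close>. The span is the complex one.\<close>

definition rho_grad :: "(complex^2 \<Rightarrow> real) \<Rightarrow> complex^2 \<Rightarrow> complex^3"
  where "rho_grad F p =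
    vector [dz 1 (\<lambda>q. complex_of_real (F q)) p, dz 2 (\<lambda>q. complex_of_real (F q)) p, - 1 / 2]"

definition conj_derivs_span :: "nat \<Rightarrow> (complex^2 \<Rightarrow> real) \<Rightarrow> complex^2 \<Rightarrow> (complex^3) set"
  where "conj_derivs_span k F p =
    vec.span {\<chi> m. foldr dzb js (\<lambda>q. rho_grad F q $ m) p | js. length js \<le> k}"

definition nondegenerate_at :: "nat \<Rightarrow> (complex^2 \<Rightarrow> real) \<Rightarrow> complex^2 \<Rightarrow> bool"
  where "nondegenerate_at k F p \<longleftrightarrow>
    conj_derivs_span k F p = UNIV \<and> (\<forall>l<k. conj_derivs_span l F p \<noteq> UNIV)"

text \<open>The hypersurface with graphing function \<open>F\<close> over \<open>U\<close> belongs to the class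
  \<open>\<CC>\<^sub>2\<^sub>,\<^sub>1\<close>. Neither the Levi matrix nor the nondegeneracy condition depends on \<open>z\<^sub>3\<close>, so
  conditions at all points of the hypersurface are conditions at all points of \<open>U\<close>.\<close>

definition class_C21 :: "(complex^2) set \<Rightarrow> (complex^2 \<Rightarrow> real) \<Rightarrow> bool"
  where "class_C21 U F \<longleftrightarrow>
    connected (rigid_hypersurface U F) \<and>
    (\<forall>p\<in>U. rank (levi_matrix F p) = 1) \<and>
    (\<forall>p\<in>U. nondegenerate_at 2 F p)"

definition S_invariant :: "(complex^2 \<Rightarrow> real) \<Rightarrow> complex^2 \<Rightarrow> complex"
  where "S_invariant F = dz 1 (\<lambda>p. mixed F 1 2 p / mixed F 1 1 p)"

end

theory Submission
  imports Defs
begin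

text \<open>Write \<open>f\<close> for the graphing function with values regarded as complex, let an index be a
  derivative in \<open>z\<^sub>1\<close> or \<open>z\<^sub>2\<close> and let a prime mark a conjugate variable. Put
  \<open>g = f\<^sub>1\<^sub>1'\<close>, \<open>\<epsilon> = f\<^sub>1\<^sub>2' / g\<close>, \<open>S = \<epsilon>\<^sub>1\<close> and \<open>\<nu> = g\<^sub>2' / g\<close>.

  The idea is that these functions satisfy a first-order differential system which is closed up to
  antiholomorphic coefficients. Degeneracy of the Levi matrix says that \<open>f\<^sub>2\<^sub>2' = g \<epsilon> cnj \<epsilon>\<close>. As \<open>g\<close>
  depends on \<open>z\<^sub>2\<close> only, one has \<open>\<epsilon>\<^sub>1' = \<nu>\<close>, and the \<open>z\<^sub>1\<close>-derivative of the degeneracy condition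
  becomes \<open>\<epsilon>\<^sub>2 = S cnj \<epsilon>\<close> (lemma \<open>\<epsilon>_2\<close>). Since \<open>S\<close> depends on \<open>z\<^sub>2\<close> only as well, differentiating
  once more in \<open>z\<^sub>1\<close> and in its conjugate gives \<open>S\<^sub>2 = S cnj \<nu>\<close> and \<open>\<nu>\<^sub>2 = S cnj S\<close>, the latter being an
  equation of Liouville type for \<open>ln g\<close>. By 2-nondegeneracy \<open>S\<close> has no zeros, so \<open>m = S\<^sub>2' / S\<close> makes
  sense; the identities just found imply that \<open>\<kappa> = m - \<nu>\<close> and \<open>Q = \<epsilon>\<^sub>2' - m \<epsilon>\<close> are annihilated by
  both holomorphic derivatives. The function \<open>\<kappa>\<close> is the logarithmic derivative of \<open>S / g\<close>, and
  \<open>Q\<^sub>1'\<close> is, up to conjugation, the Schwarzian-type first integral which linearises the Liouville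
  equation. All first derivatives of \<open>g\<close>, \<open>\<nu>\<close>, \<open>S\<close>, \<open>\<epsilon>\<close> are now polynomials of degree at most two in
  these functions and their conjugates, with coefficients built from \<open>\<kappa>\<close>, \<open>Q\<close> and \<open>Q\<^sub>1'\<close>
  (theorem \<open>f_cauchy_bounded\<close>).

  Analyticity is handled through Cauchy estimates: locally, all derivatives of order \<open>n\<close> are bounded
  by \<open>C R\<^sup>n n!\<close>. Three facts make this work. Solutions of a quadratic system obey Cauchy estimates if
  the coefficients do (theorem \<open>quadratic_system_cauchy_bounded\<close>, by comparing Leibniz sums). A smooth
  function obeys them if its derivatives in the conjugate variables do
  (theorem \<open>cauchy_riemann_regularity\<close>, by circle averages on shrinking balls); this covers holomorphic
  functions, and it leads from the mixed derivatives of \<open>f\<close> to \<open>f\<^sub>1\<close>, \<open>f\<^sub>2\<close> and \<open>f\<close>. Finally, Cauchy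
  estimates yield convergent power series (theorem \<open>real_analytic_on_if_derivative_bounds\<close>).\<close>

section \<open>Calculus of smooth functions\<close>

lemma Ck_on_cong:
  assumes "open U" "\<forall>p\<in>U. f p = g p"
  shows "Ck_on k f U \<longleftrightarrow> Ck_on k g U"
  using assms(2)
proof (induction k arbitrary: f g)
  case 0
  then show ?case by (auto cong: continuous_on_cong)
next
  case (Suc k)
  have diff: "f differentiable at p \<longleftrightarrow> g differentiable at p" if "p \<in> U" for p
    using Suc.prems assms(1) that unfolding differentiable_def
    by (metis has_derivative_transform_within_open)
  show ?case
  proof (cases "\<forall>p\<in>U. f differentiable at p")
    case True
    have "frechet_derivative f (at p) = frechet_derivative g (at p)" if "p \<in> U" for p
      using frechet_derivative_transform_within_open[OF _ assms(1) that] True Suc.prems that by blast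
    then have "Ck_on k (\<lambda>p. frechet_derivative f (at p) v) U
        \<longleftrightarrow> Ck_on k (\<lambda>p. frechet_derivative g (at p) v) U" for v
      by (intro Suc.IH) auto
    then show ?thesis using diff by auto
  next
    case False
    then show ?thesis using diff by auto
  qed
qed

lemma smooth_on_cong:
  assumes "open U" "\<forall>p\<in>U. f p = g p"
  shows "smooth_on f U \<longleftrightarrow> smooth_on g U"
  using Ck_on_cong[OF assms] unfolding smooth_on_def by blast

lemma Ck_on_Suc_imp: "Ck_on (Suc k) f U \<Longrightarrow> Ck_on k f U"
proof (induction k arbitrary: f)
  case 0
  then show ?case
    by (auto intro!: continuous_at_imp_continuous_on differentiable_imp_continuous_within)
next
  case (Suc k)
  then show ?case by (metis Ck_on.simps(2))
qed

lemma smooth_on_differentiable: "smooth_on f U \<Longrightarrow> p \<in> U \<Longrightarrow> f differentiable at p"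
  unfolding smooth_on_def by (metis Ck_on.simps(2))

lemma smooth_on_has_derivative:
  "smooth_on f U \<Longrightarrow> p \<in> U \<Longrightarrow> (f has_derivative frechet_derivative f (at p)) (at p)"
  using smooth_on_differentiable frechet_derivative_works by blast

lemma smooth_on_continuous: "smooth_on f U \<Longrightarrow> continuous_on U f"
  unfolding smooth_on_def by (metis Ck_on.simps(1))

lemma smooth_on_directional: "smooth_on f U \<Longrightarrow> smooth_on (\<lambda>p. frechet_derivative f (at p) v) U"
  unfolding smooth_on_def by (metis Ck_on.simps(2))

lemma Ck_on_const: "Ck_on k (\<lambda>p. c) U"
  by (induction k arbitrary: c) auto

lemma Ck_on_bounded_linear:
  assumes "bounded_linear L"
  shows "Ck_on k L U"
proof (cases k)
  case 0
  then show ?thesis using assms by (simp add: linear_continuous_on)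
next
  case (Suc n)
  have "frechet_derivative L (at p) = L" for p
    using assms bounded_linear_imp_has_derivative frechet_derivative_at by metis
  then show ?thesis
    using Suc assms by (simp add: Ck_on_const bounded_linear_imp_differentiable)
qed

lemma Ck_on_add:
  assumes "open U"
  shows "Ck_on k f U \<Longrightarrow> Ck_on k g U \<Longrightarrow> Ck_on k (\<lambda>p. f p + g p) U"
proof (induction k arbitrary: f g)
  case 0
  then show ?case by (auto intro: continuous_intros)
next
  case (Suc k)
  have "Ck_on k (\<lambda>p. frechet_derivative (\<lambda>p. f p + g p) (at p) v) U" for v
  proof -
    have "frechet_derivative (\<lambda>p. f p + g p) (at p) v
        = frechet_derivative f (at p) v + frechet_derivative g (at p) v" if "p \<in> U" for p
      using Suc.prems that
      by (intro fun_cong[OF frechet_derivative_at[symmetric]] has_derivative_add)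
         (auto simp: frechet_derivative_works)
    moreover have "Ck_on k (\<lambda>p. frechet_derivative f (at p) v + frechet_derivative g (at p) v) U"
      using Suc by auto
    ultimately show ?thesis by (subst Ck_on_cong[OF assms]) auto
  qed
  then show ?case using Suc.prems by auto
qed

lemma Ck_on_compose_bounded_linear:
  assumes "open U" "bounded_linear L"
  shows "Ck_on k f U \<Longrightarrow> Ck_on k (\<lambda>p. L (f p)) U"
proof (induction k arbitrary: f)
  case 0
  then show ?case using assms(2) by (auto intro: bounded_linear.continuous_on)
next
  case (Suc k)
  have hd: "((\<lambda>p. L (f p)) has_derivative (\<lambda>v. L (frechet_derivative f (at p) v))) (at p)"
    if "p \<in> U" for p
    using Suc.prems that
    by (intro bounded_linear.has_derivative[OF assms(2)]) (auto simp: frechet_derivative_works)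
  have "Ck_on k (\<lambda>p. frechet_derivative (\<lambda>p. L (f p)) (at p) v) U" for v
  proof -
    have "frechet_derivative (\<lambda>p. L (f p)) (at p) v = L (frechet_derivative f (at p) v)"
      if "p \<in> U" for p
      using fun_cong[OF frechet_derivative_at[OF hd[OF that], symmetric]] .
    moreover have "Ck_on k (\<lambda>p. L (frechet_derivative f (at p) v)) U"
      using Suc by auto
    ultimately show ?thesis by (subst Ck_on_cong[OF assms(1)]) auto
  qed
  then show ?case using hd by (auto simp: differentiable_def)
qed

lemma Ck_on_mult:
  fixes f g :: "'a::euclidean_space \<Rightarrow> 'b::real_normed_algebra"
  assumes "open U"
  shows "Ck_on k f U \<Longrightarrow> Ck_on k g U \<Longrightarrow> Ck_on k (\<lambda>p. f p * g p) U"
proof (induction k arbitrary: f g)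
  case 0
  then show ?case by (auto intro: continuous_intros)
next
  case (Suc k)
  have hd: "((\<lambda>p. f p * g p) has_derivative (\<lambda>v. f p * frechet_derivative g (at p) v
      + frechet_derivative f (at p) v * g p)) (at p)"
    if "p \<in> U" for p
    using Suc.prems that
    by (intro has_derivative_mult) (auto simp: frechet_derivative_works)
  have "Ck_on k (\<lambda>p. frechet_derivative (\<lambda>p. f p * g p) (at p) v) U" for v
  proof -
    have "frechet_derivative (\<lambda>p. f p * g p) (at p) v
        = f p * frechet_derivative g (at p) v + frechet_derivative f (at p) v * g p"
      if "p \<in> U" for p
      using fun_cong[OF frechet_derivative_at[OF hd[OF that], symmetric]] .
    moreover have "Ck_on k (\<lambda>p. f p * frechet_derivative g (at p) v
        + frechet_derivative f (at p) v * g p) U"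
      using Suc Ck_on_Suc_imp[OF Suc.prems(1)] Ck_on_Suc_imp[OF Suc.prems(2)]
      by (intro Ck_on_add[OF assms] Suc.IH) auto
    ultimately show ?thesis by (subst Ck_on_cong[OF assms(1)]) auto
  qed
  then show ?case using hd by (auto simp: differentiable_def)
qed

lemma Ck_on_inverse:
  fixes f :: "'a::euclidean_space \<Rightarrow> 'b::real_normed_field"
  assumes "open U" "\<forall>p\<in>U. f p \<noteq> 0"
  shows "Ck_on k f U \<Longrightarrow> Ck_on k (\<lambda>p. inverse (f p)) U"
proof (induction k)
  case 0
  then show ?case using assms by (auto intro: continuous_intros)
next
  case (Suc k)
  have hd: "((\<lambda>p. inverse (f p)) has_derivative
      (\<lambda>v. - (inverse (f p) * frechet_derivative f (at p) v * inverse (f p)))) (at p)"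
    if "p \<in> U" for p
    using Suc.prems that assms(2)
    by (intro Deriv.has_derivative_inverse) (auto simp: frechet_derivative_works)
  have "Ck_on k (\<lambda>p. frechet_derivative (\<lambda>p. inverse (f p)) (at p) v) U" for v
  proof -
    have "frechet_derivative (\<lambda>p. inverse (f p)) (at p) v
        = - (inverse (f p) * frechet_derivative f (at p) v * inverse (f p))"
      if "p \<in> U" for p
      using fun_cong[OF frechet_derivative_at[OF hd[OF that], symmetric]] .
    moreover have "Ck_on k (\<lambda>p. - (inverse (f p) * frechet_derivative f (at p) v * inverse (f p))) U"
      using Suc.prems Suc.IH[OF Ck_on_Suc_imp[OF Suc.prems]]
      by (intro Ck_on_compose_bounded_linear[OF assms(1) bounded_linear_minus[OF bounded_linear_ident]]
          Ck_on_mult[OF assms(1)]) auto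
    ultimately show ?thesis by (subst Ck_on_cong[OF assms(1)]) auto
  qed
  then show ?case using hd by (auto simp: differentiable_def)
qed

lemma smooth_on_const [simp]: "smooth_on (\<lambda>p. c) U"
  by (simp add: smooth_on_def Ck_on_const)

lemma smooth_on_bounded_linear: "bounded_linear L \<Longrightarrow> smooth_on L U"
  by (simp add: smooth_on_def Ck_on_bounded_linear)

lemma smooth_on_add: "open U \<Longrightarrow> smooth_on f U \<Longrightarrow> smooth_on g U \<Longrightarrow> smooth_on (\<lambda>p. f p + g p) U"
  by (simp add: smooth_on_def Ck_on_add)

lemma smooth_on_compose_bounded_linear:
  "open U \<Longrightarrow> bounded_linear L \<Longrightarrow> smooth_on f U \<Longrightarrow> smooth_on (\<lambda>p. L (f p)) U"
  by (simp add: smooth_on_def Ck_on_compose_bounded_linear)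

lemma smooth_on_minus: "open U \<Longrightarrow> smooth_on f U \<Longrightarrow> smooth_on (\<lambda>p. - f p) U"
  by (rule smooth_on_compose_bounded_linear[OF _ bounded_linear_minus[OF bounded_linear_ident]])

lemma smooth_on_diff: "open U \<Longrightarrow> smooth_on f U \<Longrightarrow> smooth_on g U \<Longrightarrow> smooth_on (\<lambda>p. f p - g p) U"
  using smooth_on_add[of U f "\<lambda>p. - g p"] smooth_on_minus[of U g] by simp

lemma smooth_on_mult:
  fixes f g :: "'a::euclidean_space \<Rightarrow> 'b::real_normed_algebra"
  shows "open U \<Longrightarrow> smooth_on f U \<Longrightarrow> smooth_on g U \<Longrightarrow> smooth_on (\<lambda>p. f p * g p) U"
  by (simp add: smooth_on_def Ck_on_mult)

lemma smooth_on_divide: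
  fixes f g :: "'a::euclidean_space \<Rightarrow> 'b::real_normed_field"
  shows "open U \<Longrightarrow> smooth_on f U \<Longrightarrow> smooth_on g U \<Longrightarrow> \<forall>p\<in>U. g p \<noteq> 0
    \<Longrightarrow> smooth_on (\<lambda>p. f p / g p) U"
  by (simp add: divide_inverse smooth_on_def Ck_on_mult Ck_on_inverse)

lemma smooth_on_sum:
  assumes "open U" "\<And>i. i \<in> I \<Longrightarrow> smooth_on (f i) U"
  shows "smooth_on (\<lambda>p. \<Sum>i\<in>I. f i p) U"
  using assms(2) by (induction I rule: infinite_finite_induct) (auto intro: smooth_on_add[OF assms(1)])

lemma has_derivative_along_line:
  assumes "(g has_derivative g') (at (a + t *\<^sub>R v))"
  shows "((\<lambda>t. g (a + t *\<^sub>R v)) has_derivative (\<lambda>d. d *\<^sub>R g' v)) (at t within S)"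
proof -
  have "((\<lambda>t. a + t *\<^sub>R v) has_derivative (\<lambda>d. d *\<^sub>R v)) (at t within S)"
    by (auto intro!: derivative_eq_intros)
  from has_derivative_compose[OF this assms] show ?thesis
    using has_derivative_linear[OF assms] by (simp add: linear_cmul)
qed

text \<open>Two applications of the mean value inequality, one in the direction \<open>u\<close> and one in the direction
  \<open>v\<close>. The second difference of \<open>f\<close> is symmetric in \<open>u\<close> and \<open>v\<close>, so that exchanging their roles
  compares the two iterated derivatives at \<open>p\<close> with the same quantity.\<close>

lemma second_difference_bound:
  fixes f :: "'a::euclidean_space \<Rightarrow> 'b::real_normed_vector"
  assumes sm: "smooth_on f U"
    and h: "h > 0"
    and inU: "\<And>s t. s \<in> {0..h} \<Longrightarrow> t \<in> {0..h} \<Longrightarrow> p + s *\<^sub>R u + t *\<^sub>R v \<in> U"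
    and bd: "\<And>s t. s \<in> {0..h} \<Longrightarrow> t \<in> {0..h} \<Longrightarrow>
      norm (frechet_derivative (\<lambda>q. frechet_derivative f (at q) u) (at (p + s *\<^sub>R u + t *\<^sub>R v)) v - A) \<le> e"
  shows "norm (f (p + h *\<^sub>R u + h *\<^sub>R v) - f (p + h *\<^sub>R u) - f (p + h *\<^sub>R v) + f p - (h * h) *\<^sub>R A) \<le> e * h * h"
proof -
  let ?Du = "\<lambda>q. frechet_derivative f (at q) u"
  have smu: "smooth_on ?Du U" by (rule smooth_on_directional[OF sm])
  have inner: "norm (?Du (p + s *\<^sub>R u + h *\<^sub>R v) - ?Du (p + s *\<^sub>R u) - h *\<^sub>R A) \<le> e * h"
    if s: "s \<in> {0..h}" for s
  proof -
    let ?K = "\<lambda>t. ?Du (p + s *\<^sub>R u + t *\<^sub>R v) - t *\<^sub>R A"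
    let ?K' = "\<lambda>t. frechet_derivative ?Du (at (p + s *\<^sub>R u + t *\<^sub>R v)) v - A"
    have "norm (?K h - ?K 0) \<le> e * norm (h - 0)"
    proof (rule differentiable_bound[where S = "{0..h}" and f' = "\<lambda>t d. d *\<^sub>R ?K' t"])
      fix t assume t: "t \<in> {0..h}"
      have "((\<lambda>t. ?Du (p + s *\<^sub>R u + t *\<^sub>R v)) has_derivative
          (\<lambda>d. d *\<^sub>R frechet_derivative ?Du (at (p + s *\<^sub>R u + t *\<^sub>R v)) v)) (at t within {0..h})"
        by (rule has_derivative_along_line[OF smooth_on_has_derivative[OF smu inU[OF s t]]])
      then show "(?K has_derivative (\<lambda>d. d *\<^sub>R ?K' t)) (at t within {0..h})"
        by (auto intro!: derivative_eq_intros simp: algebra_simps)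
      show "onorm (\<lambda>d. d *\<^sub>R ?K' t) \<le> e"
        using bd[OF s t] by (intro onorm_le) (metis mult.commute mult_left_mono norm_ge_zero norm_scaleR real_norm_def)
    qed (use h in auto)
    then show ?thesis using h by (simp add: algebra_simps)
  qed
  let ?G = "\<lambda>s. f (p + s *\<^sub>R u + h *\<^sub>R v) - f (p + s *\<^sub>R u) - (s * h) *\<^sub>R A"
  let ?G' = "\<lambda>s. ?Du (p + s *\<^sub>R u + h *\<^sub>R v) - ?Du (p + s *\<^sub>R u) - h *\<^sub>R A"
  have "norm (?G h - ?G 0) \<le> (e * h) * norm (h - 0)"
  proof (rule differentiable_bound[where S = "{0..h}" and f' = "\<lambda>s d. d *\<^sub>R ?G' s"])
    fix s assume s: "s \<in> {0..h}"
    have *: "((\<lambda>s. f (p + s *\<^sub>R u + t *\<^sub>R v)) has_derivative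
          (\<lambda>d. d *\<^sub>R ?Du (p + s *\<^sub>R u + t *\<^sub>R v))) (at s within {0..h})" if t: "t \<in> {0..h}" for t
      using has_derivative_along_line[of f _ "p + t *\<^sub>R v" s u] smooth_on_has_derivative[OF sm inU[OF s t]]
      by (simp add: algebra_simps)
    have "((\<lambda>s. f (p + s *\<^sub>R u)) has_derivative (\<lambda>d. d *\<^sub>R ?Du (p + s *\<^sub>R u))) (at s within {0..h})"
      using *[of 0] h by simp
    then show "(?G has_derivative (\<lambda>d. d *\<^sub>R ?G' s)) (at s within {0..h})"
      using *[of h] h by (auto intro!: derivative_eq_intros simp: algebra_simps)
    show "onorm (\<lambda>d. d *\<^sub>R ?G' s) \<le> e * h"
      using inner[OF s] by (intro onorm_le) (metis mult.commute mult_left_mono norm_ge_zero norm_scaleR real_norm_def)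
  qed (use h in auto)
  then show ?thesis using h by (simp add: algebra_simps)
qed

text \<open>Both iterated derivatives are limits of the same second difference quotient.\<close>

theorem directional_derivatives_commute:
  fixes f :: "'a::euclidean_space \<Rightarrow> 'b::real_normed_vector"
  assumes sm: "smooth_on f U" and U: "open U" "p \<in> U"
  shows "frechet_derivative (\<lambda>q. frechet_derivative f (at q) u) (at p) v
    = frechet_derivative (\<lambda>q. frechet_derivative f (at q) v) (at p) u" (is "?A = ?B")
proof -
  have small: "norm (?A - ?B) \<le> 2 * e" if e: "e > 0" for e
  proof -
    have close: "\<exists>d>0. \<forall>q\<in>ball p d. q \<in> U \<and>
      norm (frechet_derivative (\<lambda>q. frechet_derivative f (at q) u) (at q) v
        - frechet_derivative (\<lambda>q. frechet_derivative f (at q) u) (at p) v) \<le> e" for u v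
    proof -
      have "continuous_on U (\<lambda>q. frechet_derivative (\<lambda>q. frechet_derivative f (at q) u) (at q) v)"
        by (intro smooth_on_continuous smooth_on_directional sm)
      then obtain d where d: "d > 0" "\<And>q. q \<in> U \<Longrightarrow> dist q p < d \<Longrightarrow>
        dist (frechet_derivative (\<lambda>q. frechet_derivative f (at q) u) (at q) v)
        (frechet_derivative (\<lambda>q. frechet_derivative f (at q) u) (at p) v) < e"
        unfolding continuous_on_iff using e U(2) by blast
      obtain d' where d': "d' > 0" "ball p d' \<subseteq> U"
        using U open_contains_ball by blast
      show ?thesis
      proof (intro exI[of _ "min d d'"] conjI ballI)
        fix q assume q: "q \<in> ball p (min d d')"
        show qU: "q \<in> U" using q d'(2) by auto
        have "dist q p < d" using q by (simp add: dist_commute)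
        from d(2)[OF qU this]
        show "norm (frechet_derivative (\<lambda>q. frechet_derivative f (at q) u) (at q) v
          - frechet_derivative (\<lambda>q. frechet_derivative f (at q) u) (at p) v) \<le> e"
          unfolding dist_norm by (rule less_imp_le)
      qed (use d(1) d'(1) in simp)
    qed
    obtain d1 where d1: "d1 > 0" "\<forall>q\<in>ball p d1. q \<in> U \<and>
      norm (frechet_derivative (\<lambda>q. frechet_derivative f (at q) u) (at q) v - ?A) \<le> e"
      using close[of u v] by blast
    obtain d2 where d2: "d2 > 0" "\<forall>q\<in>ball p d2. q \<in> U \<and>
      norm (frechet_derivative (\<lambda>q. frechet_derivative f (at q) v) (at q) u - ?B) \<le> e"
      using close[of v u] by blast
    define h where "h = min d1 d2 / (2 * (norm u + norm v + 1))"
    have pos: "0 < norm u + norm v + 1" using norm_ge_zero[of u] norm_ge_zero[of v] by linarith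
    have d0: "0 < min d1 d2" using d1 d2 by simp
    have h: "h > 0" using d0 pos by (simp add: h_def)
    have hs: "h * (norm u + norm v) < min d1 d2"
    proof -
      have "h * (norm u + norm v) \<le> h * (norm u + norm v + 1)" using h by simp
      also have "\<dots> = min d1 d2 / 2" using pos by (simp add: h_def field_simps)
      also have "\<dots> < min d1 d2" using d0 by linarith
      finally show ?thesis .
    qed
    have inb: "p + s *\<^sub>R u + t *\<^sub>R v \<in> ball p (min d1 d2)" if "s \<in> {0..h}" "t \<in> {0..h}" for s t
    proof -
      have "norm (s *\<^sub>R u + t *\<^sub>R v) \<le> s * norm u + t * norm v"
        using that norm_triangle_ineq[of "s *\<^sub>R u" "t *\<^sub>R v"] by simp
      also have "\<dots> \<le> h * norm u + h * norm v"
        using that by (intro add_mono mult_right_mono) auto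
      finally have "norm (s *\<^sub>R u + t *\<^sub>R v) < min d1 d2"
        using hs by (simp add: algebra_simps)
      moreover have "dist p (p + s *\<^sub>R u + t *\<^sub>R v) = norm (s *\<^sub>R u + t *\<^sub>R v)"
        by (metis add.assoc add_diff_cancel_left' dist_norm norm_minus_commute)
      ultimately show ?thesis by simp
    qed
    let ?D = "f (p + h *\<^sub>R u + h *\<^sub>R v) - f (p + h *\<^sub>R u) - f (p + h *\<^sub>R v) + f p"
    have 1: "norm (?D - (h * h) *\<^sub>R ?A) \<le> e * h * h"
      using inb d1 by (intro second_difference_bound[OF sm h]) auto
    have "norm (f (p + h *\<^sub>R v + h *\<^sub>R u) - f (p + h *\<^sub>R v) - f (p + h *\<^sub>R u) + f p - (h * h) *\<^sub>R ?B) \<le> e * h * h"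
    proof (rule second_difference_bound[OF sm h])
      fix s t assume "s \<in> {0..h}" "t \<in> {0..h}"
      then have "p + s *\<^sub>R v + t *\<^sub>R u \<in> ball p d2"
        using inb[of t s] by (simp add: add.assoc add.commute[of "s *\<^sub>R v"])
      then show "p + s *\<^sub>R v + t *\<^sub>R u \<in> U"
        "norm (frechet_derivative (\<lambda>q. frechet_derivative f (at q) v) (at (p + s *\<^sub>R v + t *\<^sub>R u)) u - ?B) \<le> e"
        using d2 by auto
    qed
    moreover have "f (p + h *\<^sub>R v + h *\<^sub>R u) - f (p + h *\<^sub>R v) - f (p + h *\<^sub>R u) + f p = ?D"
      by (simp add: add.assoc add.commute[of "h *\<^sub>R v"])
    ultimately have 2: "norm (?D - (h * h) *\<^sub>R ?B) \<le> e * h * h" by simp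
    have "norm ((h * h) *\<^sub>R (?A - ?B)) = norm ((?D - (h * h) *\<^sub>R ?B) - (?D - (h * h) *\<^sub>R ?A))"
      by (simp add: scaleR_diff_right)
    also have "\<dots> \<le> e * h * h + e * h * h"
      using 1 2 norm_triangle_ineq4[of "?D - (h * h) *\<^sub>R ?B" "?D - (h * h) *\<^sub>R ?A"] by linarith
    finally have "(h * h) * norm (?A - ?B) \<le> (h * h) * (2 * e)"
      unfolding norm_scaleR by (simp add: mult_ac)
    then show ?thesis using h by simp
  qed
  have "norm (?A - ?B) \<le> 0"
  proof (rule field_le_epsilon)
    fix e :: real assume "e > 0"
    then show "norm (?A - ?B) \<le> 0 + e" using small[of "e / 2"] by simp
  qed
  then show ?thesis by simp
qed

section \<open>Wirtinger derivatives as derivations\<close>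

text \<open>A letter \<open>(b, j)\<close> stands for the derivative in \<open>z\<^sub>j\<close> (\<open>b = False\<close>) or in its conjugate
  (\<open>b = True\<close>). With letters as data, iterated derivatives are indexed by words, that is by lists.\<close>

definition wirt :: "bool \<times> 'n::finite \<Rightarrow> (complex^'n \<Rightarrow> complex) \<Rightarrow> complex^'n \<Rightarrow> complex" where
  "wirt d f p = (frechet_derivative f (at p) (axis (snd d) 1)
    + (if fst d then \<i> else - \<i>) * frechet_derivative f (at p) (axis (snd d) \<i>)) / 2"

lemma dz_eq_wirt: "dz j = wirt (False, j)"
  by (intro ext) (simp add: dz_def wirt_def)

lemma dzb_eq_wirt: "dzb j = wirt (True, j)"
  by (intro ext) (simp add: dzb_def wirt_def)

lemma wirt_eq:
  assumes "(f has_derivative f') (at p)"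
  shows "wirt d f p = (f' (axis (snd d) 1) + (if fst d then \<i> else - \<i>) * f' (axis (snd d) \<i>)) / 2"
  using frechet_derivative_at[OF assms] by (simp add: wirt_def)

lemma wirt_cong:
  assumes "open U" "p \<in> U" "\<And>q. q \<in> U \<Longrightarrow> f q = g q" "f differentiable at p"
  shows "wirt d f p = wirt d g p"
  using frechet_derivative_transform_within_open[OF assms(4,1,2)] assms(3) by (simp add: wirt_def)

lemma wirt_const [simp]: "wirt d (\<lambda>p. c) = (\<lambda>p. 0)"
  by (intro ext) (simp add: wirt_def)

lemma wirt_add:
  assumes "f differentiable at p" "g differentiable at p"
  shows "wirt d (\<lambda>p. f p + g p) p = wirt d f p + wirt d g p"
  using assms unfolding frechet_derivative_works
  by (subst wirt_eq[OF has_derivative_add]) (auto simp: wirt_def field_simps)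

lemma wirt_diff:
  assumes "f differentiable at p" "g differentiable at p"
  shows "wirt d (\<lambda>p. f p - g p) p = wirt d f p - wirt d g p"
  using assms unfolding frechet_derivative_works
  by (subst wirt_eq[OF has_derivative_diff]) (auto simp: wirt_def field_simps)

lemma wirt_mult:
  assumes "f differentiable at p" "g differentiable at p"
  shows "wirt d (\<lambda>p. f p * g p) p = wirt d f p * g p + f p * wirt d g p"
  using assms unfolding frechet_derivative_works
  by (subst wirt_eq[OF has_derivative_mult]) (auto simp: wirt_def field_simps)

lemma wirt_cnj:
  assumes "f differentiable at p"
  shows "wirt d (\<lambda>p. cnj (f p)) p = cnj (wirt (\<not> fst d, snd d) f p)"
  using assms unfolding frechet_derivative_works
  by (subst wirt_eq[OF has_derivative_cnj]) (auto simp: wirt_def)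

lemma wirt_divide:
  assumes "f differentiable at p" "g differentiable at p" "g p \<noteq> 0"
  shows "wirt d (\<lambda>p. f p / g p) p = (wirt d f p * g p - f p * wirt d g p) / (g p)\<^sup>2"
proof -
  have "(f has_derivative frechet_derivative f (at p)) (at p)"
    "(g has_derivative frechet_derivative g (at p)) (at p)"
    using assms frechet_derivative_works by blast+
  from wirt_eq[OF has_derivative_divide'[OF this assms(3)], of d] show ?thesis
    by (simp add: wirt_def[of d f] wirt_def[of d g] diff_divide_distrib add_divide_distrib
        ring_distribs power2_eq_square mult_ac)
qed

lemma smooth_on_wirt:
  assumes "open U" "smooth_on f U"
  shows "smooth_on (wirt d f) U"
proof -
  have "smooth_on (\<lambda>p. (frechet_derivative f (at p) (axis (snd d) 1)
    + (if fst d then \<i> else - \<i>) * frechet_derivative f (at p) (axis (snd d) \<i>)) * (1 / 2)) U"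
    by (intro smooth_on_mult smooth_on_add smooth_on_directional smooth_on_const assms)
  then show ?thesis by (simp add: wirt_def[abs_def])
qed

lemma smooth_on_cnj: "open U \<Longrightarrow> smooth_on f U \<Longrightarrow> smooth_on (\<lambda>p. cnj (f p)) U"
  by (rule smooth_on_compose_bounded_linear[OF _ bounded_linear_cnj])

lemma wirt_commute:
  assumes "open U" "smooth_on f U" "p \<in> U"
  shows "wirt d (wirt e f) p = wirt e (wirt d f) p"
proof -
  let ?D = "\<lambda>u q. frechet_derivative f (at q) u"
  have expand: "wirt d (wirt e f) p = (frechet_derivative (?D (axis (snd e) 1)) (at p) (axis (snd d) 1)
      + (if fst e then \<i> else - \<i>) * frechet_derivative (?D (axis (snd e) \<i>)) (at p) (axis (snd d) 1)
      + (if fst d then \<i> else - \<i>) * (frechet_derivative (?D (axis (snd e) 1)) (at p) (axis (snd d) \<i>)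
      + (if fst e then \<i> else - \<i>) * frechet_derivative (?D (axis (snd e) \<i>)) (at p) (axis (snd d) \<i>))) / 4"
    for d e :: "bool \<times> 'a"
  proof -
    have D: "(?D u has_derivative frechet_derivative (?D u) (at p)) (at p)" for u
      by (intro smooth_on_has_derivative[of _ U] smooth_on_directional assms)
    have "((\<lambda>q. (?D (axis (snd e) 1) q + (if fst e then \<i> else - \<i>) * ?D (axis (snd e) \<i>) q) / 2)
      has_derivative (\<lambda>v. (frechet_derivative (?D (axis (snd e) 1)) (at p) v
        + (if fst e then \<i> else - \<i>) * frechet_derivative (?D (axis (snd e) \<i>)) (at p) v) / 2)) (at p)"
      using D by (auto intro!: derivative_eq_intros)
    then have "(wirt e f has_derivative (\<lambda>v. (frechet_derivative (?D (axis (snd e) 1)) (at p) v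
        + (if fst e then \<i> else - \<i>) * frechet_derivative (?D (axis (snd e) \<i>)) (at p) v) / 2)) (at p)"
      by (simp add: wirt_def[abs_def])
    from wirt_eq[OF this, of d] show ?thesis by (simp add: add_divide_distrib ring_distribs mult.assoc)
  qed
  show ?thesis
    unfolding expand
    by (simp add: directional_derivatives_commute[OF assms(2,1,3), of "axis (snd e) _" "axis (snd d) _"]
        algebra_simps)
qed

abbreviation wirts :: "(bool \<times> 'n::finite) list \<Rightarrow> (complex^'n \<Rightarrow> complex) \<Rightarrow> complex^'n \<Rightarrow> complex" where
  "wirts w f \<equiv> foldr wirt w f"

lemma smooth_on_wirts: "open U \<Longrightarrow> smooth_on f U \<Longrightarrow> smooth_on (wirts w f) U"
  by (induction w) (auto intro: smooth_on_wirt)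

lemma wirts_cong:
  assumes "open U" "smooth_on f U" "\<And>q. q \<in> U \<Longrightarrow> f q = g q"
  shows "p \<in> U \<Longrightarrow> wirts w f p = wirts w g p"
proof (induction w arbitrary: p)
  case (Cons d w)
  have "wirt d (wirts w f) p = wirt d (wirts w g) p"
    using Cons.prems Cons.IH smooth_on_wirts[OF assms(1,2)]
    by (intro wirt_cong[OF assms(1)]) (auto intro: smooth_on_differentiable)
  then show ?case by simp
qed (use assms in simp)

lemma wirts_commute:
  assumes "open U" "smooth_on f U" "p \<in> U"
  shows "wirts w (wirt d f) p = wirt d (wirts w f) p"
  using assms(3)
proof (induction w arbitrary: p)
  case (Cons e w)
  have "wirt e (wirts w (wirt d f)) p = wirt e (wirt d (wirts w f)) p"
    using Cons assms by (intro wirt_cong[OF assms(1)])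
      (auto intro!: smooth_on_differentiable[of _ U] smooth_on_wirts smooth_on_wirt)
  also have "\<dots> = wirt d (wirt e (wirts w f)) p"
    using Cons.prems assms by (intro wirt_commute[of U] smooth_on_wirts)
  finally show ?case by simp
qed simp

lemma wirts_add:
  assumes "open U" "smooth_on f U" "smooth_on g U" "p \<in> U"
  shows "wirts w (\<lambda>p. f p + g p) p = wirts w f p + wirts w g p"
  using assms(4)
proof (induction w arbitrary: p)
  case (Cons e w)
  have "wirt e (wirts w (\<lambda>p. f p + g p)) p = wirt e (\<lambda>p. wirts w f p + wirts w g p) p"
    using Cons assms by (intro wirt_cong[OF assms(1)])
      (auto intro!: smooth_on_differentiable[of _ U] smooth_on_wirts smooth_on_add)
  also have "\<dots> = wirt e (wirts w f) p + wirt e (wirts w g) p"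
    using Cons.prems assms by (intro wirt_add smooth_on_differentiable[of _ U] smooth_on_wirts)
  finally show ?case by simp
qed simp

lemma wirts_cnj:
  assumes "open U" "smooth_on f U" "p \<in> U"
  shows "wirts w (\<lambda>p. cnj (f p)) p = cnj (wirts (map (\<lambda>d. (\<not> fst d, snd d)) w) f p)"
  using assms(3)
proof (induction w arbitrary: p)
  case (Cons e w)
  have "wirt e (wirts w (\<lambda>p. cnj (f p))) p
      = wirt e (\<lambda>p. cnj (wirts (map (\<lambda>d. (\<not> fst d, snd d)) w) f p)) p"
    using Cons assms by (intro wirt_cong[OF assms(1)])
      (auto intro!: smooth_on_differentiable[of _ U] smooth_on_wirts smooth_on_cnj)
  then show ?case
    using Cons.prems assms by (simp add: wirt_cnj smooth_on_differentiable[of _ U] smooth_on_wirts)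
qed simp

lemma choose_sum_Suc:
  fixes a :: "nat \<Rightarrow> real"
  shows "(\<Sum>k\<le>Suc n. real (Suc n choose k) * a k)
    = (\<Sum>k\<le>n. real (n choose k) * a (Suc k)) + (\<Sum>k\<le>n. real (n choose k) * a k)"
proof -
  have "(\<Sum>k\<le>Suc n. real (Suc n choose k) * a k)
      = a 0 + (\<Sum>k\<le>n. real (Suc n choose Suc k) * a (Suc k))"
    by (subst sum.atMost_Suc_shift) simp
  also have "\<dots> = (\<Sum>k\<le>n. real (n choose k) * a (Suc k))
      + (a 0 + (\<Sum>k\<le>n. real (n choose Suc k) * a (Suc k)))"
    by (simp add: sum.distrib algebra_simps)
  also have "a 0 + (\<Sum>k\<le>n. real (n choose Suc k) * a (Suc k)) = (\<Sum>k\<le>Suc n. real (n choose k) * a k)"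
    by (subst sum.atMost_Suc_shift) simp
  also have "\<dots> = (\<Sum>k\<le>n. real (n choose k) * a k)" by simp
  finally show ?thesis .
qed

text \<open>The general Leibniz rule in the form of an inequality: the \<open>n\<close>-th order bounds of the factors
  convolve binomially. Pascal's identity drives the induction, in which the innermost letter of the
  word is passed to one of the factors.\<close>

lemma wirts_mult_bound:
  assumes U: "open U" "q \<in> U"
  shows "smooth_on f U \<Longrightarrow> smooth_on g U
    \<Longrightarrow> (\<And>v. length v \<le> n \<Longrightarrow> cmod (wirts v f q) \<le> F (length v))
    \<Longrightarrow> (\<And>v. length v \<le> n \<Longrightarrow> cmod (wirts v g q) \<le> G (length v))
    \<Longrightarrow> length w = n
    \<Longrightarrow> cmod (wirts w (\<lambda>p. f p * g p) q) \<le> (\<Sum>k\<le>n. real (n choose k) * (F k * G (n - k)))"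
proof (induction n arbitrary: f g F G w)
  case 0
  then show ?case
    using 0(3)[of "[]"] 0(4)[of "[]"] by (auto simp: norm_mult intro!: mult_mono order_trans[OF norm_ge_zero])
next
  case (Suc n)
  obtain v d where w: "w = v @ [d]" and v: "length v = n"
    using Suc.prems(5) by (metis length_Suc_conv_rev)
  have sm: "smooth_on (wirt d f) U" "smooth_on (wirt d g) U"
    using Suc.prems U by (auto intro: smooth_on_wirt)
  have "wirts w (\<lambda>p. f p * g p) q = wirts v (wirt d (\<lambda>p. f p * g p)) q"
    by (simp add: w)
  also have "\<dots> = wirts v (\<lambda>p. wirt d f p * g p + f p * wirt d g p) q"
    using Suc.prems(1,2) U by (intro wirts_cong[OF U(1)] smooth_on_wirt smooth_on_mult wirt_mult)
      (auto intro: smooth_on_differentiable)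
  also have "\<dots> = wirts v (\<lambda>p. wirt d f p * g p) q + wirts v (\<lambda>p. f p * wirt d g p) q"
    using Suc.prems(1,2) U sm by (intro wirts_add[OF U(1)] smooth_on_mult) auto
  finally have "cmod (wirts w (\<lambda>p. f p * g p) q)
      \<le> cmod (wirts v (\<lambda>p. wirt d f p * g p) q) + cmod (wirts v (\<lambda>p. f p * wirt d g p) q)"
    by (simp add: norm_triangle_ineq)
  also have "cmod (wirts v (\<lambda>p. wirt d f p * g p) q)
      \<le> (\<Sum>k\<le>n. real (n choose k) * ((\<lambda>k. F (Suc k)) k * G (n - k)))"
  proof (rule Suc.IH[OF sm(1) Suc.prems(2) _ _ v])
    fix u :: "(bool \<times> 'a) list" assume "length u \<le> n"
    then show "cmod (wirts u (wirt d f) q) \<le> F (Suc (length u))" "cmod (wirts u g q) \<le> G (length u)"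
      using Suc.prems(3)[of "u @ [d]"] Suc.prems(4)[of u] by auto
  qed
  also have "cmod (wirts v (\<lambda>p. f p * wirt d g p) q)
      \<le> (\<Sum>k\<le>n. real (n choose k) * (F k * (\<lambda>k. G (Suc k)) (n - k)))"
  proof (rule Suc.IH[OF Suc.prems(1) sm(2) _ _ v])
    fix u :: "(bool \<times> 'a) list" assume "length u \<le> n"
    then show "cmod (wirts u (wirt d g) q) \<le> G (Suc (length u))" "cmod (wirts u f q) \<le> F (length u)"
      using Suc.prems(4)[of "u @ [d]"] Suc.prems(3)[of u] by auto
  qed
  also have "(\<Sum>k\<le>n. real (n choose k) * ((\<lambda>k. F (Suc k)) k * G (n - k)))
      + (\<Sum>k\<le>n. real (n choose k) * (F k * (\<lambda>k. G (Suc k)) (n - k)))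
      = (\<Sum>k\<le>Suc n. real (Suc n choose k) * (F k * G (Suc n - k)))"
    by (subst choose_sum_Suc) (auto intro!: sum.cong simp: Suc_diff_le)
  finally show ?case by simp
qed

section \<open>Functions with Cauchy estimates\<close>

definition cauchy_bounded_on :: "(complex^'n::finite \<Rightarrow> complex) \<Rightarrow> (complex^'n) set \<Rightarrow> bool" where
  "cauchy_bounded_on f U \<longleftrightarrow> smooth_on f U \<and>
    (\<forall>p\<in>U. \<exists>r>0. \<exists>C R. \<forall>q\<in>ball p r. \<forall>w. cmod (wirts w f q) \<le> C * R ^ length w * fact (length w))"

lemma eventually_at_top_witness: "\<forall>\<^sub>F N in at_top. P (N::real) \<Longrightarrow> \<exists>N. P N"
  by (rule eventually_happens'[OF trivial_limit_at_top_linorder])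

text \<open>With a single large parameter for the radius and both constants, bounds for finitely many
  functions are combined by intersecting eventual statements.\<close>

lemma cauchy_bounded_on_iff_eventually:
  assumes "open U"
  shows "cauchy_bounded_on f U \<longleftrightarrow> smooth_on f U \<and>
    (\<forall>p\<in>U. \<forall>\<^sub>F N in at_top. \<forall>q\<in>ball p (1 / N). \<forall>w. cmod (wirts w f q) \<le> N * N ^ length w * fact (length w))"
    (is "_ \<longleftrightarrow> _ \<and> (\<forall>p\<in>U. ?E p)")
proof -
  have "?E p \<longleftrightarrow> (\<exists>r>0. \<exists>C R. \<forall>q\<in>ball p r. \<forall>w. cmod (wirts w f q) \<le> C * R ^ length w * fact (length w))"
    (is "_ \<longleftrightarrow> ?B") for p
  proof
    assume ?B
    then obtain r C R where r: "r > 0"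
      and b: "\<And>q w. q \<in> ball p r \<Longrightarrow> cmod (wirts w f q) \<le> C * R ^ length w * fact (length w)"
      by blast
    have "\<forall>\<^sub>F N in at_top. N \<ge> 1 \<and> N \<ge> 1 / r \<and> N \<ge> C \<and> N \<ge> \<bar>R\<bar>"
      by (intro eventually_conj eventually_ge_at_top)
    then show "?E p"
    proof (rule eventually_mono, intro ballI allI)
      fix N q w assume N: "N \<ge> 1 \<and> N \<ge> 1 / r \<and> N \<ge> C \<and> N \<ge> \<bar>R\<bar>" and q: "q \<in> ball p (1 / N)"
      have "1 / N \<le> r" using N r by (simp add: field_simps)
      then have "cmod (wirts w f q) \<le> C * R ^ length w * fact (length w)" using q by (intro b) auto
      also have "C * R ^ length w \<le> N * \<bar>R\<bar> ^ length w"
      proof -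
        have "C * R ^ length w \<le> \<bar>C\<bar> * \<bar>R\<bar> ^ length w"
          by (metis abs_ge_self abs_mult power_abs)
        moreover have "0 \<le> C" using b[of p "[]"] r order_trans[OF norm_ge_zero] by fastforce
        ultimately show ?thesis using N by (smt (verit) mult_right_mono zero_le_power)
      qed
      also have "N * \<bar>R\<bar> ^ length w \<le> N * N ^ length w"
        using N by (intro mult_left_mono power_mono) auto
      finally show "cmod (wirts w f q) \<le> N * N ^ length w * fact (length w)"
        by (simp add: mult_right_mono)
    qed
  next
    assume "?E p"
    moreover have "\<forall>\<^sub>F N in at_top. (N::real) > 0" by (rule eventually_gt_at_top)
    ultimately have "\<forall>\<^sub>F N in at_top. N > 0 \<and>
      (\<forall>q\<in>ball p (1 / N). \<forall>w. cmod (wirts w f q) \<le> N * N ^ length w * fact (length w))"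
      by (intro eventually_conj)
    from eventually_at_top_witness[OF this] obtain N where "N > 0"
      "\<forall>q\<in>ball p (1 / N). \<forall>w. cmod (wirts w f q) \<le> N * N ^ length w * fact (length w)"
      by blast
    then show ?B by (intro exI[of _ "1 / N"] conjI exI[of _ N]) auto
  qed
  then show ?thesis unfolding cauchy_bounded_on_def by blast
qed

lemma cauchy_bounded_on_smooth: "cauchy_bounded_on f U \<Longrightarrow> smooth_on f U"
  by (simp add: cauchy_bounded_on_def)

lemma eventually_ball_subset:
  fixes U :: "'a::metric_space set"
  assumes "open U" "p \<in> U"
  shows "\<forall>\<^sub>F N in at_top. ball p (1 / N) \<subseteq> U"
proof -
  obtain r where r: "r > 0" "ball p r \<subseteq> U" using assms open_contains_ball by blast
  have "\<forall>\<^sub>F N in at_top. N \<ge> 1 \<and> N \<ge> 1 / r" by (intro eventually_conj eventually_ge_at_top)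
  then show ?thesis
  proof (rule eventually_mono)
    fix N assume N: "N \<ge> 1 \<and> N \<ge> 1 / r"
    then have "1 / N \<le> r" using r by (simp add: field_simps)
    then show "ball p (1 / N) \<subseteq> U" using r by auto
  qed
qed

lemma eventually_ball_norm_le:
  fixes f :: "'a::metric_space \<Rightarrow> 'b::real_normed_vector"
  assumes "continuous_on U f" "open U" "p \<in> U"
  shows "\<forall>\<^sub>F N in at_top. \<forall>q\<in>ball p (1 / N). norm (f q) \<le> N"
proof -
  obtain r where r: "r > 0" "\<And>q. q \<in> U \<Longrightarrow> dist q p < r \<Longrightarrow> dist (f q) (f p) < 1"
    using assms unfolding continuous_on_iff by (metis zero_less_one)
  have "\<forall>\<^sub>F N in at_top. N \<ge> 1 \<and> N \<ge> 1 / r \<and> N \<ge> norm (f p) + 1 \<and> ball p (1 / N) \<subseteq> U"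
    by (intro eventually_conj eventually_ge_at_top eventually_ball_subset assms)
  then show ?thesis
  proof (rule eventually_mono, intro ballI)
    fix N q assume N: "N \<ge> 1 \<and> N \<ge> 1 / r \<and> N \<ge> norm (f p) + 1 \<and> ball p (1 / N) \<subseteq> U"
      and q: "q \<in> ball p (1 / N)"
    then have "1 / N \<le> r" using r by (simp add: field_simps)
    then have "norm (f q - f p) < 1" using N q r(2)[of q] by (auto simp: dist_commute dist_norm norm_minus_commute)
    then show "norm (f q) \<le> N" using N norm_triangle_sub[of "f q" "f p"] by linarith
  qed
qed

lemma wirts_zero [simp]: "wirts w (\<lambda>p. 0) = (\<lambda>p. 0)"
  by (induction w) auto

lemma cauchy_bounded_on_const: "cauchy_bounded_on (\<lambda>p. c) U"
proof -
  have "cmod (wirts w (\<lambda>p. c) q) \<le> cmod c * 1 ^ length w * fact (length w)" for w q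
    by (cases w rule: rev_cases) auto
  then show ?thesis
    unfolding cauchy_bounded_on_def using smooth_on_const zero_less_one by blast
qed

lemma cauchy_bounded_on_cong:
  assumes "open U" "cauchy_bounded_on f U" "\<And>p. p \<in> U \<Longrightarrow> f p = g p"
  shows "cauchy_bounded_on g U"
proof -
  have sm: "smooth_on f U" by (rule cauchy_bounded_on_smooth[OF assms(2)])
  have "\<forall>\<^sub>F N in at_top. \<forall>q\<in>ball p (1 / N). \<forall>w. cmod (wirts w g q) \<le> N * N ^ length w * fact (length w)"
    if "p \<in> U" for p
  proof -
    have "\<forall>\<^sub>F N in at_top. ball p (1 / N) \<subseteq> U \<and>
      (\<forall>q\<in>ball p (1 / N). \<forall>w. cmod (wirts w f q) \<le> N * N ^ length w * fact (length w))"
      using assms(2) that eventually_ball_subset[OF assms(1) that]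
      unfolding cauchy_bounded_on_iff_eventually[OF assms(1)] by (intro eventually_conj) auto
    then show ?thesis
      using wirts_cong[OF assms(1) sm assms(3)] by (elim eventually_mono) (metis subsetD)
  qed
  moreover have "smooth_on g U" using smooth_on_cong[OF assms(1)] assms(3) sm by blast
  ultimately show ?thesis unfolding cauchy_bounded_on_iff_eventually[OF assms(1)] by blast
qed

lemma cauchy_bounded_on_cnj:
  assumes "open U" "cauchy_bounded_on f U"
  shows "cauchy_bounded_on (\<lambda>p. cnj (f p)) U"
proof -
  have sm: "smooth_on f U" by (rule cauchy_bounded_on_smooth[OF assms(2)])
  have "\<forall>\<^sub>F N in at_top. \<forall>q\<in>ball p (1 / N). \<forall>w.
      cmod (wirts w (\<lambda>p. cnj (f p)) q) \<le> N * N ^ length w * fact (length w)"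
    if "p \<in> U" for p
  proof -
    have "\<forall>\<^sub>F N in at_top. ball p (1 / N) \<subseteq> U \<and>
      (\<forall>q\<in>ball p (1 / N). \<forall>w. cmod (wirts w f q) \<le> N * N ^ length w * fact (length w))"
      using assms(2) that eventually_ball_subset[OF assms(1) that]
      unfolding cauchy_bounded_on_iff_eventually[OF assms(1)] by (intro eventually_conj) auto
    then show ?thesis
    proof (rule eventually_mono, intro ballI allI)
      fix N q and w :: "(bool \<times> 'a) list"
      assume N: "ball p (1 / N) \<subseteq> U \<and>
        (\<forall>q\<in>ball p (1 / N). \<forall>w. cmod (wirts w f q) \<le> N * N ^ length w * fact (length w))"
        and q: "q \<in> ball p (1 / N)"
      define v where "v = map (\<lambda>d. (\<not> fst d, snd d)) w"
      have "cmod (wirts v f q) \<le> N * N ^ length v * fact (length v)" using N q by blast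
      then have "cmod (wirts v f q) \<le> N * N ^ length w * fact (length w)" by (simp add: v_def)
      moreover have "q \<in> U" using N q by blast
      ultimately show "cmod (wirts w (\<lambda>p. cnj (f p)) q) \<le> N * N ^ length w * fact (length w)"
        by (simp add: wirts_cnj[OF assms(1) sm] v_def)
    qed
  qed
  then show ?thesis
    unfolding cauchy_bounded_on_iff_eventually[OF assms(1)] using smooth_on_cnj[OF assms(1) sm] by blast
qed

text \<open>Every word of length \<open>n + 1\<close> applied to \<open>f\<close> is a word of length \<open>n\<close> applied to a first
  derivative.\<close>

lemma cauchy_bounded_on_if_derivatives:
  fixes f :: "complex^'n::finite \<Rightarrow> complex"
  assumes U: "open U" and sm: "smooth_on f U" and d: "\<And>d. cauchy_bounded_on (wirt d f) U"
  shows "cauchy_bounded_on f U"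
proof -
  have "\<forall>\<^sub>F N in at_top. \<forall>q\<in>ball p (1 / N). \<forall>w. cmod (wirts w f q) \<le> N * N ^ length w * fact (length w)"
    if p: "p \<in> U" for p
  proof -
    have "\<forall>\<^sub>F N in at_top. 1 \<le> N \<and> (\<forall>q\<in>ball p (1 / N). cmod (f q) \<le> N) \<and>
      (\<forall>d\<in>UNIV. \<forall>q\<in>ball p (1 / N). \<forall>w. cmod (wirts w (wirt d f) q) \<le> N * N ^ length w * fact (length w))"
    proof (intro eventually_conj eventually_ge_at_top
        eventually_ball_norm_le[OF smooth_on_continuous[OF sm] U p])
      have "\<forall>d\<in>UNIV. \<forall>\<^sub>F N in at_top. \<forall>q\<in>ball p (1 / N). \<forall>w.
          cmod (wirts w (wirt d f) q) \<le> N * N ^ length w * fact (length w)"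
        using d p unfolding cauchy_bounded_on_iff_eventually[OF U] by blast
      then show "\<forall>\<^sub>F N in at_top. \<forall>d\<in>UNIV. \<forall>q\<in>ball p (1 / N). \<forall>w.
          cmod (wirts w (wirt d f) q) \<le> N * N ^ length w * fact (length w)"
        by (rule eventually_ball_finite[OF finite])
    qed
    then show ?thesis
    proof (rule eventually_mono, intro ballI allI)
      fix N q and w :: "(bool \<times> 'n) list"
      assume N: "1 \<le> N \<and> (\<forall>q\<in>ball p (1 / N). cmod (f q) \<le> N) \<and>
        (\<forall>d\<in>UNIV. \<forall>q\<in>ball p (1 / N). \<forall>w. cmod (wirts w (wirt d f) q) \<le> N * N ^ length w * fact (length w))"
        and q: "q \<in> ball p (1 / N)"
      show "cmod (wirts w f q) \<le> N * N ^ length w * fact (length w)"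
      proof (cases w rule: rev_cases)
        case Nil
        then show ?thesis using N q by simp
      next
        case (snoc v d)
        then have "wirts w f q = wirts v (wirt d f) q" by simp
        moreover have "cmod (wirts v (wirt d f) q) \<le> N * N ^ length v * fact (length v)"
          using N q by blast
        ultimately have "cmod (wirts w f q) \<le> N * N ^ length v * fact (length v)" by simp
        also have "\<dots> \<le> N * N ^ length w * fact (length w)"
          using N snoc by (intro mult_mono power_increasing fact_mono) auto
        finally show ?thesis .
      qed
    qed
  qed
  then show ?thesis unfolding cauchy_bounded_on_iff_eventually[OF U] using sm by blast
qed

lemma wirts_mult_geometric:
  assumes "open U" "q \<in> U" "smooth_on f U" "smooth_on g U"
    and "\<And>v. length v \<le> n \<Longrightarrow> cmod (wirts v f q) \<le> A * R ^ length v * fact (length v)"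
    and "\<And>v. length v \<le> n \<Longrightarrow> cmod (wirts v g q) \<le> B * R ^ length v * fact (length v)"
    and "length w = n"
  shows "cmod (wirts w (\<lambda>p. f p * g p) q) \<le> A * B * R ^ n * fact (Suc n)"
proof -
  have "cmod (wirts w (\<lambda>p. f p * g p) q)
    \<le> (\<Sum>k\<le>n. real (n choose k) * ((A * R ^ k * fact k) * (B * R ^ (n - k) * fact (n - k))))"
    using assms by (intro wirts_mult_bound[where F = "\<lambda>k. A * R ^ k * fact k"
          and G = "\<lambda>k. B * R ^ k * fact k"]) auto
  also have "\<dots> = (\<Sum>k\<le>n. A * B * R ^ n * fact n)"
  proof (rule sum.cong)
    fix k assume k: "k \<in> {..n}"
    have "real (n choose k) * (fact k * fact (n - k)) = fact n"
      using k by (simp add: binomial_fact)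
    moreover have "R ^ k * R ^ (n - k) = R ^ n" using k by (simp flip: power_add)
    ultimately show "real (n choose k) * ((A * R ^ k * fact k) * (B * R ^ (n - k) * fact (n - k)))
      = A * B * R ^ n * fact n"
      by (metis (no_types, lifting) mult.assoc mult.left_commute)
  qed simp
  also have "\<dots> = A * B * R ^ n * fact (Suc n)" by (simp add: algebra_simps)
  finally show ?thesis .
qed

text \<open>A factor that obeys the estimates with half the growth rate costs only a constant, even when
  the other factor carries the larger factorials \<open>(n + 1)!\<close>: the Leibniz sum is then dominated by a
  geometric series.\<close>

lemma wirts_mult_slow_factor:
  assumes "open U" "q \<in> U" "smooth_on f U" "smooth_on g U"
    and f: "\<And>v. length v \<le> n \<Longrightarrow> cmod (wirts v f q) \<le> A * R0 ^ length v * fact (length v)"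
    and g: "\<And>v. length v \<le> n \<Longrightarrow> cmod (wirts v g q) \<le> B * R ^ length v * fact (Suc (length v))"
    and R: "0 \<le> R0" "2 * R0 \<le> R" and AB: "0 \<le> A" "0 \<le> B"
    and w: "length w = n"
  shows "cmod (wirts w (\<lambda>p. f p * g p) q) \<le> 2 * A * B * R ^ n * fact (Suc n)"
proof -
  have "cmod (wirts w (\<lambda>p. f p * g p) q)
    \<le> (\<Sum>k\<le>n. real (n choose k) * ((A * R0 ^ k * fact k) * (B * R ^ (n - k) * fact (Suc (n - k)))))"
    using assms by (intro wirts_mult_bound[where F = "\<lambda>k. A * R0 ^ k * fact k"
          and G = "\<lambda>k. B * R ^ k * fact (Suc k)"]) auto
  also have "\<dots> \<le> (\<Sum>k\<le>n. (1 / 2) ^ k * (A * B * R ^ n * fact (Suc n)))"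
  proof (rule sum_mono)
    fix k assume k: "k \<in> {..n}"
    have c: "real (n choose k) * (fact k * fact (n - k)) = fact n"
      using k by (simp add: binomial_fact)
    have "R0 ^ k * R ^ (n - k) \<le> (R / 2) ^ k * R ^ (n - k)"
      using R by (intro mult_right_mono power_mono) auto
    also have "\<dots> = (1 / 2) ^ k * R ^ n" using k by (simp add: power_divide flip: power_add)
    finally have p: "R0 ^ k * R ^ (n - k) \<le> (1 / 2) ^ k * R ^ n" .
    have "real (n choose k) * ((A * R0 ^ k * fact k) * (B * R ^ (n - k) * fact (Suc (n - k))))
      = A * B * (R0 ^ k * R ^ (n - k)) * ((real (n choose k) * (fact k * fact (n - k))) * real (Suc (n - k)))"
      by (simp add: mult_ac)
    also have "\<dots> \<le> A * B * ((1 / 2) ^ k * R ^ n) * (fact n * real (Suc n))"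
    proof (rule mult_mono)
      show "A * B * (R0 ^ k * R ^ (n - k)) \<le> A * B * ((1 / 2) ^ k * R ^ n)"
        using p AB by (intro mult_left_mono) auto
      show "real (n choose k) * (fact k * fact (n - k)) * real (Suc (n - k)) \<le> fact n * real (Suc n)"
        unfolding c by (intro mult_left_mono) auto
    qed (use AB R in auto)
    also have "\<dots> = (1 / 2) ^ k * (A * B * R ^ n * fact (Suc n))" by (simp add: mult_ac)
    finally show "real (n choose k) * ((A * R0 ^ k * fact k) * (B * R ^ (n - k) * fact (Suc (n - k))))
      \<le> (1 / 2) ^ k * (A * B * R ^ n * fact (Suc n))" .
  qed
  also have "\<dots> = (\<Sum>k\<le>n. (1 / 2) ^ k) * (A * B * R ^ n * fact (Suc n))"
    by (simp add: sum_distrib_right)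
  also have "\<dots> \<le> 2 * (A * B * R ^ n * fact (Suc n))"
  proof (rule mult_right_mono)
    have "(\<Sum>k\<le>n. (1 / 2 :: real) ^ k) = (1 - (1 / 2) ^ Suc n) / (1 - 1 / 2)"
      by (subst sum_gp0) auto
    also have "\<dots> \<le> 2" by simp
    finally show "(\<Sum>k\<le>n. (1 / 2 :: real) ^ k) \<le> 2" .
  qed (use AB R in auto)
  finally show ?thesis by (simp add: mult_ac)
qed

lemma cauchy_bounded_on_mult:
  assumes U: "open U" and f: "cauchy_bounded_on f U" and g: "cauchy_bounded_on g U"
  shows "cauchy_bounded_on (\<lambda>p. f p * g p) U"
proof -
  have sm: "smooth_on f U" "smooth_on g U" using f g by (auto intro: cauchy_bounded_on_smooth)
  have "\<exists>r>0. \<exists>C R. \<forall>q\<in>ball p r. \<forall>w. cmod (wirts w (\<lambda>p. f p * g p) q) \<le> C * R ^ length w * fact (length w)"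
    if p: "p \<in> U" for p
  proof -
    have "\<forall>\<^sub>F N in at_top. 1 \<le> N \<and> ball p (1 / N) \<subseteq> U
      \<and> (\<forall>q\<in>ball p (1 / N). \<forall>w. cmod (wirts w f q) \<le> N * N ^ length w * fact (length w))
      \<and> (\<forall>q\<in>ball p (1 / N). \<forall>w. cmod (wirts w g q) \<le> N * N ^ length w * fact (length w))"
      using f g p unfolding cauchy_bounded_on_iff_eventually[OF U]
      by (intro eventually_conj eventually_ge_at_top eventually_ball_subset U) auto
    then obtain N where N: "1 \<le> N" "ball p (1 / N) \<subseteq> U"
      and b: "\<And>q w. q \<in> ball p (1 / N) \<Longrightarrow> cmod (wirts w f q) \<le> N * N ^ length w * fact (length w)"
      "\<And>q w. q \<in> ball p (1 / N) \<Longrightarrow> cmod (wirts w g q) \<le> N * N ^ length w * fact (length w)"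
      by (auto dest!: eventually_at_top_witness)
    have "cmod (wirts w (\<lambda>p. f p * g p) q) \<le> (N * N) * (2 * N) ^ length w * fact (length w)"
      if q: "q \<in> ball p (1 / N)" for q w
    proof -
      have "cmod (wirts w (\<lambda>p. f p * g p) q) \<le> N * N * N ^ length w * fact (Suc (length w))"
        using N q b by (intro wirts_mult_geometric[OF U _ sm]) auto
      also have "\<dots> = N * N * N ^ length w * fact (length w) * real (Suc (length w))"
        by (simp add: algebra_simps)
      also have "\<dots> \<le> N * N * N ^ length w * fact (length w) * 2 ^ length w"
      proof (rule mult_left_mono)
        have "Suc (length w) \<le> 2 ^ length w" by (rule Suc_leI[OF less_exp])
        then show "real (Suc (length w)) \<le> 2 ^ length w"
          by (metis of_nat_le_iff of_nat_numeral of_nat_power)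
      qed (use N in auto)
      finally show ?thesis by (simp add: power_mult_distrib mult_ac)
    qed
    moreover have "1 / N > 0" using N by simp
    ultimately show ?thesis by blast
  qed
  then show ?thesis unfolding cauchy_bounded_on_def using smooth_on_mult[OF U sm] by blast
qed

section \<open>Quadratic differential systems\<close>

inductive quadratic_over ::
  "(complex^'n::finite) set \<Rightarrow> (complex^'n \<Rightarrow> complex) set \<Rightarrow> (complex^'n \<Rightarrow> complex) \<Rightarrow> bool"
  for U Y
where
  quadratic_term: "cauchy_bounded_on a U \<Longrightarrow> u \<in> Y \<Longrightarrow> v \<in> Y
    \<Longrightarrow> quadratic_over U Y (\<lambda>p. a p * (u p * v p))"
| quadratic_add: "quadratic_over U Y f \<Longrightarrow> quadratic_over U Y g
    \<Longrightarrow> quadratic_over U Y (\<lambda>p. f p + g p)"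

lemma quadratic_over_smooth:
  assumes "open U" "\<And>y. y \<in> Y \<Longrightarrow> smooth_on y U"
  shows "quadratic_over U Y h \<Longrightarrow> smooth_on h U"
  by (induction rule: quadratic_over.induct)
     (simp_all add: smooth_on_mult smooth_on_add assms cauchy_bounded_on_smooth)

text \<open>The product of two functions with bounds \<open>C R\<^sup>n n!\<close> has the bound \<open>C\<^sup>2 R\<^sup>n (n + 1)!\<close>. Read as a bound for the
  derivatives of order \<open>n + 1\<close> of a solution, this leaves a factor \<open>R\<close> in reserve, which can absorb
  \<open>N * C\<close>.\<close>

lemma quadratic_over_bound:
  fixes Y :: "(complex^'n::finite \<Rightarrow> complex) set"
  assumes U: "open U" "p \<in> U" and Y: "\<And>y. y \<in> Y \<Longrightarrow> smooth_on y U"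
  shows "quadratic_over U Y h \<Longrightarrow> \<forall>\<^sub>F N in at_top. \<forall>q\<in>ball p (1 / N). \<forall>R\<ge>N. \<forall>C\<ge>0. \<forall>n.
      (\<forall>y\<in>Y. \<forall>v. length v \<le> n \<longrightarrow> cmod (wirts v y q) \<le> C * R ^ length v * fact (length v)) \<longrightarrow>
      (\<forall>w. length w = n \<longrightarrow> cmod (wirts w h q) \<le> N * C\<^sup>2 * R ^ n * fact (Suc n))"
proof (induction rule: quadratic_over.induct)
  case (quadratic_term a u v)
  have sm: "smooth_on a U" "smooth_on (\<lambda>p. u p * v p) U"
    using quadratic_term Y U by (auto intro: cauchy_bounded_on_smooth smooth_on_mult)
  obtain M where M: "1 \<le> M" "ball p (1 / M) \<subseteq> U"
      and b: "\<And>q w. q \<in> ball p (1 / M) \<Longrightarrow> cmod (wirts w a q) \<le> M * M ^ length w * fact (length w)"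
  proof -
    have "\<forall>\<^sub>F N in at_top. 1 \<le> N \<and> ball p (1 / N) \<subseteq> U
      \<and> (\<forall>q\<in>ball p (1 / N). \<forall>w. cmod (wirts w a q) \<le> N * N ^ length w * fact (length w))"
      using quadratic_term(1) U unfolding cauchy_bounded_on_iff_eventually[OF U(1)]
      by (intro eventually_conj eventually_ge_at_top eventually_ball_subset U) auto
    from eventually_at_top_witness[OF this] show ?thesis using that by blast
  qed
  have "\<forall>\<^sub>F N in at_top. 2 * M \<le> N" by (rule eventually_ge_at_top)
  then show ?case
  proof (rule eventually_mono, intro ballI allI impI)
    fix N R C :: real and n q and w :: "(bool \<times> 'n) list"
    assume N: "2 * M \<le> N" and q: "q \<in> ball p (1 / N)" and R: "N \<le> R" and C: "0 \<le> C"
      and hyp: "\<forall>y\<in>Y. \<forall>v. length v \<le> n \<longrightarrow> cmod (wirts v y q) \<le> C * R ^ length v * fact (length v)"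
      and w: "length w = n"
    have "1 / N \<le> 1 / M" using M N by (simp add: frac_le)
    then have q': "q \<in> ball p (1 / M)" "q \<in> U" using q M by auto
    have "cmod (wirts w (\<lambda>p. a p * (u p * v p)) q) \<le> 2 * M * (C * C) * R ^ n * fact (Suc n)"
    proof (rule wirts_mult_slow_factor[OF U(1) q'(2) sm, where ?R0.0 = M])
      show "cmod (wirts x (\<lambda>p. u p * v p) q) \<le> C * C * R ^ length x * fact (Suc (length x))"
        if "length x \<le> n" for x
        using that hyp quadratic_term(2,3) Y by (intro wirts_mult_geometric[OF U(1) q'(2)]) auto
    qed (use b q' M N R C w in auto)
    also have "\<dots> \<le> N * (C * C) * R ^ n * fact (Suc n)"
      using N M R C by (intro mult_right_mono) auto
    finally show "cmod (wirts w (\<lambda>p. a p * (u p * v p)) q) \<le> N * C\<^sup>2 * R ^ n * fact (Suc n)"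
      by (simp add: power2_eq_square)
  qed
next
  case (quadratic_add f g)
  let ?B = "\<lambda>h N. \<forall>q\<in>ball p (1 / N). \<forall>R\<ge>N. \<forall>C\<ge>0. \<forall>n.
      (\<forall>y\<in>Y. \<forall>v. length v \<le> n \<longrightarrow> cmod (wirts v y q) \<le> C * R ^ length v * fact (length v)) \<longrightarrow>
      (\<forall>w. length w = n \<longrightarrow> cmod (wirts w h q) \<le> N * C\<^sup>2 * R ^ n * fact (Suc n))"
  have sm: "smooth_on f U" "smooth_on g U"
    using quadratic_add quadratic_over_smooth[OF U(1) Y] by auto
  obtain M where M: "1 \<le> M" "ball p (1 / M) \<subseteq> U" "?B f M" "?B g M"
  proof -
    have "\<forall>\<^sub>F N in at_top. 1 \<le> N \<and> ball p (1 / N) \<subseteq> U \<and> ?B f N \<and> ?B g N"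
      by (rule eventually_conj[OF eventually_ge_at_top
            eventually_conj[OF eventually_ball_subset[OF U] eventually_conj[OF quadratic_add.IH]]])
    from eventually_at_top_witness[OF this] show ?thesis using that by blast
  qed
  have "\<forall>\<^sub>F N in at_top. 2 * M \<le> N" by (rule eventually_ge_at_top)
  then show ?case
  proof (rule eventually_mono, intro ballI allI impI)
    fix N R C :: real and n q and w :: "(bool \<times> 'n) list"
    assume N: "2 * M \<le> N" and q: "q \<in> ball p (1 / N)" and R: "N \<le> R" and C: "0 \<le> C"
      and hyp: "\<forall>y\<in>Y. \<forall>v. length v \<le> n \<longrightarrow> cmod (wirts v y q) \<le> C * R ^ length v * fact (length v)"
      and w: "length w = n"
    have "1 / N \<le> 1 / M" using M N by (simp add: frac_le)
    then have q': "q \<in> ball p (1 / M)" "q \<in> U" using q M by auto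
    have RM: "R \<ge> M" using R N M by linarith
    have "cmod (wirts w f q) \<le> M * C\<^sup>2 * R ^ n * fact (Suc n)"
      using M(3) q'(1) RM C hyp w by blast
    moreover have "cmod (wirts w g q) \<le> M * C\<^sup>2 * R ^ n * fact (Suc n)"
      using M(4) q'(1) RM C hyp w by blast
    ultimately have "cmod (wirts w (\<lambda>p. f p + g p) q) \<le> (2 * M) * C\<^sup>2 * R ^ n * fact (Suc n)"
      using norm_triangle_ineq[of "wirts w f q" "wirts w g q"]
      by (simp add: wirts_add[OF U(1) sm q'(2)])
    also have "\<dots> \<le> N * C\<^sup>2 * R ^ n * fact (Suc n)"
      using N M R C by (intro mult_right_mono) auto
    finally show "cmod (wirts w (\<lambda>p. f p + g p) q) \<le> N * C\<^sup>2 * R ^ n * fact (Suc n)" .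
  qed
qed

text \<open>Induction on the order of the derivative: one derivative is replaced by the quadratic right-hand
  side, to which the bounds of lower order apply. If \<open>N\<close> bounds the solutions and the constants of
  the system near the point, then the rate \<open>R = N\<^sup>2\<close> reproduces itself. A constant function in \<open>Y\<close>
  admits terms of degree less than two.\<close>

theorem quadratic_system_cauchy_bounded:
  fixes Y :: "(complex^'n::finite \<Rightarrow> complex) set"
  assumes U: "open U" and fin: "finite Y" and Y: "\<And>y. y \<in> Y \<Longrightarrow> smooth_on y U"
    and sys: "\<And>y d. y \<in> Y \<Longrightarrow> \<exists>h. quadratic_over U Y h \<and> (\<forall>q\<in>U. wirt d y q = h q)"
    and y: "y \<in> Y"
  shows "cauchy_bounded_on y U"
proof -
  have "\<exists>r>0. \<exists>C R. \<forall>q\<in>ball p r. \<forall>w. cmod (wirts w y q) \<le> C * R ^ length w * fact (length w)"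
    if p: "p \<in> U" for p
  proof -
    let ?B = "\<lambda>h N. \<forall>q\<in>ball p (1 / N). \<forall>R\<ge>N. \<forall>C\<ge>0. \<forall>n.
      (\<forall>y\<in>Y. \<forall>v. length v \<le> n \<longrightarrow> cmod (wirts v y q) \<le> C * R ^ length v * fact (length v)) \<longrightarrow>
      (\<forall>w. length w = n \<longrightarrow> cmod (wirts w h q) \<le> N * C\<^sup>2 * R ^ n * fact (Suc n))"
    obtain H where H: "\<And>y d. y \<in> Y \<Longrightarrow> quadratic_over U Y (H y d)"
      "\<And>y d q. y \<in> Y \<Longrightarrow> q \<in> U \<Longrightarrow> wirt d y q = H y d q"
      using sys by metis
    have "\<forall>\<^sub>F N in at_top. 1 \<le> N \<and> ball p (1 / N) \<subseteq> U
      \<and> (\<forall>y\<in>Y. \<forall>q\<in>ball p (1 / N). cmod (y q) \<le> N)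
      \<and> (\<forall>y\<in>Y. \<forall>d\<in>UNIV. ?B (H y d) N)"
    proof (intro eventually_conj eventually_ge_at_top eventually_ball_subset U p)
      show "\<forall>\<^sub>F N in at_top. \<forall>y\<in>Y. \<forall>q\<in>ball p (1 / N). cmod (y q) \<le> N"
        using eventually_ball_norm_le[OF smooth_on_continuous[OF Y] U p]
        by (intro eventually_ball_finite[OF fin]) blast
      show "\<forall>\<^sub>F N in at_top. \<forall>y\<in>Y. \<forall>d\<in>UNIV. ?B (H y d) N"
        using quadratic_over_bound[OF U p Y H(1)]
        by (intro eventually_ball_finite[OF fin] eventually_ball_finite[OF finite] ballI) blast
    qed
    then obtain N where N: "1 \<le> N" "ball p (1 / N) \<subseteq> U" "\<And>y q. y \<in> Y \<Longrightarrow> q \<in> ball p (1 / N) \<Longrightarrow> cmod (y q) \<le> N"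
      "\<And>y d. y \<in> Y \<Longrightarrow> ?B (H y d) N"
      by (auto dest!: eventually_at_top_witness)
    have "\<forall>y\<in>Y. \<forall>w. length w = n \<longrightarrow> cmod (wirts w y q) \<le> N * (N\<^sup>2) ^ n * fact n"
      if q: "q \<in> ball p (1 / N)" for q n
    proof (induction n rule: less_induct)
      case (less n)
      show ?case
      proof (intro ballI allI impI)
        fix y and w :: "(bool \<times> 'n) list" assume y: "y \<in> Y" and w: "length w = n"
        show "cmod (wirts w y q) \<le> N * (N\<^sup>2) ^ n * fact n"
        proof (cases w rule: rev_cases)
          case Nil
          then show ?thesis using N(3)[OF y q] w by simp
        next
          case (snoc v d)
          then have n: "n = Suc (length v)" using w by simp
          \<comment> \<open>The bound for right-hand sides is available for rates at least \<open>N\<close>.\<close>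
          have "N * 1 \<le> N\<^sup>2" unfolding power2_eq_square using N by (intro mult_left_mono) auto
          then have NN: "N \<le> N\<^sup>2" by simp
          have qU: "q \<in> U" using q N(2) by blast
          have smy: "smooth_on (wirt d y) U" by (rule smooth_on_wirt[OF U Y[OF y]])
          have "wirts w y q = wirts v (H y d) q"
            using wirts_cong[OF U smy H(2)[OF y] qU, of v] snoc by simp
          also have "cmod \<dots> \<le> N * N\<^sup>2 * (N\<^sup>2) ^ length v * fact (Suc (length v))"
          proof -
            have "\<forall>y\<in>Y. \<forall>u. length u \<le> length v \<longrightarrow> cmod (wirts u y q) \<le> N * (N\<^sup>2) ^ length u * fact (length u)"
              using less.IH n by auto
            then show ?thesis using N(4)[OF y, of d] q NN N(1) by force
          qed
          also have "\<dots> = N * (N\<^sup>2) ^ n * fact n" by (simp add: n)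
          finally show ?thesis .
        qed
      qed
    qed
    then have "\<forall>q\<in>ball p (1 / N). \<forall>w. cmod (wirts w y q) \<le> N * (N\<^sup>2) ^ length w * fact (length w)"
      using y by blast
    moreover have "1 / N > 0" using N by simp
    ultimately show ?thesis by blast
  qed
  then show ?thesis unfolding cauchy_bounded_on_def using Y[OF y] by blast
qed

section \<open>Analytic regularity for the Cauchy-Riemann operators\<close>

lemma integral_cis_neg2: "integral {0..2 * pi} (\<lambda>t. cis (- (2 * t))) = 0"
proof -
  have "((\<lambda>t. cis (- (2 * t))) has_integral
      (\<i> / 2) * cis (- (2 * (2 * pi))) - (\<i> / 2) * cis (- (2 * 0))) {0..2 * pi}"
  proof (rule fundamental_theorem_of_calculus)
    fix t :: real assume "t \<in> {0..2 * pi}"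
    show "((\<lambda>t. (\<i> / 2) * cis (- (2 * t))) has_vector_derivative cis (- (2 * t))) (at t within {0..2 * pi})"
      unfolding has_vector_derivative_def
      by (auto intro!: derivative_eq_intros simp: fun_eq_iff complex_eq_iff)
  qed simp
  moreover have "cis (- (2 * (2 * pi))) = 1"
    by (simp add: cis.ctr complex_eq_iff cos_2npi[of 2, simplified] sin_2npi[of 2, simplified])
  ultimately show ?thesis by (auto intro: integral_unique)
qed

text \<open>Cauchy's estimate with an error term for the failure of holomorphy. Let \<open>J \<rho>\<close> be the integral of
  \<open>h (\<rho> e\<^sup>i\<^sup>\<theta>) e\<^sup>-\<^sup>i\<^sup>\<theta>\<close> over a period. The radial derivative of \<open>J\<close> is the integral of \<open>a + b e\<^sup>-\<^sup>2\<^sup>i\<^sup>\<theta>\<close>, while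
  integration by parts in \<open>\<theta>\<close> gives \<open>J \<rho> = \<rho> K \<rho>\<close> with \<open>K \<rho>\<close> the integral of \<open>a - b e\<^sup>-\<^sup>2\<^sup>i\<^sup>\<theta>\<close>. Hence the derivative of
  \<open>K\<close> involves only \<open>b\<close>, and only its oscillation since \<open>e\<^sup>-\<^sup>2\<^sup>i\<^sup>\<theta>\<close> has mean zero. At \<open>\<rho> = 0\<close> the value of
  \<open>K\<close> is \<open>2 \<pi> a 0\<close>, at \<open>\<rho> = r\<close> it is controlled by the size of \<open>h\<close>.\<close>

lemma first_derivative_circle_estimate:
  fixes h a b :: "complex \<Rightarrow> complex"
  assumes r: "0 < r"
    and hd: "\<And>t. t \<in> cball 0 r \<Longrightarrow> (h has_derivative (\<lambda>s. a t * s + b t * cnj s)) (at t)"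
    and ca: "continuous_on (cball 0 r) a" and cb: "continuous_on (cball 0 r) b"
    and M: "\<And>t. t \<in> cball 0 r \<Longrightarrow> cmod (h t) \<le> M"
    and L: "\<And>t. t \<in> cball 0 r \<Longrightarrow> cmod (b t - b 0) \<le> L * cmod t"
  shows "cmod (a 0) \<le> M / r + 2 * L * r"
proof -
  let ?e = "\<lambda>\<rho> \<theta>. of_real \<rho> * cis \<theta>"
  define J where "J \<rho> = integral {0..2 * pi} (\<lambda>\<theta>. h (?e \<rho> \<theta>) * cis (- \<theta>))" for \<rho> :: real
  define K where "K \<rho> = integral {0..2 * pi} (\<lambda>\<theta>. a (?e \<rho> \<theta>) - b (?e \<rho> \<theta>) * cis (- (2 * \<theta>)))" for \<rho> :: real
  define J' where "J' \<rho> = integral {0..2 * pi} (\<lambda>\<theta>. a (?e \<rho> \<theta>) + b (?e \<rho> \<theta>) * cis (- (2 * \<theta>)))" for \<rho> :: real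
  have in_ball: "?e \<rho> \<theta> \<in> cball 0 r" if "\<rho> \<in> {0..r}" for \<rho> \<theta>
    using that by (auto simp: norm_mult)
  have ce: "continuous_on ({0..r} \<times> {0..2*pi}) (\<lambda>x. ?e (fst x) (snd x))"
    by (intro continuous_intros)
  have ca2: "continuous_on ({0..r} \<times> {0..2*pi}) (\<lambda>x. a (?e (fst x) (snd x)))"
    by (rule continuous_on_compose2[OF ca ce]) (use in_ball in auto)
  have cb2: "continuous_on ({0..r} \<times> {0..2*pi}) (\<lambda>x. b (?e (fst x) (snd x)))"
    by (rule continuous_on_compose2[OF cb ce]) (use in_ball in auto)
  have ch: "continuous_on (cball 0 r) h"
    using hd by (meson continuous_at_imp_continuous_on has_derivative_continuous)
  have ch2: "continuous_on ({0..r} \<times> {0..2*pi}) (\<lambda>x. h (?e (fst x) (snd x)))"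
    by (rule continuous_on_compose2[OF ch ce]) (use in_ball in auto)
  have slice: "continuous_on {0..2*pi} (\<lambda>\<theta>. f (?e \<rho> \<theta>))"
    if "continuous_on ({0..r} \<times> {0..2*pi}) (\<lambda>x. f (?e (fst x) (snd x)))" "\<rho> \<in> {0..r}"
    for f :: "complex \<Rightarrow> complex" and \<rho>
  proof -
    have "continuous_on {0..2*pi} (\<lambda>\<theta>. (\<rho>, \<theta>))" by (intro continuous_intros)
    moreover have "Pair \<rho> ` {0..2 * pi} \<subseteq> {0..r} \<times> {0..2 * pi}" using that(2) by auto
    ultimately have "continuous_on {0..2*pi} (\<lambda>x. f (?e (fst (\<rho>, x)) (snd (\<rho>, x))))"
      by (rule continuous_on_compose2[OF that(1)])
    then show ?thesis by simp
  qed
  note slices = slice[OF ca2] slice[OF cb2] slice[OF ch2]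
  have intble: "(\<lambda>\<theta>. f \<theta>) integrable_on {0..2*pi}" if "continuous_on {0..2*pi} f" for f :: "real \<Rightarrow> complex"
    using that by (rule integrable_continuous_real)
  have dJ: "(J has_vector_derivative J' \<rho>) (at \<rho> within {0..r})" if \<rho>: "\<rho> \<in> {0..r}" for \<rho>
  proof -
    have "((\<lambda>x. integral (cbox 0 (2*pi)) (\<lambda>\<theta>. h (?e x \<theta>) * cis (- \<theta>)))
      has_vector_derivative integral (cbox 0 (2*pi)) (\<lambda>\<theta>. a (?e \<rho> \<theta>) + b (?e \<rho> \<theta>) * cis (- (2 * \<theta>))))
      (at \<rho> within {0..r})"
    proof (rule leibniz_rule_vector_derivative[where fx = "\<lambda>\<rho> \<theta>. a (?e \<rho> \<theta>) + b (?e \<rho> \<theta>) * cis (- (2 * \<theta>))"])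
      fix x \<theta> :: real assume x: "x \<in> {0..r}"
      have e: "((\<lambda>x. ?e x \<theta>) has_derivative (\<lambda>s. of_real s * cis \<theta>)) (at x within {0..r})"
        by (auto intro!: derivative_eq_intros)
      have "((\<lambda>x. h (?e x \<theta>)) has_derivative
          (\<lambda>s. a (?e x \<theta>) * (of_real s * cis \<theta>) + b (?e x \<theta>) * cnj (of_real s * cis \<theta>))) (at x within {0..r})"
        by (rule has_derivative_compose[OF e hd[OF in_ball[OF x]]])
      from has_derivative_mult_left[OF this, of "cis (- \<theta>)"]
      show "((\<lambda>x. h (?e x \<theta>) * cis (- \<theta>)) has_vector_derivative
          a (?e x \<theta>) + b (?e x \<theta>) * cis (- (2 * \<theta>))) (at x within {0..r})"
        unfolding has_vector_derivative_def
      proof (rule has_derivative_eq_rhs, intro ext)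
        fix s :: real
        have cc: "cis \<theta> * cis (- \<theta>) = 1" "cis (- \<theta>) * cis (- \<theta>) = cis (- (2 * \<theta>))"
          by (simp_all add: cis_mult)
        have "(a (?e x \<theta>) * (of_real s * cis \<theta>) + b (?e x \<theta>) * cnj (of_real s * cis \<theta>)) * cis (- \<theta>)
          = of_real s * (a (?e x \<theta>) * (cis \<theta> * cis (- \<theta>)) + b (?e x \<theta>) * (cis (- \<theta>) * cis (- \<theta>)))"
          by (simp add: cis_cnj algebra_simps)
        then show "(a (?e x \<theta>) * (of_real s * cis \<theta>) + b (?e x \<theta>) * cnj (of_real s * cis \<theta>)) * cis (- \<theta>)
          = s *\<^sub>R (a (?e x \<theta>) + b (?e x \<theta>) * cis (- (2 * \<theta>)))"
          unfolding cc by (simp add: scaleR_conv_of_real)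
      qed
    next
      fix x assume "x \<in> {0..r}"
      then show "(\<lambda>\<theta>. h (?e x \<theta>) * cis (- \<theta>)) integrable_on cbox 0 (2*pi)"
        unfolding box_real by (intro intble continuous_intros slices)
    next
      show "continuous_on ({0..r} \<times> cbox 0 (2 * pi))
        (\<lambda>(x, \<theta>). a (?e x \<theta>) + b (?e x \<theta>) * cis (- (2 * \<theta>)))"
        unfolding box_real case_prod_beta by (intro continuous_intros ca2 cb2)
    qed (use \<rho> in auto)
    then show ?thesis unfolding J_def[abs_def] J'_def box_real .
  qed
  \<comment> \<open>The integrand of \<open>J\<close> is periodic, so the integral of its angular derivative vanishes.\<close>
  have JK: "J \<rho> = of_real \<rho> * K \<rho>" if \<rho>: "\<rho> \<in> {0..r}" for \<rho>
  proof -
    let ?f = "\<lambda>\<theta>. h (?e \<rho> \<theta>) * cis (- \<theta>)"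
    let ?f' = "\<lambda>\<theta>. \<i> * (of_real \<rho> * (a (?e \<rho> \<theta>) - b (?e \<rho> \<theta>) * cis (- (2 * \<theta>))) - h (?e \<rho> \<theta>) * cis (- \<theta>))"
    have FTC: "(?f' has_integral ?f (2 * pi) - ?f 0) {0..2 * pi}"
    proof (rule fundamental_theorem_of_calculus)
      fix \<theta> :: real assume "\<theta> \<in> {0..2 * pi}"
      have e: "((\<lambda>\<theta>. ?e \<rho> \<theta>) has_derivative (\<lambda>s. of_real \<rho> * (\<i> * of_real s * cis \<theta>))) (at \<theta> within {0..2 * pi})"
        by (auto intro!: derivative_eq_intros simp: scaleR_conv_of_real)
      have c: "((\<lambda>\<theta>. cis (- \<theta>)) has_derivative (\<lambda>s. - (\<i> * of_real s * cis (- \<theta>)))) (at \<theta> within {0..2 * pi})"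
        by (auto intro!: derivative_eq_intros simp: scaleR_conv_of_real)
      have cc: "cis \<theta> * cis (- \<theta>) = 1" "cis (- \<theta>) * cis (- \<theta>) = cis (- (2 * \<theta>))"
        by (simp_all add: cis_mult)
      have "((\<lambda>x. h (?e \<rho> x)) has_derivative
          (\<lambda>s. a (?e \<rho> \<theta>) * (of_real \<rho> * (\<i> * of_real s * cis \<theta>))
            + b (?e \<rho> \<theta>) * cnj (of_real \<rho> * (\<i> * of_real s * cis \<theta>)))) (at \<theta> within {0..2 * pi})"
        by (rule has_derivative_compose[OF e hd[OF in_ball[OF \<rho>]]])
      from has_derivative_mult[OF this c]
      show "(?f has_vector_derivative ?f' \<theta>) (at \<theta> within {0..2 * pi})"
        unfolding has_vector_derivative_def
      proof (rule has_derivative_eq_rhs, intro ext)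
        fix s :: real
        have "h (?e \<rho> \<theta>) * - (\<i> * of_real s * cis (- \<theta>)) +
            (a (?e \<rho> \<theta>) * (of_real \<rho> * (\<i> * of_real s * cis \<theta>))
            + b (?e \<rho> \<theta>) * cnj (of_real \<rho> * (\<i> * of_real s * cis \<theta>))) * cis (- \<theta>)
          = \<i> * of_real s * (of_real \<rho> * (a (?e \<rho> \<theta>) * (cis \<theta> * cis (- \<theta>)) - b (?e \<rho> \<theta>) * (cis (- \<theta>) * cis (- \<theta>)))
            - h (?e \<rho> \<theta>) * cis (- \<theta>))"
          by (simp add: cis_cnj algebra_simps)
        then show "h (?e \<rho> \<theta>) * - (\<i> * of_real s * cis (- \<theta>)) +
            (a (?e \<rho> \<theta>) * (of_real \<rho> * (\<i> * of_real s * cis \<theta>))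
            + b (?e \<rho> \<theta>) * cnj (of_real \<rho> * (\<i> * of_real s * cis \<theta>))) * cis (- \<theta>) = s *\<^sub>R ?f' \<theta>"
          unfolding cc by (simp add: scaleR_conv_of_real algebra_simps)
      qed
    qed simp
    have "?f (2 * pi) - ?f 0 = 0"
    proof -
      have c: "cis (- (2 * pi)) = 1" by (simp add: complex_eq_iff)
      show ?thesis unfolding c by simp
    qed
    then have "integral {0..2 * pi} ?f' = 0" using integral_unique[OF FTC] by (rule trans[rotated])
    moreover have "integral {0..2 * pi} ?f' = \<i> * (of_real \<rho> * K \<rho> - J \<rho>)"
    proof -
      have 1: "(\<lambda>\<theta>. a (?e \<rho> \<theta>) - b (?e \<rho> \<theta>) * cis (- (2 * \<theta>))) integrable_on {0..2*pi}"
        using \<rho> by (intro intble continuous_intros slices)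
      have 2: "?f integrable_on {0..2*pi}"
        using \<rho> by (intro intble continuous_intros slices)
      have 3: "(\<lambda>\<theta>. of_real \<rho> * (a (?e \<rho> \<theta>) - b (?e \<rho> \<theta>) * cis (- (2 * \<theta>)))) integrable_on {0..2*pi}"
        using \<rho> by (intro intble continuous_intros slices)
      show ?thesis
        unfolding integral_mult_right Henstock_Kurzweil_Integration.integral_diff[OF 3 2]
        by (simp add: K_def J_def)
    qed
    ultimately show ?thesis by simp
  qed
  have K0: "K 0 = 2 * pi * a 0"
  proof -
    have "K 0 = integral {0..2 * pi} (\<lambda>\<theta>. a 0) - b 0 * integral {0..2*pi} (\<lambda>\<theta>. cis (- (2 * \<theta>)))"
      unfolding K_def
      by (subst integral_mult_right[symmetric], subst Henstock_Kurzweil_Integration.integral_diff[symmetric])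
         (auto intro!: intble continuous_intros)
    then show ?thesis by (simp add: integral_cis_neg2 scaleR_conv_of_real)
  qed
  have contK: "continuous_on {0..r} K"
  proof -
    have "continuous_on {0..r} (\<lambda>\<rho>. integral (cbox 0 (2*pi)) (\<lambda>\<theta>. a (?e \<rho> \<theta>) - b (?e \<rho> \<theta>) * cis (- (2 * \<theta>))))"
      by (rule integral_continuous_on_param)
         (auto simp: case_prod_beta intro!: continuous_intros ca2 cb2)
    then show ?thesis unfolding K_def[abs_def] box_real .
  qed
  \<comment> \<open>The derivative of \<open>K = J / \<rho>\<close> only involves the oscillation of \<open>b\<close>.\<close>
  have diffJK: "cmod (J' \<rho> - K \<rho>) \<le> 4 * pi * L * \<rho>" if \<rho>: "\<rho> \<in> {0..r}" for \<rho>
  proof -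
    have "J' \<rho> - K \<rho> = integral {0..2 * pi} (\<lambda>\<theta>. 2 * (b (?e \<rho> \<theta>) * cis (- (2 * \<theta>))))"
      unfolding J'_def K_def
      by (subst Henstock_Kurzweil_Integration.integral_diff[symmetric])
         (use \<rho> in \<open>auto intro!: intble continuous_intros slices\<close>)
    also have "\<dots> = integral {0..2 * pi} (\<lambda>\<theta>. 2 * (b (?e \<rho> \<theta>) * cis (- (2 * \<theta>))))
        - 2 * b 0 * integral {0..2*pi} (\<lambda>\<theta>. cis (- (2 * \<theta>)))"
      by (simp add: integral_cis_neg2)
    also have "\<dots> = integral {0..2 * pi} (\<lambda>\<theta>. 2 * ((b (?e \<rho> \<theta>) - b 0) * cis (- (2 * \<theta>))))"
    proof -
      have "(\<lambda>\<theta>. 2 * ((b (?e \<rho> \<theta>) - b 0) * cis (- (2 * \<theta>))))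
        = (\<lambda>\<theta>. 2 * (b (?e \<rho> \<theta>) * cis (- (2 * \<theta>))) - 2 * b 0 * cis (- (2 * \<theta>)))"
        by (simp add: algebra_simps)
      then show ?thesis
        unfolding integral_mult_right[symmetric]
        by (simp only:, subst Henstock_Kurzweil_Integration.integral_diff[symmetric])
           (use \<rho> in \<open>auto intro!: intble continuous_intros slices\<close>)
    qed
    also have "cmod \<dots> \<le> (2 * (L * \<rho>)) * (2 * pi - 0)"
    proof (rule integral_bound)
      fix \<theta> :: real
      show "cmod (2 * ((b (?e \<rho> \<theta>) - b 0) * cis (- (2 * \<theta>)))) \<le> 2 * (L * \<rho>)"
        using L[OF in_ball[OF \<rho>, of \<theta>]] \<rho> by (simp add: norm_mult)
    qed (use \<rho> in \<open>auto intro!: continuous_intros slices\<close>)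
    finally show ?thesis by (simp add: algebra_simps)
  qed
  have "\<exists>x\<in>{0<..<r}. norm (K r - K 0) \<le> norm ((r - 0) *\<^sub>R ((J' x - K x) / of_real x))"
  proof (rule mvt_general[OF r contK, where f' = "\<lambda>x s. s *\<^sub>R ((J' x - K x) / of_real x)"])
    fix x :: real assume x: "0 < x" "x < r"
    have "at x within {0..r} = at x" using x by (intro at_within_interior) auto
    then have "(J has_derivative (\<lambda>s. s *\<^sub>R J' x)) (at x)"
      using dJ[of x] x by (simp add: has_vector_derivative_def)
    moreover have "((\<lambda>x. complex_of_real x) has_derivative (\<lambda>s. of_real s)) (at x)"
      by (auto intro!: derivative_eq_intros)
    ultimately have "((\<lambda>x. J x / of_real x) has_derivative
        (\<lambda>s. ((s *\<^sub>R J' x) * of_real x - J x * of_real s) / (of_real x * of_real x))) (at x)"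
      using x by (intro has_derivative_divide') auto
    moreover have "(\<lambda>s. ((s *\<^sub>R J' x) * of_real x - J x * of_real s) / (of_real x * of_real x))
        = (\<lambda>s. s *\<^sub>R ((J' x - K x) / of_real x))"
      using x JK[of x] by (auto simp: fun_eq_iff field_simps scaleR_conv_of_real)
    ultimately have "((\<lambda>x. J x / of_real x) has_derivative (\<lambda>s. s *\<^sub>R ((J' x - K x) / of_real x))) (at x)"
      by simp
    then show "(K has_derivative (\<lambda>s. s *\<^sub>R ((J' x - K x) / of_real x))) (at x)"
      by (rule has_derivative_transform_within_open[of _ _ _ "UNIV" "{0<..<r}"])
         (use x JK in auto)
  qed
  then obtain x where x: "0 < x" "x < r" "norm (K r - K 0) \<le> norm ((r - 0) *\<^sub>R ((J' x - K x) / of_real x))"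
    by auto
  have "norm ((r - 0) *\<^sub>R ((J' x - K x) / of_real x)) = r * (cmod (J' x - K x) / x)"
    using x r by (simp add: norm_divide)
  also have "\<dots> \<le> r * (4 * pi * L)"
    using diffJK[of x] x r by (intro mult_left_mono) (auto simp: field_simps)
  finally have KK: "norm (K r - K 0) \<le> r * (4 * pi * L)" using x(3) by linarith
  have Kr: "cmod (K r) \<le> 2 * pi * M / r"
  proof -
    have "cmod (J r) \<le> M * (2 * pi - 0)"
      unfolding J_def
    proof (rule integral_bound)
      fix \<theta> :: real
      show "cmod (h (?e r \<theta>) * cis (- \<theta>)) \<le> M"
        using M[OF in_ball[of r \<theta>]] r by (simp add: norm_mult)
    qed (use r in \<open>auto intro!: continuous_intros slices\<close>)
    then show ?thesis using JK[of r] r by (simp add: norm_mult field_simps)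
  qed
  have "2 * pi * cmod (a 0) = cmod (K 0)" unfolding K0 by (simp add: norm_mult)
  also have "\<dots> \<le> 2 * pi * M / r + r * (4 * pi * L)"
    using KK Kr norm_triangle_ineq4[of "K r" "K r - K 0"] by simp
  also have "\<dots> = 2 * pi * (M / r + 2 * L * r)" by (simp add: algebra_simps)
  finally show ?thesis by simp
qed

lemma axis_complex_decompose: "axis j s = Re s *\<^sub>R axis j 1 + Im s *\<^sub>R axis j \<i>"
  by (simp add: vec_eq_iff axis_def complex_eq_iff)

lemma norm_axis_complex: "norm (axis j s :: complex^'n::finite) = cmod s"
proof -
  have "norm (axis j s :: complex^'n) = L2_set (\<lambda>i. if i = j then cmod s else 0) UNIV"
    unfolding norm_vec_def by (rule L2_set_cong) (auto simp: axis_def)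
  also have "\<dots> = cmod s"
    by (simp add: L2_set_def if_distrib[of "\<lambda>x. x\<^sup>2"] cong: if_cong)
  finally show ?thesis .
qed

lemma has_derivative_complex_line:
  fixes f :: "complex^'n::finite \<Rightarrow> complex"
  assumes "f differentiable at (p + axis j t)"
  shows "((\<lambda>t. f (p + axis j t)) has_derivative
    (\<lambda>s. wirt (False, j) f (p + axis j t) * s + wirt (True, j) f (p + axis j t) * cnj s)) (at t within S)"
proof -
  let ?f' = "frechet_derivative f (at (p + axis j t))"
  have f': "(f has_derivative ?f') (at (p + axis j t))" using assms frechet_derivative_works by blast
  have "bounded_linear (axis j :: complex \<Rightarrow> complex^'n)"
  proof (rule bounded_linear_intro[of _ 1])
    fix s :: complex
    show "norm (axis j s :: complex^'n) \<le> norm s * 1" by (simp add: norm_axis_complex)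
  qed (auto simp: axis_def vec_eq_iff)
  then have "((\<lambda>t. p + axis j t) has_derivative axis j) (at t within S)"
    by (auto intro!: derivative_eq_intros bounded_linear_imp_has_derivative)
  from has_derivative_compose[OF this f'] show ?thesis
  proof (rule has_derivative_eq_rhs, intro ext)
    fix s
    have lin: "linear ?f'" using has_derivative_linear[OF f'] .
    have "?f' (axis j s) = of_real (Re s) * ?f' (axis j 1) + of_real (Im s) * ?f' (axis j \<i>)"
      by (subst axis_complex_decompose[of j s]) (simp only: linear_add[OF lin] linear_cmul[OF lin], simp add: scaleR_conv_of_real)
    also have "\<dots> = wirt (False, j) f (p + axis j t) * s + wirt (True, j) f (p + axis j t) * cnj s"
      by (simp add: wirt_def complex_eq_iff field_simps)
    finally show "?f' (axis j s) = wirt (False, j) f (p + axis j t) * s + wirt (True, j) f (p + axis j t) * cnj s" .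
  qed
qed

text \<open>The circle estimate on the complex line through \<open>p\<close> in the direction \<open>j\<close>; the Lipschitz constant of
  the conjugate derivative comes from its own first derivatives.\<close>

lemma wirt_estimate:
  fixes f :: "complex^'n::finite \<Rightarrow> complex"
  assumes U: "open U" "cball p r \<subseteq> U" "0 < r" and sm: "smooth_on f U"
    and M: "\<And>q. q \<in> cball p r \<Longrightarrow> cmod (f q) \<le> M"
    and B: "\<And>q d. q \<in> cball p r \<Longrightarrow> cmod (wirt d (wirt (True, j) f) q) \<le> B"
  shows "cmod (wirt (False, j) f p) \<le> M / r + 4 * B * r"
proof -
  have inb: "p + axis j t \<in> cball p r" if "t \<in> cball 0 r" for t
    using that by (simp add: dist_norm norm_axis_complex)
  have smw: "smooth_on (wirt d f) U" for d by (rule smooth_on_wirt[OF U(1) sm])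
  have contw: "continuous_on (cball 0 r) (\<lambda>t. wirt d f (p + axis j t))" for d
    using inb U(2) by (intro continuous_at_imp_continuous_on ballI
        has_derivative_continuous[OF has_derivative_complex_line] smooth_on_differentiable[OF smw]) auto
  have B0: "0 \<le> B" using order_trans[OF norm_ge_zero B[of p]] U(3) by simp
  have "cmod (wirt (False, j) f (p + axis j 0)) \<le> M / r + 2 * (2 * B) * r"
  proof (rule first_derivative_circle_estimate[where h = "\<lambda>t. f (p + axis j t)"
        and b = "\<lambda>t. wirt (True, j) f (p + axis j t)"])
    fix t :: complex assume t: "t \<in> cball 0 r"
    show "((\<lambda>t. f (p + axis j t)) has_derivative
      (\<lambda>s. wirt (False, j) f (p + axis j t) * s + wirt (True, j) f (p + axis j t) * cnj s)) (at t)"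
      using inb[OF t] U(2) by (intro has_derivative_complex_line smooth_on_differentiable[OF sm]) auto
    show "cmod (f (p + axis j t)) \<le> M" by (rule M[OF inb[OF t]])
    let ?g = "wirt (True, j) f"
    have "norm (?g (p + axis j t) - ?g (p + axis j 0)) \<le> (2 * B) * norm (t - 0)"
    proof (rule differentiable_bound[where S = "cball 0 r" and
        f' = "\<lambda>t s. wirt (False, j) ?g (p + axis j t) * s + wirt (True, j) ?g (p + axis j t) * cnj s"])
      fix t :: complex assume t: "t \<in> cball 0 r"
      show "((\<lambda>t. ?g (p + axis j t)) has_derivative
        (\<lambda>s. wirt (False, j) ?g (p + axis j t) * s + wirt (True, j) ?g (p + axis j t) * cnj s))
        (at t within cball 0 r)"
        using inb[OF t] U(2) by (intro has_derivative_complex_line smooth_on_differentiable[OF smw]) auto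
      show "onorm (\<lambda>s. wirt (False, j) ?g (p + axis j t) * s + wirt (True, j) ?g (p + axis j t) * cnj s) \<le> 2 * B"
      proof (rule onorm_le)
        fix s
        have "cmod (wirt (False, j) ?g (p + axis j t) * s + wirt (True, j) ?g (p + axis j t) * cnj s)
          \<le> cmod (wirt (False, j) ?g (p + axis j t)) * cmod s + cmod (wirt (True, j) ?g (p + axis j t)) * cmod s"
          by (metis complex_mod_cnj norm_mult norm_triangle_ineq)
        also have "\<dots> \<le> B * cmod s + B * cmod s"
          using B[OF inb[OF t]] by (intro add_mono mult_right_mono) auto
        finally show "cmod (wirt (False, j) ?g (p + axis j t) * s + wirt (True, j) ?g (p + axis j t) * cnj s)
          \<le> 2 * B * cmod s" by simp
      qed
    qed (use t U(3) in auto)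
    then show "cmod (?g (p + axis j t) - ?g (p + axis j 0)) \<le> (2 * B) * cmod t" by simp
  qed (use U(3) contw in auto)
  moreover have "p + axis j 0 = p" by (simp add: vec_eq_iff axis_def)
  ultimately show ?thesis by simp
qed

lemma power_le_exp_fact: "real n ^ n \<le> exp 1 ^ n * fact n"
proof -
  have "(\<lambda>k. real n ^ k /\<^sub>R fact k) sums exp (real n)" by (rule exp_converges)
  then have "sum (\<lambda>k. real n ^ k /\<^sub>R fact k) {n} \<le> exp (real n)"
    using sum_le_suminf[of "\<lambda>k. real n ^ k /\<^sub>R fact k" "{n}"]
    by (auto simp: sums_iff)
  then have "real n ^ n / fact n \<le> exp (real n)" by (simp add: divide_inverse mult.commute)
  also have "exp (real n) = exp 1 ^ n" by (simp flip: exp_of_nat_mult)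
  finally show ?thesis by (simp add: field_simps)
qed

text \<open>A word whose outermost letter is a conjugate one is a word in a conjugate derivative of \<open>f\<close>, hence
  under control. An outermost holomorphic letter is removed by the circle estimate, at the price of
  a smaller ball. To reach order \<open>n\<close>, the radius is halved in \<open>n\<close> equal steps of size \<open>\<epsilon>\<close>; this gives
  a bound \<open>(c n)\<^sup>n\<close>, and \<open>n\<^sup>n \<le> e\<^sup>n n!\<close>.\<close>

theorem cauchy_riemann_regularity:
  fixes f :: "complex^'n::finite \<Rightarrow> complex"
  assumes U: "open U" and sm: "smooth_on f U" and bar: "\<And>j. cauchy_bounded_on (wirt (True, j) f) U"
  shows "cauchy_bounded_on f U"
proof -
  have "\<exists>r>0. \<exists>C R. \<forall>q\<in>ball p0 r. \<forall>w. cmod (wirts w f q) \<le> C * R ^ length w * fact (length w)"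
    if p0: "p0 \<in> U" for p0
  proof -
    let ?bar = "\<lambda>N. \<forall>j\<in>UNIV. \<forall>q\<in>ball p0 (1 / N). \<forall>w.
          cmod (wirts w (wirt (True, j) f) q) \<le> N * N ^ length w * fact (length w)"
    have "\<forall>j\<in>UNIV. \<forall>\<^sub>F N in at_top. \<forall>q\<in>ball p0 (1 / N). \<forall>w.
          cmod (wirts w (wirt (True, j) f) q) \<le> N * N ^ length w * fact (length w)"
      using bar p0 unfolding cauchy_bounded_on_iff_eventually[OF U] by blast
    then have "\<forall>\<^sub>F N in at_top. ?bar N" by (rule eventually_ball_finite[OF finite])
    then have "\<forall>\<^sub>F N in at_top. 1 \<le> N \<and> ball p0 (1 / N) \<subseteq> U
      \<and> (\<forall>q\<in>ball p0 (1 / N). cmod (f q) \<le> N) \<and> ?bar N"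
      by (rule eventually_conj[OF eventually_ge_at_top eventually_conj[OF eventually_ball_subset[OF U p0]
              eventually_conj[OF eventually_ball_norm_le[OF smooth_on_continuous[OF sm] U p0]]]])
    from eventually_at_top_witness[OF this] obtain N where N: "1 \<le> N" "ball p0 (1 / N) \<subseteq> U"
      and fN: "\<And>q. q \<in> ball p0 (1 / N) \<Longrightarrow> cmod (f q) \<le> N"
      and barN: "\<And>q j w. q \<in> ball p0 (1 / N) \<Longrightarrow>
          cmod (wirts w (wirt (True, j) f) q) \<le> N * N ^ length w * fact (length w)"
      by blast
    \<comment> \<open>The number \<open>X = 1 / \<epsilon>\<close> is the loss in one step; it also dominates \<open>N * n\<close>, and hence the
      factorials in the bounds of the conjugate derivatives.\<close>
    have main: "cmod (wirts w f q) \<le> 2 * N * (4 * N * exp 1) ^ length w * fact (length w)"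
      if q: "q \<in> ball p0 (1 / (2 * N))" and n: "length w = n" "0 < n" for q w n
    proof -
      define \<epsilon> where "\<epsilon> = 1 / (2 * N * real n)"
      define X where "X = 2 * N * real n"
      have X: "1 \<le> X" "N * real n \<le> X" "real n \<le> X"
      proof -
        have n1: "1 \<le> real n" using n by simp
        have a: "1 * real n \<le> N * real n" using N n1 by (intro mult_right_mono) auto
        then show "real n \<le> X" "N * real n \<le> X" using n1 by (auto simp: X_def)
        then show "1 \<le> X" using n1 by linarith
      qed
      have eps: "\<epsilon> > 0" "\<epsilon> = 1 / X" using N n by (simp_all add: \<epsilon>_def X_def)
      have "\<forall>p\<in>ball p0 (1 / N - real (length v) * \<epsilon>). cmod (wirts v f p) \<le> 2 * N * real (Suc (length v)) * X ^ length v"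
        if "length v \<le> n" for v
        using that
      proof (induction v)
        case Nil
        then show ?case using fN N(1) by (auto intro: order_trans[of _ N])
      next
        case (Cons d v)
        obtain b j where d: "d = (b, j)" by (cases d)
        define m where "m = length v"
        have m: "Suc m \<le> n" using Cons.prems by (simp add: m_def)
        have IH: "cmod (wirts v f p) \<le> 2 * N * real (Suc m) * X ^ m"
          if "p \<in> ball p0 (1 / N - real m * \<epsilon>)" for p
          using Cons.IH Cons.prems that by (simp add: m_def)
        have factbd: "N ^ k * fact k \<le> X ^ k" if "k \<le> n" for k
        proof -
          have "(fact k :: real) \<le> real (k ^ k)" by (metis fact_le_power of_nat_fact of_nat_mono order_refl of_nat_id)
          also have "\<dots> \<le> real n ^ k" using that by (simp add: power_mono)
          finally have "N ^ k * fact k \<le> N ^ k * real n ^ k" using N by (intro mult_left_mono) auto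
          also have "\<dots> = (N * real n) ^ k" by (simp add: power_mult_distrib)
          also have "\<dots> \<le> X ^ k" using X N by (intro power_mono) auto
          finally show ?thesis .
        qed
        show ?case
        proof
          fix p assume p: "p \<in> ball p0 (1 / N - real (length (d # v)) * \<epsilon>)"
          have sub: "q \<in> ball p0 (1 / N - real m * \<epsilon>)" "q \<in> ball p0 (1 / N)" if "q \<in> cball p \<epsilon>" for q
          proof -
            have "dist p0 q \<le> dist p0 p + dist p q" by (rule dist_triangle)
            also have "\<dots> < 1 / N - real m * \<epsilon>" using p that by (simp add: m_def algebra_simps)
            finally show "q \<in> ball p0 (1 / N - real m * \<epsilon>)" by simp
            moreover have "0 \<le> real m * \<epsilon>" using eps by simp
            ultimately show "q \<in> ball p0 (1 / N)" by auto
          qed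
          have pp: "p \<in> cball p \<epsilon>" using eps by simp
          have pU: "p \<in> U" using sub(2)[OF pp] N by blast
          have smv: "smooth_on (wirts v f) U" by (rule smooth_on_wirts[OF U sm])
          have bound: "cmod (wirts (d # v) f p) \<le> 2 * N * real (Suc m) * X ^ Suc m + 2 * N * X ^ Suc m"
          proof (cases b)
            case True
            have "wirts (d # v) f p = wirts v (wirt (True, j) f) p"
              using wirts_commute[OF U sm pU] d True by simp
            then have "cmod (wirts (d # v) f p) \<le> N * (N ^ m * fact m)"
              using barN[OF sub(2)[OF pp], of v j] by (simp add: m_def mult.assoc)
            also have "\<dots> \<le> N * X ^ Suc m"
            proof (rule mult_left_mono)
              have "N ^ m * fact m \<le> X ^ m" using m by (intro factbd) simp
              also have "\<dots> \<le> X ^ Suc m" using X by (intro power_increasing) auto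
              finally show "N ^ m * fact m \<le> X ^ Suc m" .
            qed (use N in simp)
            also have "\<dots> \<le> 2 * N * real (Suc m) * X ^ Suc m + 2 * N * X ^ Suc m"
            proof -
              have "0 \<le> N * X ^ Suc m" "0 \<le> 2 * N * real (Suc m) * X ^ Suc m" using N X by auto
              then show ?thesis by linarith
            qed
            finally show ?thesis .
          next
            case False
            have "cmod (wirt (False, j) (wirts v f) p)
                \<le> (2 * N * real (Suc m) * X ^ m) / \<epsilon> + 4 * (N * X ^ Suc m) * \<epsilon>"
            proof (rule wirt_estimate[OF U _ eps(1) smv])
              show "cball p \<epsilon> \<subseteq> U" using sub(2) N by blast
              show "cmod (wirts v f q) \<le> 2 * N * real (Suc m) * X ^ m" if "q \<in> cball p \<epsilon>" for q
                using IH sub(1)[OF that] .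
              fix q e assume q: "q \<in> cball p \<epsilon>"
              have qU: "q \<in> U" using sub(2)[OF q] N by blast
              have "wirt e (wirt (True, j) (wirts v f)) q = wirts (e # v) (wirt (True, j) f) q"
                using wirts_commute[OF U sm] qU
                by (simp, intro wirt_cong[OF U]) (auto intro!: smooth_on_differentiable[of _ U] smooth_on_wirt U smv)
              then have "cmod (wirt e (wirt (True, j) (wirts v f)) q) \<le> N * (N ^ Suc m * fact (Suc m))"
                using barN[OF sub(2)[OF q], of "e # v" j] by (simp add: m_def mult.assoc)
              also have "\<dots> \<le> N * X ^ Suc m" using N m by (intro mult_left_mono factbd) auto
              finally show "cmod (wirt e (wirt (True, j) (wirts v f)) q) \<le> N * X ^ Suc m" .
            qed
            also have "(2 * N * real (Suc m) * X ^ m) / \<epsilon> = 2 * N * real (Suc m) * X ^ Suc m"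
              using eps by simp
            also have "4 * (N * X ^ Suc m) * \<epsilon> \<le> 2 * N * X ^ Suc m"
            proof -
              have "\<epsilon> \<le> 1 / 2"
              proof -
                have "1 * 1 \<le> N * real n" using N n by (intro mult_mono) auto
                then show ?thesis unfolding \<epsilon>_def by (simp add: field_simps)
              qed
              then have "4 * (N * X ^ Suc m) * \<epsilon> \<le> 4 * (N * X ^ Suc m) * (1 / 2)"
                using N X by (intro mult_left_mono) auto
              then show ?thesis by simp
            qed
            finally show ?thesis using d False by simp
          qed
          also have "\<dots> = 2 * N * real (Suc (length (d # v))) * X ^ length (d # v)"
            by (simp add: m_def algebra_simps)
          finally show "cmod (wirts (d # v) f p) \<le> 2 * N * real (Suc (length (d # v))) * X ^ length (d # v)" .
        qed
      qed
      moreover have "1 / N - real n * \<epsilon> = 1 / (2 * N)" using N n by (simp add: \<epsilon>_def field_simps)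
      ultimately have "cmod (wirts w f q) \<le> 2 * N * real (Suc n) * X ^ n" using q n by force
      also have "\<dots> \<le> 2 * N * 2 ^ n * X ^ n"
      proof (intro mult_right_mono mult_left_mono)
        have "Suc n \<le> 2 ^ n" by (rule Suc_leI[OF less_exp])
        then show "real (Suc n) \<le> 2 ^ n"
          by (metis of_nat_le_iff of_nat_numeral of_nat_power)
      qed (use N X in auto)
      also have "\<dots> = 2 * N * (4 * N) ^ n * real n ^ n"
        by (simp add: X_def power_mult_distrib mult_ac flip: power_mult_distrib[of 2 2])
      also have "\<dots> \<le> 2 * N * (4 * N) ^ n * (exp 1 ^ n * fact n)"
        using N by (intro mult_left_mono power_le_exp_fact) auto
      finally show ?thesis using n by (simp add: power_mult_distrib mult_ac)
    qed
    have "cmod (wirts w f q) \<le> 2 * N * (4 * N * exp 1) ^ length w * fact (length w)"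
      if q: "q \<in> ball p0 (1 / (2 * N))" for q w
    proof (cases "w = []")
      case True
      have "1 / (2 * N) \<le> 1 / N" using N by (simp add: field_simps)
      then have "cmod (f q) \<le> N" using q by (intro fN) auto
      then show ?thesis using True N by simp
    qed (use main[OF q] in auto)
    moreover have "1 / (2 * N) > 0" using N by simp
    ultimately show ?thesis by blast
  qed
  then show ?thesis unfolding cauchy_bounded_on_def using sm by blast
qed

section \<open>Convergent power series from derivative bounds\<close>

abbreviation dirs :: "'a::euclidean_space list \<Rightarrow> ('a \<Rightarrow> 'b::real_normed_vector) \<Rightarrow> 'a \<Rightarrow> 'b" where
  "dirs w f \<equiv> foldr (\<lambda>v f p. frechet_derivative f (at p) v) w f"

lemma smooth_on_dirs: "smooth_on f U \<Longrightarrow> smooth_on (dirs w f) U"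
  by (induction w) (auto intro: smooth_on_directional)

lemma frechet_derivative_cong:
  assumes "open U" "p \<in> U" "\<And>q. q \<in> U \<Longrightarrow> f q = g q" "f differentiable at p"
  shows "frechet_derivative f (at p) = frechet_derivative g (at p)"
  using frechet_derivative_transform_within_open[OF assms(4,1,2)] assms(3) by blast

lemma dirs_cong:
  assumes "open U" "smooth_on f U" "\<And>q. q \<in> U \<Longrightarrow> f q = g q"
  shows "p \<in> U \<Longrightarrow> dirs w f p = dirs w g p"
proof (induction w arbitrary: p)
  case (Cons v w)
  have "frechet_derivative (dirs w f) (at p) = frechet_derivative (dirs w g) (at p)"
    using Cons smooth_on_dirs[OF assms(2)]
    by (intro frechet_derivative_cong[OF assms(1)]) (auto intro: smooth_on_differentiable)
  then show ?case by simp
qed (use assms in simp)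

lemma dirs_add:
  assumes "open U" "smooth_on f U" "smooth_on g U" "p \<in> U"
  shows "dirs w (\<lambda>p. f p + g p) p = dirs w f p + dirs w g p"
  using assms(4)
proof (induction w arbitrary: p)
  case (Cons v w)
  have "frechet_derivative (dirs w (\<lambda>p. f p + g p)) (at p)
      = frechet_derivative (\<lambda>p. dirs w f p + dirs w g p) (at p)"
    by (rule frechet_derivative_cong[OF assms(1) Cons.prems Cons.IH])
       (use Cons.prems assms in \<open>auto intro!: smooth_on_differentiable[of _ U] smooth_on_dirs smooth_on_add\<close>)
  also have "\<dots> = (\<lambda>v. frechet_derivative (dirs w f) (at p) v + frechet_derivative (dirs w g) (at p) v)"
    using Cons.prems assms
    by (intro frechet_derivative_at[symmetric] has_derivative_add smooth_on_has_derivative[of _ U] smooth_on_dirs)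
  finally show ?case by simp
qed simp

lemma dirs_compose_bounded_linear:
  assumes "open U" "smooth_on f U" "bounded_linear L" "p \<in> U"
  shows "dirs w (\<lambda>p. L (f p)) p = L (dirs w f p)"
  using assms(4)
proof (induction w arbitrary: p)
  case (Cons v w)
  have smL: "smooth_on (\<lambda>p. L (f p)) U"
    by (rule smooth_on_compose_bounded_linear[OF assms(1,3,2)])
  have "frechet_derivative (dirs w (\<lambda>p. L (f p))) (at p) = frechet_derivative (\<lambda>p. L (dirs w f p)) (at p)"
    by (rule frechet_derivative_cong[OF assms(1) Cons.prems Cons.IH])
       (use Cons.prems in \<open>auto intro!: smooth_on_differentiable[of _ U] smooth_on_dirs smL\<close>)
  also have "\<dots> = (\<lambda>v. L (frechet_derivative (dirs w f) (at p) v))"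
    using Cons.prems assms
    by (intro frechet_derivative_at[symmetric] bounded_linear.has_derivative[OF assms(3)]
        smooth_on_has_derivative[of _ U] smooth_on_dirs)
  finally show ?case by simp
qed simp

lemma dirs_zero [simp]: "dirs w (\<lambda>p. 0) = (\<lambda>p. 0)"
  by (induction w) auto

lemma dirs_sum:
  assumes "open U" "finite I" "\<And>i. i \<in> I \<Longrightarrow> smooth_on (f i) U" "p \<in> U"
  shows "dirs w (\<lambda>p. \<Sum>i\<in>I. f i p) p = (\<Sum>i\<in>I. dirs w (f i) p)"
  using assms(2,3)
proof (induction I rule: finite_induct)
  case (insert i I)
  then have "dirs w (\<lambda>p. f i p + (\<Sum>i\<in>I. f i p)) p = dirs w (f i) p + dirs w (\<lambda>p. \<Sum>i\<in>I. f i p) p"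
    by (intro dirs_add[OF assms(1) _ _ assms(4)] smooth_on_sum[OF assms(1)]) auto
  then show ?case using insert by simp
qed simp

lemma dirs_compose_linear:
  fixes f :: "'b::euclidean_space \<Rightarrow> 'c::real_normed_vector" and P :: "'a::euclidean_space \<Rightarrow> 'b"
  assumes "open U" "smooth_on f U" "bounded_linear P" "P p \<in> U"
  shows "dirs w (\<lambda>p. f (P p)) p = dirs (map P w) f (P p)"
proof -
  have d: "((\<lambda>p. dirs (map P w) f (P p)) has_derivative
    (\<lambda>v. frechet_derivative (dirs (map P w) f) (at (P p)) (P v))) (at p)" if "P p \<in> U" for w p
    using that assms
    by (intro has_derivative_compose[where g = "dirs (map P w) f", OF bounded_linear_imp_has_derivative[OF assms(3)]]
        smooth_on_has_derivative[of _ U] smooth_on_dirs)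
  have op: "open (P -` U)"
    by (rule open_vimage[OF assms(1)]) (simp add: assms(3) linear_continuous_on)
  show "dirs w (\<lambda>p. f (P p)) p = dirs (map P w) f (P p)"
    using assms(4)
  proof (induction w arbitrary: p)
    case (Cons v w)
    have "frechet_derivative (dirs w (\<lambda>p. f (P p))) (at p) = frechet_derivative (\<lambda>p. dirs (map P w) f (P p)) (at p)"
      using Cons d[OF Cons.prems, of w]
      by (intro frechet_derivative_cong[OF op, symmetric]) (auto simp: differentiable_def)
    also have "\<dots> = (\<lambda>v. frechet_derivative (dirs (map P w) f) (at (P p)) (P v))"
      using d[OF Cons.prems] by (intro frechet_derivative_at[symmetric])
    finally show ?case by simp
  qed simp
qed

lemma smooth_on_compose_linear:
  fixes f :: "'b::euclidean_space \<Rightarrow> 'c::real_normed_vector" and P :: "'a::euclidean_space \<Rightarrow> 'b"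
  assumes "open U" "smooth_on f U" "bounded_linear P"
  shows "smooth_on (\<lambda>p. f (P p)) (P -` U)"
proof -
  have op: "open (P -` U)"
    by (rule open_vimage[OF assms(1)]) (simp add: assms(3) linear_continuous_on)
  have "smooth_on g U \<Longrightarrow> Ck_on k (\<lambda>p. g (P p)) (P -` U)" for g :: "'b \<Rightarrow> 'c" and k
  proof (induction k arbitrary: g)
    case 0
    then show ?case
      using continuous_on_compose2[OF smooth_on_continuous[OF 0] linear_continuous_on[OF assms(3)], of "P -` U"]
      by auto
  next
    case (Suc k)
    have d: "((\<lambda>p. g (P p)) has_derivative (\<lambda>v. frechet_derivative g (at (P p)) (P v))) (at p)"
      if "P p \<in> U" for p
      using that Suc.prems
      by (intro has_derivative_compose[where g = g, OF bounded_linear_imp_has_derivative[OF assms(3)]]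
          smooth_on_has_derivative[of _ U])
    have "Ck_on k (\<lambda>p. frechet_derivative (\<lambda>p. g (P p)) (at p) v) (P -` U)" for v
    proof -
      have "Ck_on k (\<lambda>p. frechet_derivative g (at (P p)) (P v)) (P -` U)"
        using Suc.IH[OF smooth_on_directional[OF Suc.prems]] .
      moreover have "frechet_derivative (\<lambda>p. g (P p)) (at p) v = frechet_derivative g (at (P p)) (P v)"
        if "p \<in> P -` U" for p
        using fun_cong[OF frechet_derivative_at[OF d, symmetric]] that by auto
      ultimately show ?thesis by (subst Ck_on_cong[OF op]) auto
    qed
    then show ?case using d by (auto simp: differentiable_def)
  qed
  then show ?thesis using assms(2) by (simp add: smooth_on_def)
qed

text \<open>An absolutely convergent series may be summed fibre by fibre. It is used twice for the series over
  words: by length, to identify its value, and by letter counts, to reach a power series.\<close>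

lemma has_sum_fibres:
  fixes f :: "'w \<Rightarrow> 'b::banach"
  assumes "f summable_on W" "g ` W \<subseteq> A"
  shows "((\<lambda>a. infsum f {w \<in> W. g w = a}) has_sum infsum f W) A"
proof -
  let ?S = "Sigma A (\<lambda>a. {w \<in> W. g w = a})"
  have bij: "bij_betw snd ?S W"
    using assms(2) by (auto simp: bij_betw_def inj_on_def image_iff)
  have sm: "(\<lambda>(a, w). f w) summable_on ?S"
    using assms(1) summable_on_reindex_bij_betw[OF bij, of f] by (simp add: case_prod_unfold)
  have "(\<lambda>a. infsum f {w \<in> W. g w = a}) summable_on A"
    by (rule summable_on_Sigma_banach[OF sm])
  moreover have "infsum (\<lambda>a. infsum f {w \<in> W. g w = a}) A = infsum f W"
    using infsum_Sigma'_banach[OF sm] infsum_reindex_bij_betw[OF bij, of f] by (simp add: case_prod_unfold)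
  ultimately show ?thesis by (metis has_sum_infsum)
qed

lemma prod_list_count:
  "set w \<subseteq> B \<Longrightarrow> finite B \<Longrightarrow> (\<Prod>b\<leftarrow>w. x b) = (\<Prod>b\<in>B. x b ^ count_list w b :: real)"
proof (induction w)
  case (Cons a w)
  have "(\<Prod>b\<in>B. x b ^ count_list (a # w) b) = (\<Prod>b\<in>B. (if b = a then x a else 1) * x b ^ count_list w b)"
    by (intro prod.cong) auto
  also have "\<dots> = x a * (\<Prod>b\<in>B. x b ^ count_list w b)"
    using Cons.prems by (simp add: prod.distrib)
  finally show ?case using Cons by simp
qed simp

lemma sum_words_Suc:
  fixes B :: "'a set" and g :: "'a list \<Rightarrow> 'b::comm_monoid_add"
  assumes "finite B"
  shows "(\<Sum>w | set w \<subseteq> B \<and> length w = Suc n. g w) = (\<Sum>w | set w \<subseteq> B \<and> length w = n. \<Sum>b\<in>B. g (b # w))"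
proof -
  have fin: "finite {w. set w \<subseteq> B \<and> length w = n}" by (rule finite_lists_length_eq[OF assms])
  have "(\<Sum>w | set w \<subseteq> B \<and> length w = n. \<Sum>b\<in>B. g (b # w))
      = (\<Sum>(w, b)\<in>{w. set w \<subseteq> B \<and> length w = n} \<times> B. g (b # w))"
    by (rule sum.cartesian_product)
  also have "\<dots> = (\<Sum>w | set w \<subseteq> B \<and> length w = Suc n. g w)"
    by (rule sum.reindex_bij_witness[where i = "\<lambda>w. (tl w, hd w)" and j = "\<lambda>(w, b). b # w"])
       (auto simp: length_Suc_conv)
  finally show ?thesis by simp
qed

lemma sum_words_prod_list:
  fixes x :: "'a \<Rightarrow> real"
  assumes "finite B"
  shows "(\<Sum>w | set w \<subseteq> B \<and> length w = n. \<Prod>b\<leftarrow>w. x b) = (\<Sum>b\<in>B. x b) ^ n"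
proof (induction n)
  case 0
  have "{w. set w \<subseteq> B \<and> length w = 0} = {[]}" by auto
  then show ?case by simp
next
  case (Suc n)
  then show ?case
    by (simp add: sum_words_Suc[OF assms] flip: sum_distrib_left sum_distrib_right)
qed

text \<open>Along a segment the \<open>n\<close>-th derivative of \<open>f\<close> is a sum over the words of length \<open>n\<close> in the
  basis vectors. Taylor's formula therefore yields an absolutely convergent series over all words;
  collecting the words with the same letter counts turns it into a power series.\<close>

theorem real_analytic_on_if_derivative_bounds:
  fixes f :: "'a::euclidean_space \<Rightarrow> real"
  assumes U: "open U" and sm: "smooth_on f U"
    and bd: "\<And>p. p \<in> U \<Longrightarrow> \<exists>r>0. \<exists>C R. \<forall>q\<in>ball p r. \<forall>w. set w \<subseteq> Basis \<longrightarrow>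
      \<bar>dirs w f q\<bar> \<le> C * R ^ length w * fact (length w)"
  shows "real_analytic_on f U"
  unfolding real_analytic_on_def
proof
  fix p assume p: "p \<in> U"
  obtain r0 C R0 where r0: "r0 > 0" and bd0: "\<And>q w. q \<in> ball p r0 \<Longrightarrow> set w \<subseteq> Basis
      \<Longrightarrow> \<bar>dirs w f q\<bar> \<le> C * R0 ^ length w * fact (length w)"
    using bd[OF p] by blast
  obtain r1 where r1: "r1 > 0" "ball p r1 \<subseteq> U" using U p open_contains_ball by blast
  have C: "0 \<le> C" using bd0[of p "[]"] r0 by simp
  define R where "R = \<bar>R0\<bar> + 1"
  have R: "R > 0" by (simp add: R_def)
  have bdR: "\<bar>dirs w f q\<bar> \<le> C * R ^ length w * fact (length w)" if "q \<in> ball p r0" "set w \<subseteq> Basis" for q w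
  proof -
    have "R0 ^ length w \<le> \<bar>R0\<bar> ^ length w" by (metis abs_ge_self power_abs)
    also have "\<dots> \<le> R ^ length w" by (intro power_mono) (auto simp: R_def)
    finally have "C * R0 ^ length w * fact (length w) \<le> C * R ^ length w * fact (length w)"
      using C by (intro mult_right_mono mult_left_mono) auto
    then show ?thesis using bd0[OF that] by linarith
  qed
  \<comment> \<open>Within this radius the terms of order \<open>n\<close> add up to at most \<open>C * (1 / 2) ^ n\<close>.\<close>
  define \<rho> where "\<rho> = min (min r0 r1) (1 / (2 * R * real (DIM('a))))"
  have \<rho>: "\<rho> > 0" using r0 r1 R by (simp add: \<rho>_def)
  let ?W = "{w :: 'a list. set w \<subseteq> Basis}"
  let ?Wn = "\<lambda>n. {w :: 'a list. set w \<subseteq> Basis \<and> length w = n}"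
  have finW: "finite (?Wn n)" for n by (rule finite_lists_length_eq[OF finite_Basis])
  define \<kappa> where "\<kappa> w = (\<lambda>b. count_list w b)" for w :: "'a list"
  define c where "c \<alpha> = infsum (\<lambda>w. dirs w f p / fact (length w)) {w \<in> ?W. \<kappa> w = \<alpha>}" for \<alpha>
  show "\<exists>c r. 0 < r \<and> (\<forall>x\<in>ball p r.
      ((\<lambda>\<alpha>. c \<alpha> * (\<Prod>b\<in>Basis. ((x - p) \<bullet> b) ^ \<alpha> b)) has_sum f x) multi_indices)"
  proof (intro exI[of _ c] exI[of _ \<rho>] conjI ballI \<rho>)
    fix x assume x: "x \<in> ball p \<rho>"
    define h where "h = x - p"
    define s where "s = (\<Sum>b\<in>Basis. \<bar>h \<bullet> b\<bar>) * R"
    have nh: "norm h < \<rho>" using x by (simp add: h_def dist_norm norm_minus_commute)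
    have s: "0 \<le> s" "s \<le> 1 / 2"
    proof -
      show "0 \<le> s" using R by (simp add: s_def sum_nonneg)
      have "(\<Sum>b\<in>Basis. \<bar>h \<bullet> b\<bar>) \<le> (\<Sum>b\<in>(Basis::'a set). \<rho>)"
      proof (rule sum_mono)
        fix b :: 'a assume "b \<in> Basis"
        then show "\<bar>h \<bullet> b\<bar> \<le> \<rho>" using nh Basis_le_norm[of b h] by linarith
      qed
      then have "s \<le> real (DIM('a)) * \<rho> * R" using R by (simp add: s_def)
      also have "\<dots> \<le> real (DIM('a)) * (1 / (2 * R * real (DIM('a)))) * R"
        using R by (intro mult_right_mono mult_left_mono) (auto simp: \<rho>_def)
      also have "\<dots> = 1 / 2" using R by simp
      finally show "s \<le> 1 / 2" .
    qed
    let ?m = "\<lambda>w. \<Prod>b\<leftarrow>w. h \<bullet> b"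
    define g where "g w = ?m w * dirs w f p / fact (length w)" for w
    define diff where "diff n t = (\<Sum>w\<in>?Wn n. ?m w * dirs w f (p + t *\<^sub>R h))" for n t
    have line: "p + t *\<^sub>R h \<in> ball p r0" "p + t *\<^sub>R h \<in> U" if "0 \<le> t" "t \<le> 1" for t
    proof -
      have "norm (t *\<^sub>R h) \<le> 1 * norm h" using that by (simp add: mult_left_le_one_le)
      then have "norm (t *\<^sub>R h) < r0" "norm (t *\<^sub>R h) < r1" using nh by (auto simp: \<rho>_def)
      then show "p + t *\<^sub>R h \<in> ball p r0" "p + t *\<^sub>R h \<in> U" using r1 by (auto simp: dist_norm)
    qed
    have absm: "\<bar>?m w\<bar> = (\<Prod>b\<leftarrow>w. \<bar>h \<bullet> b\<bar>)" for w by (induction w) (auto simp: abs_mult)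
    have dirsum: "(\<Sum>w\<in>?Wn n. \<bar>?m w * dirs w f q / fact (length w)\<bar>) \<le> C * s ^ n" if "q \<in> ball p r0" for n q
    proof -
      have "(\<Sum>w\<in>?Wn n. \<bar>?m w * dirs w f q / fact (length w)\<bar>) \<le> (\<Sum>w\<in>?Wn n. (\<Prod>b\<leftarrow>w. \<bar>h \<bullet> b\<bar>) * (C * R ^ n))"
      proof (rule sum_mono)
        fix w assume w: "w \<in> ?Wn n"
        have "\<bar>dirs w f q\<bar> / fact (length w) \<le> C * R ^ n"
          using bdR[OF that, of w] w by (simp add: field_simps)
        then have "(\<Prod>b\<leftarrow>w. \<bar>h \<bullet> b\<bar>) * (\<bar>dirs w f q\<bar> / fact (length w)) \<le> (\<Prod>b\<leftarrow>w. \<bar>h \<bullet> b\<bar>) * (C * R ^ n)"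
          by (intro mult_left_mono) (simp_all flip: absm)
        then show "\<bar>?m w * dirs w f q / fact (length w)\<bar> \<le> (\<Prod>b\<leftarrow>w. \<bar>h \<bullet> b\<bar>) * (C * R ^ n)"
          by (simp add: abs_mult absm)
      qed
      also have "\<dots> = (\<Sum>b\<in>Basis. \<bar>h \<bullet> b\<bar>) ^ n * (C * R ^ n)"
        by (simp add: sum_words_prod_list flip: sum_distrib_right)
      also have "\<dots> = C * s ^ n" by (simp add: s_def power_mult_distrib)
      finally show ?thesis .
    qed
    have deriv: "(diff n has_real_derivative diff (Suc n) t) (at t)" if t: "0 \<le> t" "t \<le> 1" for n t
    proof -
      have D: "((\<lambda>t. dirs w f (p + t *\<^sub>R h)) has_real_derivative
          (\<Sum>b\<in>Basis. (h \<bullet> b) * dirs (b # w) f (p + t *\<^sub>R h))) (at t)" for w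
      proof -
        have d: "(dirs w f has_derivative frechet_derivative (dirs w f) (at (p + t *\<^sub>R h))) (at (p + t *\<^sub>R h))"
          by (rule smooth_on_has_derivative[OF smooth_on_dirs[OF sm] line(2)[OF t]])
        then have lin: "linear (frechet_derivative (dirs w f) (at (p + t *\<^sub>R h)))"
          by (rule has_derivative_linear)
        have "frechet_derivative (dirs w f) (at (p + t *\<^sub>R h)) h
            = frechet_derivative (dirs w f) (at (p + t *\<^sub>R h)) (\<Sum>b\<in>Basis. (h \<bullet> b) *\<^sub>R b)"
          by (simp add: euclidean_representation)
        also have "\<dots> = (\<Sum>b\<in>Basis. (h \<bullet> b) * dirs (b # w) f (p + t *\<^sub>R h))"
          by (simp add: linear_sum[OF lin] linear_cmul[OF lin])
        finally show ?thesis
          using has_derivative_along_line[OF d, of UNIV]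
          by (simp add: has_field_derivative_def mult_commute_abs)
      qed
      have "(diff n has_real_derivative
          (\<Sum>w\<in>?Wn n. ?m w * (\<Sum>b\<in>Basis. (h \<bullet> b) * dirs (b # w) f (p + t *\<^sub>R h)))) (at t)"
        unfolding diff_def[abs_def] by (intro DERIV_sum DERIV_cmult D)
      also have "(\<Sum>w\<in>?Wn n. ?m w * (\<Sum>b\<in>Basis. (h \<bullet> b) * dirs (b # w) f (p + t *\<^sub>R h))) = diff (Suc n) t"
        unfolding diff_def sum_words_Suc[OF finite_Basis]
        by (simp add: sum_distrib_left mult_ac)
      finally show ?thesis .
    qed
    have taylor: "(\<lambda>n. diff n 0 / fact n) sums f x"
    proof -
      have rem: "\<bar>f x - (\<Sum>m<n. diff m 0 / fact m)\<bar> \<le> C * s ^ n" if n: "0 < n" for n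
      proof -
        have "diff 0 t = f (p + t *\<^sub>R h)" for t
        proof -
          have "?Wn 0 = {[]}" by auto
          then show ?thesis by (simp add: diff_def)
        qed
        then have "diff 0 = (\<lambda>t. f (p + t *\<^sub>R h))" by auto
        then obtain t where t: "0 < t" "t < 1"
          and e: "f (p + 1 *\<^sub>R h) = (\<Sum>m<n. diff m 0 / fact m * 1 ^ m) + diff n t / fact n * 1 ^ n"
          using Maclaurin[of 1 n diff "\<lambda>t. f (p + t *\<^sub>R h)"] n deriv by auto
        have "\<bar>f x - (\<Sum>m<n. diff m 0 / fact m)\<bar> = \<bar>\<Sum>w\<in>?Wn n. ?m w * dirs w f (p + t *\<^sub>R h) / fact (length w)\<bar>"
          using e by (simp add: h_def diff_def sum_divide_distrib)
        also have "\<dots> \<le> (\<Sum>w\<in>?Wn n. \<bar>?m w * dirs w f (p + t *\<^sub>R h) / fact (length w)\<bar>)" by (rule sum_abs)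
        also have "\<dots> \<le> C * s ^ n" using t by (intro dirsum line) auto
        finally show ?thesis .
      qed
      have "(\<lambda>n. C * s ^ n) \<longlonglongrightarrow> C * 0"
        using s by (intro tendsto_mult tendsto_const LIMSEQ_realpow_zero) auto
      then have "(\<lambda>n. C * s ^ n) \<longlonglongrightarrow> 0" by simp
      moreover have "\<forall>\<^sub>F n in sequentially. norm (f x - (\<Sum>m<n. diff m 0 / fact m)) \<le> C * s ^ n"
        using rem by (auto intro!: eventually_sequentiallyI[of 1])
      ultimately have "(\<lambda>n. f x - (\<Sum>m<n. diff m 0 / fact m)) \<longlonglongrightarrow> 0"
        by (rule Lim_null_comparison[rotated])
      then have "(\<lambda>n. f x - (f x - (\<Sum>m<n. diff m 0 / fact m))) \<longlonglongrightarrow> f x - 0"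
        by (intro tendsto_diff tendsto_const)
      then show ?thesis by (simp add: sums_def)
    qed
    have p0: "p \<in> ball p r0" using r0 by simp
    have "(\<lambda>w. norm (g w)) summable_on ?W"
    proof (rule nonneg_bdd_above_summable_on)
      show "bdd_above (sum (\<lambda>w. norm (g w)) ` {F. F \<subseteq> ?W \<and> finite F})"
      proof (rule bdd_aboveI2)
        fix F assume F: "F \<in> {F. F \<subseteq> ?W \<and> finite F}"
        define N where "N = Suc (Max (length ` F))"
        have "F \<subseteq> (\<Union>n<N. ?Wn n)"
        proof
          fix w assume w: "w \<in> F"
          then have "length w < N" using F by (simp add: N_def less_Suc_eq_le)
          then show "w \<in> (\<Union>n<N. ?Wn n)" using w F by auto
        qed
        then have "sum (\<lambda>w. norm (g w)) F \<le> sum (\<lambda>w. norm (g w)) (\<Union>n<N. ?Wn n)"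
          using finW by (intro sum_mono2) auto
        also have "\<dots> = (\<Sum>n<N. \<Sum>w\<in>?Wn n. norm (g w))"
          using finW by (intro sum.UNION_disjoint) auto
        also have "\<dots> \<le> (\<Sum>n<N. C * (1 / 2) ^ n)"
        proof (rule sum_mono)
          fix n
          have "(\<Sum>w\<in>?Wn n. norm (g w)) \<le> C * s ^ n"
            using dirsum[OF p0, of n] by (simp add: g_def)
          also have "\<dots> \<le> C * (1 / 2) ^ n" using C s by (intro mult_left_mono power_mono) auto
          finally show "(\<Sum>w\<in>?Wn n. norm (g w)) \<le> C * (1 / 2) ^ n" .
        qed
        also have "\<dots> = C * (\<Sum>n<N. (1 / 2) ^ n)" by (simp add: sum_distrib_left)
        also have "\<dots> \<le> C * 2"
        proof (rule mult_left_mono[OF _ C])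
          have "(\<Sum>n<N. (1 / 2 :: real) ^ n) = (1 - (1 / 2) ^ N) / (1 - 1 / 2)" by (simp add: sum_gp_strict)
          also have "\<dots> \<le> 2" by simp
          finally show "(\<Sum>n<N. (1 / 2 :: real) ^ n) \<le> 2" .
        qed
        finally show "sum (\<lambda>w. norm (g w)) F \<le> C * 2" .
      qed
    qed simp
    then have sumg: "g summable_on ?W" by (rule abs_summable_summable)
    have "((\<lambda>n. infsum g {w \<in> ?W. length w = n}) has_sum infsum g ?W) UNIV"
      by (rule has_sum_fibres[OF sumg]) simp
    moreover have "infsum g {w \<in> ?W. length w = n} = diff n 0 / fact n" for n
    proof -
      have "{w \<in> ?W. length w = n} = ?Wn n" by auto
      then show ?thesis using finW by (simp add: diff_def g_def sum_divide_distrib)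
    qed
    ultimately have "(\<lambda>n. diff n 0 / fact n) sums infsum g ?W" by (simp add: has_sum_imp_sums)
    then have total: "infsum g ?W = f x" using taylor sums_unique2 by blast
    have \<kappa>: "\<kappa> ` ?W \<subseteq> multi_indices"
      by (auto simp: \<kappa>_def multi_indices_def count_list_0_iff)
    have "infsum g {w \<in> ?W. \<kappa> w = \<alpha>} = c \<alpha> * (\<Prod>b\<in>Basis. ((x - p) \<bullet> b) ^ \<alpha> b)" for \<alpha>
    proof -
      have "infsum g {w \<in> ?W. \<kappa> w = \<alpha>}
          = infsum (\<lambda>w. (\<Prod>b\<in>Basis. (h \<bullet> b) ^ \<alpha> b) * (dirs w f p / fact (length w))) {w \<in> ?W. \<kappa> w = \<alpha>}"
      proof (rule infsum_cong)
        fix w assume w: "w \<in> {w \<in> ?W. \<kappa> w = \<alpha>}"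
        then have "?m w = (\<Prod>b\<in>Basis. (h \<bullet> b) ^ \<alpha> b)"
          using prod_list_count[of w Basis "\<lambda>b. h \<bullet> b"] by (auto simp: \<kappa>_def)
        then show "g w = (\<Prod>b\<in>Basis. (h \<bullet> b) ^ \<alpha> b) * (dirs w f p / fact (length w))"
          by (simp add: g_def)
      qed
      also have "\<dots> = (\<Prod>b\<in>Basis. (h \<bullet> b) ^ \<alpha> b) * c \<alpha>" unfolding c_def by (rule infsum_cmult_right')
      finally show ?thesis by (simp add: h_def mult.commute)
    qed
    then show "((\<lambda>\<alpha>. c \<alpha> * (\<Prod>b\<in>Basis. ((x - p) \<bullet> b) ^ \<alpha> b)) has_sum f x) multi_indices"
      using has_sum_fibres[OF sumg \<kappa>] total by simp
  qed
qed

lemma real_analytic_on_add: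
  assumes "real_analytic_on f U" "real_analytic_on g U"
  shows "real_analytic_on (\<lambda>x. f x + g x) U"
  unfolding real_analytic_on_def
proof
  fix p assume p: "p \<in> U"
  obtain c r where c: "r > 0" "\<And>x. x \<in> ball p r \<Longrightarrow>
      ((\<lambda>\<alpha>. c \<alpha> * (\<Prod>b\<in>Basis. ((x - p) \<bullet> b) ^ \<alpha> b)) has_sum f x) multi_indices"
    using assms(1) p unfolding real_analytic_on_def by blast
  obtain d s where d: "s > 0" "\<And>x. x \<in> ball p s \<Longrightarrow>
      ((\<lambda>\<alpha>. d \<alpha> * (\<Prod>b\<in>Basis. ((x - p) \<bullet> b) ^ \<alpha> b)) has_sum g x) multi_indices"
    using assms(2) p unfolding real_analytic_on_def by blast
  show "\<exists>e t. 0 < t \<and> (\<forall>x\<in>ball p t.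
      ((\<lambda>\<alpha>. e \<alpha> * (\<Prod>b\<in>Basis. ((x - p) \<bullet> b) ^ \<alpha> b)) has_sum f x + g x) multi_indices)"
  proof (intro exI[of _ "\<lambda>\<alpha>. c \<alpha> + d \<alpha>"] exI[of _ "min r s"] conjI ballI)
    fix x assume "x \<in> ball p (min r s)"
    then show "((\<lambda>\<alpha>. (c \<alpha> + d \<alpha>) * (\<Prod>b\<in>Basis. ((x - p) \<bullet> b) ^ \<alpha> b)) has_sum f x + g x) multi_indices"
      using has_sum_add[OF c(2) d(2), of x x] by (simp add: ring_distribs)
  qed (use c d in simp)
qed

lemma real_analytic_on_linear:
  fixes L :: "'a::euclidean_space \<Rightarrow> real"
  assumes L: "bounded_linear L"
  shows "real_analytic_on L U"
proof -
  have fd: "frechet_derivative L (at p) = L" for p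
    using L bounded_linear_imp_has_derivative frechet_derivative_at by metis
  obtain K where K: "K \<ge> 0" "\<And>v. \<bar>L v\<bar> \<le> norm v * K"
    using bounded_linear.nonneg_bounded[OF L] by auto
  have "\<bar>dirs w L q\<bar> \<le> (norm p + 2) * K * 1 ^ length w * fact (length w)"
    if q: "q \<in> ball p 1" and w: "set w \<subseteq> Basis" for p q w
  proof -
    have "\<bar>dirs w L q\<bar> \<le> (norm p + 2) * K"
    proof (cases w rule: rev_cases)
      case Nil
      have "norm q \<le> norm p + 2" using q norm_triangle_sub[of q p] by (simp add: dist_norm norm_minus_commute)
      then show ?thesis using Nil K(2)[of q] mult_right_mono[OF _ K(1), of "norm q"] by fastforce
    next
      case (snoc v b)
      have "\<bar>L b\<bar> \<le> (norm p + 2) * K"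
        using snoc w K(2)[of b] mult_right_mono[OF _ K(1), of 1 "norm p + 2"] by fastforce
      moreover have "dirs v (\<lambda>p. L b) q = (if v = [] then L b else 0)"
        by (cases v rule: rev_cases) auto
      ultimately show ?thesis using snoc K(1) by (simp add: fd)
    qed
    also have "\<dots> \<le> (norm p + 2) * K * fact (length w)"
      using K(1) mult_left_mono[of 1 "fact (length w)" "(norm p + 2) * K"] by simp
    finally show ?thesis by simp
  qed
  then have "\<exists>r>0. \<exists>C R. \<forall>q\<in>ball p r. \<forall>w. set w \<subseteq> Basis \<longrightarrow>
      \<bar>dirs w L q\<bar> \<le> C * R ^ length w * fact (length w)" for p
    using zero_less_one by blast
  then have "real_analytic_on L UNIV"
    by (intro real_analytic_on_if_derivative_bounds smooth_on_bounded_linear L open_UNIV)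
  then show ?thesis by (simp add: real_analytic_on_def)
qed

lemma directional_eq_wirt:
  fixes f :: "complex^'n::finite \<Rightarrow> complex"
  assumes "f differentiable (at p)"
  shows "frechet_derivative f (at p) v
    = (\<Sum>d\<in>UNIV. (if fst d then cnj (v $ snd d) else v $ snd d) * wirt d f p)"
proof -
  have lin: "linear (frechet_derivative f (at p))"
    using assms by (rule linear_frechet_derivative)
  have "v = (\<Sum>j\<in>UNIV. axis j (v $ j))" by (simp add: vec_eq_iff axis_def)
  then have "frechet_derivative f (at p) v = (\<Sum>j\<in>UNIV. frechet_derivative f (at p) (axis j (v $ j)))"
    by (metis linear_sum[OF lin])
  also have "\<dots> = (\<Sum>j\<in>UNIV. v $ j * wirt (False, j) f p + cnj (v $ j) * wirt (True, j) f p)"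
  proof (rule sum.cong)
    fix j :: 'n
    have "frechet_derivative f (at p) (axis j (v $ j)) = of_real (Re (v $ j)) * frechet_derivative f (at p) (axis j 1)
        + of_real (Im (v $ j)) * frechet_derivative f (at p) (axis j \<i>)"
      by (subst axis_complex_decompose[of j "v $ j"])
         (simp only: linear_add[OF lin] linear_cmul[OF lin], simp add: scaleR_conv_of_real)
    then show "frechet_derivative f (at p) (axis j (v $ j)) = v $ j * wirt (False, j) f p + cnj (v $ j) * wirt (True, j) f p"
      by (simp add: wirt_def complex_eq_iff field_simps)
  qed simp
  also have "\<dots> = (\<Sum>d\<in>UNIV \<times> UNIV. (if fst d then cnj (v $ snd d) else v $ snd d) * wirt d f p)"
    by (simp add: sum.cartesian_product' UNIV_bool sum.distrib add.commute)
  finally show ?thesis by simp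
qed

text \<open>A directional derivative is a combination of the Wirtinger derivatives with coefficients at most one,
  so a word in directions expands into a sum of at most \<open>K ^ n\<close> words in Wirtinger letters. Allowing
  all vectors of norm at most one as letters makes the estimate stable under linear projections.\<close>

lemma cauchy_bounded_dirs:
  fixes f :: "complex^'n::finite \<Rightarrow> complex"
  assumes U: "open U" and f: "cauchy_bounded_on f U" and p: "p \<in> U"
  shows "\<exists>r>0. \<exists>C R. \<forall>q\<in>ball p r. \<forall>w. (\<forall>v\<in>set w. norm v \<le> 1) \<longrightarrow>
    cmod (dirs w f q) \<le> C * R ^ length w * fact (length w)"
proof -
  have sm: "smooth_on f U" by (rule cauchy_bounded_on_smooth[OF f])
  have "\<forall>\<^sub>F N in at_top. ball p (1 / N) \<subseteq> U \<and> 1 \<le> N \<and>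
      (\<forall>q\<in>ball p (1 / N). \<forall>w. cmod (wirts w f q) \<le> N * N ^ length w * fact (length w))"
    using f p eventually_ball_subset[OF U p]
    unfolding cauchy_bounded_on_iff_eventually[OF U] by (intro eventually_conj eventually_ge_at_top) auto
  from eventually_at_top_witness[OF this] obtain N where N: "ball p (1 / N) \<subseteq> U" "1 \<le> N"
    "\<And>q w. q \<in> ball p (1 / N) \<Longrightarrow> cmod (wirts w f q) \<le> N * N ^ length w * fact (length w)"
    by blast
  let ?K = "real CARD(bool \<times> 'n)"
  have main: "cmod (dirs w (wirts u f) q) \<le> ?K ^ length w * (N * N ^ (length w + length u) * fact (length w + length u))"
    if q: "q \<in> ball p (1 / N)" and w: "\<forall>v\<in>set w. norm v \<le> 1" for q w u
    using w
  proof (induction w arbitrary: u rule: rev_induct)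
    case Nil
    then show ?case using N(3)[OF q] by simp
  next
    case (snoc v w)
    let ?c = "\<lambda>d. if fst d then cnj (v $ snd d) else v $ snd d"
    have qU: "q \<in> U" using q N by blast
    have smu: "smooth_on (wirts u f) U" "smooth_on (wirt d (wirts u f)) U" for d
      using U sm by (auto intro: smooth_on_wirts smooth_on_wirt)
    have bl: "bounded_linear (\<lambda>z. ?c d * z)" for d by (rule bounded_linear_mult_right)
    have "dirs (w @ [v]) (wirts u f) q = dirs w (\<lambda>p. frechet_derivative (wirts u f) (at p) v) q" by simp
    also have "\<dots> = dirs w (\<lambda>p. \<Sum>d\<in>UNIV. ?c d * wirt d (wirts u f) p) q"
      by (rule dirs_cong[OF U smooth_on_directional[OF smu(1)] _ qU])
         (rule directional_eq_wirt[OF smooth_on_differentiable[OF smu(1)]])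
    also have "\<dots> = (\<Sum>d\<in>UNIV. dirs w (\<lambda>p. ?c d * wirt d (wirts u f) p) q)"
      by (rule dirs_sum[OF U finite _ qU]) (rule smooth_on_compose_bounded_linear[OF U bl smu(2)])
    also have "\<dots> = (\<Sum>d\<in>UNIV. ?c d * dirs w (wirts (d # u) f) q)"
      by (simp add: dirs_compose_bounded_linear[OF U smu(2) bl qU])
    also have "cmod \<dots> \<le> (\<Sum>d\<in>(UNIV::(bool \<times> 'n) set). ?K ^ length w * (N * N ^ (length w + Suc (length u)) * fact (length w + Suc (length u))))"
    proof (rule sum_norm_le)
      fix d :: "bool \<times> 'n"
      have "cmod (?c d) \<le> norm v" using Finite_Cartesian_Product.norm_nth_le[of v "snd d"] by auto
      also have "\<dots> \<le> 1" using snoc.prems by simp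
      finally have "cmod (?c d * dirs w (wirts (d # u) f) q) \<le> 1 * cmod (dirs w (wirts (d # u) f) q)"
        unfolding norm_mult by (rule mult_right_mono) simp
      also have "\<dots> \<le> ?K ^ length w * (N * N ^ (length w + Suc (length u)) * fact (length w + Suc (length u)))"
        using snoc.IH[of "d # u"] snoc.prems by simp
      finally show "cmod (?c d * dirs w (wirts (d # u) f) q)
        \<le> ?K ^ length w * (N * N ^ (length w + Suc (length u)) * fact (length w + Suc (length u)))" .
    qed
    also have "\<dots> = ?K ^ length (w @ [v]) * (N * N ^ (length (w @ [v]) + length u) * fact (length (w @ [v]) + length u))"
      by simp
    finally show ?case .
  qed
  have "cmod (dirs w f q) \<le> N * (?K * N) ^ length w * fact (length w)"
    if "q \<in> ball p (1 / N)" "\<forall>v\<in>set w. norm v \<le> 1" for q w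
    using main[OF that, of "[]"] by (simp add: power_mult_distrib mult_ac)
  moreover have "1 / N > 0" using N by simp
  ultimately show ?thesis by blast
qed

section \<open>Levi matrices of rank one\<close>

lemma rank_one_imp_minor_zero:
  fixes A :: "complex^2^2"
  assumes "rank A = 1"
  shows "A $ 1 $ 1 * A $ 2 $ 2 = A $ 1 $ 2 * A $ 2 $ 1"
proof (rule ccontr)
  assume "\<not> ?thesis"
  then have "det A \<noteq> 0" by (simp add: det_2)
  then have "\<exists>B. B ** A = mat 1" using invertible_det_nz invertible_left_inverse by blast
  then have "vec.span (rows A) = UNIV" by (simp add: matrix_left_invertible_span_rows_gen)
  then have "vec.dim (rows A) = CARD(2)" by (metis vec.dim_span vec_dim_card)
  then show False using assms by (simp add: row_rank_def_gen)
qed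

lemma wirt_zero_of_constant_along:
  fixes g :: "complex^'n::finite \<Rightarrow> complex"
  assumes U: "open U" "p \<in> U" and d: "g differentiable at p"
    and c: "\<And>q. q \<in> U \<Longrightarrow> (\<forall>i. i \<noteq> snd d \<longrightarrow> q $ i = p $ i) \<Longrightarrow> g q = g p"
  shows "wirt d g p = 0"
proof -
  have "frechet_derivative g (at p) (axis (snd d) s) = 0" for s
  proof -
    let ?v = "axis (snd d) s :: complex^'n"
    have "(g has_derivative frechet_derivative g (at p)) (at (p + 0 *\<^sub>R ?v))"
      using d by (simp add: frechet_derivative_works)
    from has_derivative_along_line[OF this]
    have 1: "((\<lambda>t. g (p + t *\<^sub>R ?v)) has_derivative (\<lambda>t. t *\<^sub>R frechet_derivative g (at p) ?v)) (at 0)" .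
    have "open ((\<lambda>t. p + t *\<^sub>R ?v) -` U)"
      by (rule open_vimage[OF U(1)]) (intro continuous_intros)
    then have 2: "((\<lambda>t. g (p + t *\<^sub>R ?v)) has_derivative (\<lambda>t. 0)) (at 0)"
      by (rule has_derivative_transform_within_open[OF has_derivative_const[of "g p"]])
         (use U in \<open>auto intro!: c[symmetric] simp: axis_def\<close>)
    show ?thesis using fun_cong[OF has_derivative_unique[OF 1 2], of 1] by simp
  qed
  then show ?thesis by (simp add: wirt_def)
qed

text \<open>The conjugate function is holomorphic, and for it the regularity theorem has vanishing data.\<close>

lemma antiholomorphic_cauchy_bounded:
  fixes h :: "complex^'n::finite \<Rightarrow> complex"
  assumes U: "open U" and sm: "smooth_on h U" and hol: "\<And>j p. p \<in> U \<Longrightarrow> wirt (False, j) h p = 0"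
  shows "cauchy_bounded_on h U"
proof -
  have "cauchy_bounded_on (wirt (True, j) (\<lambda>p. cnj (h p))) U" for j
    by (rule cauchy_bounded_on_cong[OF U cauchy_bounded_on_const[of 0]])
       (simp add: wirt_cnj smooth_on_differentiable[OF sm] hol)
  from cauchy_bounded_on_cnj[OF U cauchy_riemann_regularity[OF U smooth_on_cnj[OF U sm] this]]
  show ?thesis by simp
qed

text \<open>Equations for half of the unknowns suffice when the other half consists of their conjugates.\<close>

lemma conjugate_quadratic_system_cauchy_bounded:
  fixes Y :: "(complex^'n::finite \<Rightarrow> complex) set"
  defines "Z \<equiv> Y \<union> (\<lambda>y p. cnj (y p)) ` Y"
  assumes U: "open U" and fin: "finite Y" and Y: "\<And>y. y \<in> Y \<Longrightarrow> smooth_on y U"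
    and sys: "\<And>y d. y \<in> Y \<Longrightarrow> \<exists>h. quadratic_over U Z h \<and> (\<forall>q\<in>U. wirt d y q = h q)"
    and y: "y \<in> Y"
  shows "cauchy_bounded_on y U"
proof (rule quadratic_system_cauchy_bounded[OF U])
  have Zc: "(\<lambda>p. cnj (z p)) \<in> Z" if "z \<in> Z" for z
    using that by (auto simp: Z_def)
  have quadc: "quadratic_over U Z h \<Longrightarrow> quadratic_over U Z (\<lambda>p. cnj (h p))" for h
  proof (induction rule: quadratic_over.induct)
    case (quadratic_term a u v)
    then have "quadratic_over U Z (\<lambda>p. cnj (a p) * (cnj (u p) * cnj (v p)))"
      by (intro quadratic_over.quadratic_term cauchy_bounded_on_cnj U Zc)
    then show ?case by simp
  next
    case (quadratic_add f g)
    then show ?case using quadratic_over.quadratic_add[OF quadratic_add.IH] by simp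
  qed
  show "finite Z" "y \<in> Z" using fin y by (auto simp: Z_def)
  show "smooth_on z U" if "z \<in> Z" for z
    using that Y by (auto simp: Z_def intro: smooth_on_cnj[OF U])
  show "\<exists>h. quadratic_over U Z h \<and> (\<forall>q\<in>U. wirt d z q = h q)" if z: "z \<in> Z" for z d
  proof (cases "z \<in> Y")
    case True
    then show ?thesis by (rule sys)
  next
    case False
    then obtain x where x: "x \<in> Y" "z = (\<lambda>p. cnj (x p))" using z by (auto simp: Z_def)
    from sys[OF x(1), of "(\<not> fst d, snd d)"] obtain h
      where h: "quadratic_over U Z h" "\<forall>q\<in>U. wirt (\<not> fst d, snd d) x q = h q" by blast
    have "\<forall>q\<in>U. wirt d z q = cnj (h q)"
      using h(2) by (simp add: x wirt_cnj smooth_on_differentiable[OF Y[OF x(1)]])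
    then show ?thesis using quadc[OF h(1)] by blast
  qed
qed

section \<open>The Monge-Ampere equation\<close>

locale degenerate_graph =
  fixes U :: "(complex^2) set" and f :: "complex^2 \<Rightarrow> complex"
  assumes U: "open U" and sm_f: "smooth_on f U" and real_f: "\<And>p. cnj (f p) = f p"
    and g_nz: "\<And>p. p \<in> U \<Longrightarrow> wirt (True, 1) (wirt (False, 1) f) p \<noteq> 0"
    and monge_ampere: "\<And>p. p \<in> U \<Longrightarrow> wirt (True, 1) (wirt (False, 1) f) p * wirt (True, 2) (wirt (False, 2) f) p
      = wirt (True, 2) (wirt (False, 1) f) p * wirt (True, 1) (wirt (False, 2) f) p"
begin

text \<open>The field \<open>\<partial>\<^sub>2 - cnj \<epsilon> \<partial>\<^sub>1\<close> spans the kernel of the Levi matrix, \<open>S\<close> is the invariant that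
  detects 2-nondegeneracy, and \<open>\<nu>\<close> is the conjugate derivative of \<open>ln g\<close> in \<open>z\<^sub>2\<close>.\<close>

definition g :: "complex^2 \<Rightarrow> complex" where "g = wirt (True, 1) (wirt (False, 1) f)"
definition \<epsilon> :: "complex^2 \<Rightarrow> complex" where "\<epsilon> p = wirt (True, 2) (wirt (False, 1) f) p / g p"
definition S :: "complex^2 \<Rightarrow> complex" where "S = wirt (False, 1) \<epsilon>"
definition \<nu> :: "complex^2 \<Rightarrow> complex" where "\<nu> p = wirt (True, 2) g p / g p"

lemma g_nonzero: "p \<in> U \<Longrightarrow> g p \<noteq> 0"
  by (simp add: g_def g_nz)

lemma smooth: "smooth_on g U" "smooth_on \<epsilon> U" "smooth_on S U" "smooth_on \<nu> U"
proof -
  show g: "smooth_on g U" unfolding g_def by (intro smooth_on_wirt U sm_f)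
  show e: "smooth_on \<epsilon> U"
    unfolding \<epsilon>_def[abs_def] by (intro smooth_on_divide smooth_on_wirt U sm_f g ballI g_nonzero)
  show "smooth_on S U" unfolding S_def by (intro smooth_on_wirt U e)
  show "smooth_on \<nu> U"
    unfolding \<nu>_def[abs_def] by (intro smooth_on_divide smooth_on_wirt U g ballI g_nonzero)
qed

lemma diff: "p \<in> U \<Longrightarrow> smooth_on h U \<Longrightarrow> h differentiable at p"
  by (rule smooth_on_differentiable)

lemma conj_second: "p \<in> U \<Longrightarrow> cnj (wirt (a, j) (wirt (b, k) f) p) = wirt (\<not> a, j) (wirt (\<not> b, k) f) p"
proof -
  assume p: "p \<in> U"
  have "cnj (wirt (b, k) f q) = wirt (\<not> b, k) f q" if "q \<in> U" for q
    using wirt_cnj[OF diff[OF that sm_f], of "(\<not> b, k)"] by (simp add: real_f)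
  then have "wirt (\<not> a, j) (\<lambda>q. cnj (wirt (b, k) f q)) p = wirt (\<not> a, j) (wirt (\<not> b, k) f) p"
    by (intro wirt_cong[OF U p]) (auto intro!: diff[OF p] smooth_on_cnj smooth_on_wirt U sm_f)
  then show ?thesis
    using wirt_cnj[OF diff[OF p smooth_on_wirt[OF U sm_f]], of "(\<not> a, j)" "(b, k)"] by simp
qed

lemma g_real: "p \<in> U \<Longrightarrow> cnj (g p) = g p"
  using conj_second[of p True 1 False 1] wirt_commute[OF U sm_f] by (simp add: g_def)

lemma wirt_conj: "p \<in> U \<Longrightarrow> smooth_on h U \<Longrightarrow> wirt (b, j) (\<lambda>p. cnj (h p)) p = cnj (wirt (\<not> b, j) h p)"
  by (simp add: wirt_cnj diff)

lemma conj_wirt_g: "p \<in> U \<Longrightarrow> cnj (wirt (b, j) g p) = wirt (\<not> b, j) g p"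
  using wirt_conj[of p g "\<not> b" j] wirt_cong[OF U, of p "\<lambda>p. cnj (g p)" g "(\<not> b, j)"] g_real
  by (simp add: smooth diff smooth_on_cnj U)

lemma f12: "p \<in> U \<Longrightarrow> wirt (True, 2) (wirt (False, 1) f) p = g p * \<epsilon> p"
  by (simp add: \<epsilon>_def g_nonzero)

lemma f21: "p \<in> U \<Longrightarrow> wirt (True, 1) (wirt (False, 2) f) p = g p * cnj (\<epsilon> p)"
  using conj_second[of p True 2 False 1] wirt_commute[OF U sm_f, of p "(False, 2)" "(True, 1)"] f12[of p]
  by (simp add: g_real)

lemma f22: "p \<in> U \<Longrightarrow> wirt (True, 2) (wirt (False, 2) f) p = g p * (\<epsilon> p * cnj (\<epsilon> p))"
proof -
  assume p: "p \<in> U"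
  have "g p * wirt (True, 2) (wirt (False, 2) f) p = g p * (g p * (\<epsilon> p * cnj (\<epsilon> p)))"
    using monge_ampere[OF p] f12[OF p] f21[OF p] by (simp add: g_def mult_ac)
  then show ?thesis using g_nonzero[OF p] by simp
qed

end

locale z1_independent_graph = degenerate_graph +
  assumes g1: "\<And>p b. p \<in> U \<Longrightarrow> wirt (b, 1) g p = 0"
    and S1: "\<And>p b. p \<in> U \<Longrightarrow> wirt (b, 1) S p = 0"
begin

lemma wirt_zero_function:
  assumes "p \<in> U" "smooth_on h U" "\<And>q. q \<in> U \<Longrightarrow> h q = 0"
  shows "wirt d h p = 0"
  using wirt_cong[OF U assms(1), of h "\<lambda>_. 0"] assms by (simp add: diff)

lemma \<nu>1: "p \<in> U \<Longrightarrow> wirt (b, 1) \<nu> p = 0"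
proof -
  assume p: "p \<in> U"
  have "wirt (b, 1) (wirt (True, 2) g) p = wirt (True, 2) (wirt (b, 1) g) p"
    by (rule wirt_commute[OF U smooth(1) p])
  also have "\<dots> = 0"
    by (rule wirt_zero_function[OF p]) (auto intro: smooth_on_wirt U smooth simp: g1)
  finally show ?thesis
    unfolding \<nu>_def[abs_def] using p
    by (subst wirt_divide) (auto intro: diff smooth_on_wirt U smooth simp: g_nonzero g1)
qed

lemma \<epsilon>_1bar: "p \<in> U \<Longrightarrow> wirt (True, 1) \<epsilon> p = \<nu> p"
proof -
  assume p: "p \<in> U"
  have "wirt (True, 1) (wirt (True, 2) (wirt (False, 1) f)) p = wirt (True, 2) g p"
    unfolding g_def by (rule wirt_commute[OF U smooth_on_wirt[OF U sm_f] p])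
  then show ?thesis
    unfolding \<epsilon>_def[abs_def] using p
    by (subst wirt_divide)
       (auto intro: diff smooth_on_wirt U smooth sm_f simp: g_nonzero g1 \<nu>_def power2_eq_square)
qed

text \<open>This is the degeneracy equation of lemma \<open>f22\<close>, differentiated in \<open>z\<^sub>1\<close>: the left-hand side
  becomes the \<open>z\<^sub>2\<close>-derivative of \<open>g \<epsilon>\<close>, and the terms with \<open>\<nu>\<close> cancel.\<close>

lemma \<epsilon>_2: "p \<in> U \<Longrightarrow> wirt (False, 2) \<epsilon> p = S p * cnj (\<epsilon> p)"
proof -
  assume p: "p \<in> U"
  have smc: "smooth_on (\<lambda>p. cnj (\<epsilon> p)) U" "smooth_on (\<lambda>p. \<epsilon> p * cnj (\<epsilon> p)) U"
    by (intro smooth_on_cnj smooth_on_mult smooth U)+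
  have "wirt (False, 1) (wirt (True, 2) (wirt (False, 2) f)) p
      = wirt (True, 2) (wirt (False, 1) (wirt (False, 2) f)) p"
    by (rule wirt_commute[OF U smooth_on_wirt[OF U sm_f] p])
  also have "\<dots> = wirt (True, 2) (wirt (False, 2) (wirt (False, 1) f)) p"
    using wirt_commute[OF U sm_f] p by (intro wirt_cong[OF U]) (auto intro: diff smooth_on_wirt U sm_f)
  also have "\<dots> = wirt (False, 2) (wirt (True, 2) (wirt (False, 1) f)) p"
    by (rule wirt_commute[OF U smooth_on_wirt[OF U sm_f] p])
  also have "\<dots> = wirt (False, 2) (\<lambda>p. g p * \<epsilon> p) p"
    using f12 p by (intro wirt_cong[OF U]) (auto intro: diff smooth_on_wirt U sm_f)
  also have "\<dots> = wirt (False, 2) g p * \<epsilon> p + g p * wirt (False, 2) \<epsilon> p"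
    by (intro wirt_mult diff[OF p] smooth)
  also have "wirt (False, 2) g p = g p * cnj (\<nu> p)"
    using conj_wirt_g[OF p, of True 2] g_nonzero[OF p] g_real[OF p] by (simp add: \<nu>_def)
  finally have l: "wirt (False, 1) (wirt (True, 2) (wirt (False, 2) f)) p
    = g p * (cnj (\<nu> p) * \<epsilon> p + wirt (False, 2) \<epsilon> p)" by (simp add: algebra_simps)
  have "wirt (False, 1) (wirt (True, 2) (wirt (False, 2) f)) p = wirt (False, 1) (\<lambda>p. g p * (\<epsilon> p * cnj (\<epsilon> p))) p"
    using f22 p by (intro wirt_cong[OF U]) (auto intro: diff smooth_on_wirt U sm_f)
  also have "\<dots> = g p * (S p * cnj (\<epsilon> p) + \<epsilon> p * cnj (\<nu> p))"
    by (simp add: wirt_mult diff[OF p] smooth smc g1[OF p] wirt_conj[OF p] \<epsilon>_1bar[OF p] flip: S_def)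
  finally show ?thesis using l g_nonzero[OF p] by (simp add: algebra_simps)
qed

lemma smooth_conj: "smooth_on (\<lambda>p. cnj (\<epsilon> p)) U" "smooth_on (\<lambda>p. cnj (S p)) U" "smooth_on (\<lambda>p. cnj (\<nu> p)) U"
  by (intro smooth_on_cnj smooth U)+

text \<open>The next two identities are the \<open>z\<^sub>1\<close>-derivative and the conjugate \<open>z\<^sub>1\<close>-derivative of lemma \<open>\<epsilon>_2\<close>.\<close>

lemma S_2: "p \<in> U \<Longrightarrow> wirt (False, 2) S p = cnj (\<nu> p) * S p"
proof -
  assume p: "p \<in> U"
  have "wirt (False, 2) S p = wirt (False, 1) (wirt (False, 2) \<epsilon>) p"
    unfolding S_def by (rule wirt_commute[OF U smooth(2) p])
  also have "\<dots> = wirt (False, 1) (\<lambda>p. S p * cnj (\<epsilon> p)) p"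
    using \<epsilon>_2 p by (intro wirt_cong[OF U]) (auto intro: diff smooth_on_wirt U smooth)
  also have "\<dots> = S p * cnj (\<nu> p)"
    by (simp add: wirt_mult diff[OF p] smooth smooth_conj S1[OF p] wirt_conj[OF p] \<epsilon>_1bar[OF p])
  finally show ?thesis by simp
qed

lemma \<nu>_2: "p \<in> U \<Longrightarrow> wirt (False, 2) \<nu> p = S p * cnj (S p)"
proof -
  assume p: "p \<in> U"
  have "wirt (False, 2) \<nu> p = wirt (False, 2) (wirt (True, 1) \<epsilon>) p"
    using \<epsilon>_1bar p by (intro wirt_cong[OF U]) (auto intro: diff U smooth)
  also have "\<dots> = wirt (True, 1) (wirt (False, 2) \<epsilon>) p" by (rule wirt_commute[OF U smooth(2) p])
  also have "\<dots> = wirt (True, 1) (\<lambda>p. S p * cnj (\<epsilon> p)) p"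
    using \<epsilon>_2 p by (intro wirt_cong[OF U]) (auto intro: diff smooth_on_wirt U smooth)
  also have "\<dots> = S p * cnj (S p)"
    by (simp add: wirt_mult diff[OF p] smooth smooth_conj S1[OF p] wirt_conj[OF p] flip: S_def)
  finally show ?thesis .
qed

text \<open>With \<open>m\<close> the conjugate logarithmic derivative of \<open>S\<close> in \<open>z\<^sub>2\<close>, the unknown conjugate \<open>z\<^sub>2\<close>-derivatives of
  \<open>S\<close>, \<open>\<epsilon>\<close> and \<open>\<nu>\<close> are \<open>m S\<close>, \<open>m \<epsilon> + Q\<close> and \<open>m \<nu> + \<tau>\<close>, where \<open>m = \<nu> + \<kappa>\<close> and the functions \<open>\<kappa>\<close>, \<open>Q\<close>, \<open>\<tau>\<close>
  turn out to be antiholomorphic. This closes the system.\<close>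

theorem f_cauchy_bounded:
  assumes S_nz: "\<And>p. p \<in> U \<Longrightarrow> S p \<noteq> 0"
  shows "cauchy_bounded_on f U"
proof -
  define m where "m p = wirt (True, 2) S p / S p" for p
  define \<kappa> where "\<kappa> p = m p - \<nu> p" for p
  define Q where "Q p = wirt (True, 2) \<epsilon> p - m p * \<epsilon> p" for p
  define \<tau> where "\<tau> = wirt (True, 1) Q"
  have smm: "smooth_on m U"
    unfolding m_def[abs_def] by (intro smooth_on_divide smooth_on_wirt smooth U ballI S_nz)
  have smk: "smooth_on \<kappa> U" unfolding \<kappa>_def[abs_def] by (intro smooth_on_diff smooth U smm)
  have smQ: "smooth_on Q U"
    unfolding Q_def[abs_def] by (intro smooth_on_diff smooth_on_mult smooth_on_wirt smooth U smm)
  have smt: "smooth_on \<tau> U" unfolding \<tau>_def by (intro smooth_on_wirt U smQ)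
  have mS: "wirt (True, 2) S p = m p * S p" if "p \<in> U" for p using S_nz[OF that] by (simp add: m_def)
  have m1: "wirt (b, 1) m p = 0" if p: "p \<in> U" for p b
  proof -
    have "wirt (b, 1) (wirt (True, 2) S) p = wirt (True, 2) (wirt (b, 1) S) p"
      by (rule wirt_commute[OF U smooth(3) p])
    also have "\<dots> = 0"
      by (rule wirt_zero_function[OF p]) (auto intro: smooth_on_wirt U smooth simp: S1)
    finally show ?thesis
      unfolding m_def[abs_def] using p
      by (subst wirt_divide) (auto intro: diff smooth_on_wirt U smooth simp: S_nz S1)
  qed
  have m2: "wirt (False, 2) m p = S p * cnj (S p)" if p: "p \<in> U" for p
  proof -
    have "wirt (False, 2) (wirt (True, 2) S) p = wirt (True, 2) (wirt (False, 2) S) p"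
      by (rule wirt_commute[OF U smooth(3) p])
    also have "\<dots> = wirt (True, 2) (\<lambda>p. cnj (\<nu> p) * S p) p"
      using S_2 p by (intro wirt_cong[OF U]) (auto intro: diff smooth_on_wirt U smooth)
    also have "\<dots> = cnj (S p) * S p * S p + cnj (\<nu> p) * wirt (True, 2) S p"
      by (simp add: wirt_mult diff[OF p] smooth smooth_conj wirt_conj[OF p] \<nu>_2[OF p])
    finally have 1: "wirt (False, 2) (wirt (True, 2) S) p
      = cnj (S p) * S p * S p + cnj (\<nu> p) * wirt (True, 2) S p" .
    have "wirt (False, 2) m p
      = (wirt (False, 2) (wirt (True, 2) S) p * S p - wirt (True, 2) S p * wirt (False, 2) S p) / (S p)\<^sup>2"
      unfolding m_def[abs_def] using p
      by (intro wirt_divide diff smooth_on_wirt U smooth S_nz)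
    also have "\<dots> = S p * cnj (S p)"
      unfolding 1 S_2[OF p] using S_nz[OF p] by (simp add: field_simps power2_eq_square)
    finally show ?thesis .
  qed
  \<comment> \<open>Both \<open>m\<close> and \<open>\<nu>\<close> have the \<open>z\<^sub>2\<close>-derivative \<open>S cnj S\<close>.\<close>
  have k0: "wirt (False, j) \<kappa> p = 0" if p: "p \<in> U" for p j
    using exhaust_2[of j] unfolding \<kappa>_def[abs_def]
    by (auto simp: wirt_diff diff[OF p] smooth smm m1[OF p] m2[OF p] \<nu>1[OF p] \<nu>_2[OF p])
  have Q0: "wirt (False, j) Q p = 0" if p: "p \<in> U" for p j
  proof -
    have 1: "wirt (False, 1) (wirt (True, 2) \<epsilon>) p = m p * S p"
      using wirt_commute[OF U smooth(2) p, of "(False, 1)" "(True, 2)"] mS[OF p] by (simp add: S_def)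
    have "wirt (False, 2) (wirt (True, 2) \<epsilon>) p = wirt (True, 2) (wirt (False, 2) \<epsilon>) p"
      by (rule wirt_commute[OF U smooth(2) p])
    also have "\<dots> = wirt (True, 2) (\<lambda>p. S p * cnj (\<epsilon> p)) p"
      using \<epsilon>_2 p by (intro wirt_cong[OF U]) (auto intro: diff smooth_on_wirt U smooth)
    also have "\<dots> = m p * S p * cnj (\<epsilon> p) + S p * (cnj (S p) * \<epsilon> p)"
      by (simp add: wirt_mult diff[OF p] smooth smooth_conj wirt_conj[OF p] \<epsilon>_2[OF p] mS[OF p])
    finally have 2: "wirt (False, 2) (wirt (True, 2) \<epsilon>) p = m p * S p * cnj (\<epsilon> p) + S p * (cnj (S p) * \<epsilon> p)" .
    have "wirt (False, j) Q p = wirt (False, j) (wirt (True, 2) \<epsilon>) p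
        - (wirt (False, j) m p * \<epsilon> p + m p * wirt (False, j) \<epsilon> p)"
      unfolding Q_def[abs_def]
      by (simp add: wirt_diff wirt_mult diff[OF p] smooth smm smooth_on_mult smooth_on_wirt U)
    then show ?thesis
      using exhaust_2[of j] by (auto simp: 1 2 m1[OF p] m2[OF p] \<epsilon>_2[OF p] simp flip: S_def)
  qed
  have t0: "wirt (False, j) \<tau> p = 0" if p: "p \<in> U" for p j
  proof -
    have "wirt (False, j) \<tau> p = wirt (True, 1) (wirt (False, j) Q) p"
      unfolding \<tau>_def by (rule wirt_commute[OF U smQ p])
    also have "\<dots> = 0"
      by (rule wirt_zero_function[OF p]) (auto intro: smooth_on_wirt U smQ simp: Q0)
    finally show ?thesis .
  qed
  have \<nu>_2bar: "wirt (True, 2) \<nu> p = m p * \<nu> p + \<tau> p" if p: "p \<in> U" for p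
  proof -
    have "wirt (True, 2) \<nu> p = wirt (True, 2) (wirt (True, 1) \<epsilon>) p"
      using \<epsilon>_1bar p by (intro wirt_cong[OF U]) (auto intro: diff U smooth)
    also have "\<dots> = wirt (True, 1) (wirt (True, 2) \<epsilon>) p" by (rule wirt_commute[OF U smooth(2) p])
    also have "\<dots> = \<tau> p + m p * \<nu> p"
      unfolding \<tau>_def Q_def[abs_def]
      by (simp add: wirt_diff wirt_mult diff[OF p] smooth smm smooth_on_mult smooth_on_wirt U m1[OF p] \<epsilon>_1bar[OF p])
    finally show ?thesis by simp
  qed
  have cb: "cauchy_bounded_on \<kappa> U" "cauchy_bounded_on Q U" "cauchy_bounded_on \<tau> U"
    by (intro antiholomorphic_cauchy_bounded U smk smQ smt k0 Q0 t0; assumption)+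

  \<comment> \<open>The constant \<open>1\<close> is included so that linear and constant terms count as quadratic ones.\<close>
  let ?Y = "{\<lambda>p. 1, g, \<nu>, S, \<epsilon>}"
  let ?Z = "?Y \<union> (\<lambda>y p. cnj (y p)) ` ?Y"
  have Z: "(\<lambda>p. 1) \<in> ?Z" "g \<in> ?Z" "\<nu> \<in> ?Z" "S \<in> ?Z" "\<epsilon> \<in> ?Z"
    "(\<lambda>p. cnj (\<nu> p)) \<in> ?Z" "(\<lambda>p. cnj (S p)) \<in> ?Z" "(\<lambda>p. cnj (\<epsilon> p)) \<in> ?Z"
    by blast+
  have quad: "quadratic_over U ?Z (\<lambda>p. u p * v p)" if "u \<in> ?Z" "v \<in> ?Z" for u v
    using quadratic_term[OF cauchy_bounded_on_const[of 1] that] by simp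
  have lin: "quadratic_over U ?Z (\<lambda>p. a p * u p)" if "u \<in> ?Z" "cauchy_bounded_on a U" for a u
    using quadratic_term[OF that(2) Z(1) that(1)] by simp
  have elem: "quadratic_over U ?Z u" if "u \<in> ?Z" for u
    using quad[OF Z(1) that] by simp
  have coeff: "quadratic_over U ?Z a" if "cauchy_bounded_on a U" for a
    using lin[OF Z(1) that] by simp
  have zero: "quadratic_over U ?Z (\<lambda>p. 0)"
    by (rule coeff[OF cauchy_bounded_on_const])
  have mk: "m p = \<nu> p + \<kappa> p" for p by (simp add: \<kappa>_def)
  have mult_m: "quadratic_over U ?Z (\<lambda>p. m p * u p)" if "u \<in> ?Z" for u
    using quadratic_add[OF quad[OF Z(3) that] lin[OF that cb(1)]] by (simp add: mk ring_distribs)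
  have I: "\<exists>h. quadratic_over U ?Z h \<and> (\<forall>q\<in>U. wirt d y q = h q)"
    if "quadratic_over U ?Z h" "\<And>q. q \<in> U \<Longrightarrow> wirt d y q = h q" for h y d
    using that by blast
  have A: "cauchy_bounded_on y U" if "y \<in> ?Y" for y
  proof (rule conjugate_quadratic_system_cauchy_bounded[OF U _ _ _ that])
    show "smooth_on y U" if "y \<in> ?Y" for y using that smooth by auto
    fix y and d :: "bool \<times> 2" assume y: "y \<in> ?Y"
    consider "snd d = 1" | "d = (False, 2)" | "d = (True, 2)"
      using exhaust_2[of "snd d"] by (cases d; cases "fst d") auto
    then show "\<exists>h. quadratic_over U ?Z h \<and> (\<forall>q\<in>U. wirt d y q = h q)"
    proof cases
      case 1
      then obtain b where d: "d = (b, 1)" by (cases d) auto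
      have e: "\<exists>h. quadratic_over U ?Z h \<and> (\<forall>q\<in>U. wirt (b, 1) \<epsilon> q = h q)"
      proof (cases b)
        case True
        then have b: "b = True" by simp
        show ?thesis unfolding b by (rule I[OF elem[OF Z(3)] \<epsilon>_1bar])
      next
        case False
        then have "wirt (b, 1) \<epsilon> = S" by (simp add: S_def)
        then show ?thesis by (intro I[OF elem[OF Z(4)]]) simp
      qed
      from y show ?thesis unfolding d
      proof (elim insertE emptyE; hypsubst)
        show "\<exists>h. quadratic_over U ?Z h \<and> (\<forall>q\<in>U. wirt (b, 1) (\<lambda>p. 1) q = h q)"
          by (rule I[OF zero]) simp
        show "\<exists>h. quadratic_over U ?Z h \<and> (\<forall>q\<in>U. wirt (b, 1) g q = h q)"
          by (rule I[OF zero g1])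
        show "\<exists>h. quadratic_over U ?Z h \<and> (\<forall>q\<in>U. wirt (b, 1) \<nu> q = h q)"
          by (rule I[OF zero \<nu>1])
        show "\<exists>h. quadratic_over U ?Z h \<and> (\<forall>q\<in>U. wirt (b, 1) S q = h q)"
          by (rule I[OF zero S1])
      qed (rule e)
    next
      case 2
      have "wirt (False, 2) g q = cnj (\<nu> q) * g q" if "q \<in> U" for q
        using conj_wirt_g[OF that, of True 2] g_nonzero[OF that] g_real[OF that] by (simp add: \<nu>_def)
      note g_2 = this
      from y show ?thesis unfolding 2
      proof (elim insertE emptyE; hypsubst)
        show "\<exists>h. quadratic_over U ?Z h \<and> (\<forall>q\<in>U. wirt (False, 2) (\<lambda>p. 1) q = h q)"
          by (rule I[OF zero]) simp
        show "\<exists>h. quadratic_over U ?Z h \<and> (\<forall>q\<in>U. wirt (False, 2) g q = h q)"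
          by (rule I[OF quad[OF Z(6) Z(2)] g_2])
        show "\<exists>h. quadratic_over U ?Z h \<and> (\<forall>q\<in>U. wirt (False, 2) \<nu> q = h q)"
          by (rule I[OF quad[OF Z(4) Z(7)] \<nu>_2])
        show "\<exists>h. quadratic_over U ?Z h \<and> (\<forall>q\<in>U. wirt (False, 2) S q = h q)"
          by (rule I[OF quad[OF Z(6) Z(4)] S_2])
        show "\<exists>h. quadratic_over U ?Z h \<and> (\<forall>q\<in>U. wirt (False, 2) \<epsilon> q = h q)"
          by (rule I[OF quad[OF Z(4) Z(8)] \<epsilon>_2])
      qed
    next
      case 3
      have "wirt (True, 2) g q = \<nu> q * g q" if "q \<in> U" for q
        using g_nonzero[OF that] by (simp add: \<nu>_def)
      note g_2bar = this
      from y show ?thesis unfolding 3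
      proof (elim insertE emptyE; hypsubst)
        show "\<exists>h. quadratic_over U ?Z h \<and> (\<forall>q\<in>U. wirt (True, 2) (\<lambda>p. 1) q = h q)"
          by (rule I[OF zero]) simp
        show "\<exists>h. quadratic_over U ?Z h \<and> (\<forall>q\<in>U. wirt (True, 2) g q = h q)"
          by (rule I[OF quad[OF Z(3) Z(2)] g_2bar])
        show "\<exists>h. quadratic_over U ?Z h \<and> (\<forall>q\<in>U. wirt (True, 2) \<nu> q = h q)"
          by (rule I[OF quadratic_add[OF mult_m[OF Z(3)] coeff[OF cb(3)]] \<nu>_2bar])
        show "\<exists>h. quadratic_over U ?Z h \<and> (\<forall>q\<in>U. wirt (True, 2) S q = h q)"
          by (rule I[OF mult_m[OF Z(4)] mS])
        show "\<exists>h. quadratic_over U ?Z h \<and> (\<forall>q\<in>U. wirt (True, 2) \<epsilon> q = h q)"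
          by (rule I[OF quadratic_add[OF mult_m[OF Z(5)] coeff[OF cb(2)]]]) (simp add: Q_def)
      qed
    qed
  qed simp
  have g: "cauchy_bounded_on g U" and e: "cauchy_bounded_on \<epsilon> U" by (auto intro: A)
  note ec = cauchy_bounded_on_cnj[OF U e]
  have "cauchy_bounded_on (wirt (True, j) (wirt (False, k) f)) U" for j k
  proof -
    have "cauchy_bounded_on (wirt (True, 1) (wirt (False, 1) f)) U" using g by (simp add: g_def)
    moreover have "cauchy_bounded_on (wirt (True, 2) (wirt (False, 1) f)) U"
      by (rule cauchy_bounded_on_cong[OF U cauchy_bounded_on_mult[OF U g e]]) (simp add: f12)
    moreover have "cauchy_bounded_on (wirt (True, 1) (wirt (False, 2) f)) U"
      by (rule cauchy_bounded_on_cong[OF U cauchy_bounded_on_mult[OF U g ec]]) (simp add: f21)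
    moreover have "cauchy_bounded_on (wirt (True, 2) (wirt (False, 2) f)) U"
      by (rule cauchy_bounded_on_cong[OF U cauchy_bounded_on_mult[OF U g cauchy_bounded_on_mult[OF U e ec]]])
         (simp add: f22)
    ultimately show ?thesis using exhaust_2[of j] exhaust_2[of k] by auto
  qed
  then have hol: "cauchy_bounded_on (wirt (False, k) f) U" for k
    by (rule cauchy_riemann_regularity[OF U smooth_on_wirt[OF U sm_f]])
  have "cauchy_bounded_on (wirt (True, k) f) U" for k
  proof (rule cauchy_bounded_on_cong[OF U cauchy_bounded_on_cnj[OF U hol]])
    show "cnj (wirt (False, k) f p) = wirt (True, k) f p" if "p \<in> U" for p
      using wirt_conj[OF that sm_f, of True k] by (simp add: real_f)
  qed
  moreover have "d = (False, snd d) \<or> d = (True, snd d)" for d :: "bool \<times> 2"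
    by (cases d) auto
  ultimately have "cauchy_bounded_on (wirt d f) U" for d
    using hol[of "snd d"] by metis
  then show ?thesis by (rule cauchy_bounded_on_if_derivatives[OF U sm_f])
qed

end

section \<open>Analyticity of the hypersurface\<close>

text \<open>If \<open>S p = 0\<close>, then by lemma \<open>\<epsilon>_2\<close> both conjugate derivatives of \<open>cnj \<epsilon>\<close> vanish at \<open>p\<close>. As the
  second row of the Levi matrix is \<open>cnj \<epsilon>\<close> times the first, this proportionality persists at \<open>p\<close> for
  one more conjugate derivative. All vectors that should span the whole space then lie in
  one hyperplane, whose coefficient \<open>?x\<close> is chosen so that it contains the gradient itself.\<close>

lemma (in z1_independent_graph) S_nonzero:
  assumes F: "\<And>p. f p = complex_of_real (F p)" and p: "p \<in> U" and nd: "nondegenerate_at 2 F p"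
  shows "S p \<noteq> 0"
proof
  assume S0: "S p = 0"
  have f_eq: "(\<lambda>q. complex_of_real (F q)) = f" using F by auto
  let ?a = "cnj (\<epsilon> p)"
  let ?x = "2 * (wirt (False, 2) f p - ?a * wirt (False, 1) f p)"
  let ?T = "{\<chi> m. foldr dzb js (\<lambda>q. rho_grad F q $ m) p | js. length js \<le> 2} :: (complex^3) set"
  have c0: "wirt (True, k) (\<lambda>q. cnj (\<epsilon> q)) p = 0" for k
    using exhaust_2[of k] S0 \<epsilon>_2[OF p] by (auto simp: wirt_conj[OF p] smooth simp flip: S_def)
  have second: "wirt (True, k) (wirt (False, 2) f) q = cnj (\<epsilon> q) * wirt (True, k) (wirt (False, 1) f) q"
    if "q \<in> U" for q k
    using exhaust_2[of k] f12[OF that] f21[OF that] f22[OF that] by (auto simp: mult_ac simp flip: g_def)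
  have third: "wirt (True, k) (wirt (True, l) (wirt (False, 2) f)) p
      = ?a * wirt (True, k) (wirt (True, l) (wirt (False, 1) f)) p" for k l
  proof -
    have "wirt (True, k) (wirt (True, l) (wirt (False, 2) f)) p
      = wirt (True, k) (\<lambda>q. cnj (\<epsilon> q) * wirt (True, l) (wirt (False, 1) f) q) p"
      using p second by (intro wirt_cong[OF U]) (auto intro: diff smooth_on_wirt U sm_f)
    also have "\<dots> = ?a * wirt (True, k) (wirt (True, l) (wirt (False, 1) f)) p"
      by (simp add: wirt_mult diff[OF p] smooth_conj smooth_on_wirt U sm_f c0)
    finally show ?thesis .
  qed
  have grad: "(\<lambda>q. rho_grad F q $ 1) = wirt (False, 1) f" "(\<lambda>q. rho_grad F q $ 2) = wirt (False, 2) f"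
    "(\<lambda>q. rho_grad F q $ 3) = (\<lambda>q. - 1 / 2)"
    by (simp_all add: rho_grad_def vector_3 f_eq dz_eq_wirt)
  have "V $ 2 - ?a * V $ 1 + ?x * V $ 3 = 0" if "V \<in> vec.span ?T" for V :: "complex^3"
    using that
  proof (rule vec.span_induct)
    show "vec.subspace {V :: complex^3. V $ 2 - ?a * V $ 1 + ?x * V $ 3 = 0}"
    proof (rule vec.subspaceI)
      fix V W :: "complex^3" assume "V \<in> {V. V $ 2 - ?a * V $ 1 + ?x * V $ 3 = 0}" "W \<in> {V. V $ 2 - ?a * V $ 1 + ?x * V $ 3 = 0}"
      then have "V $ 2 - ?a * V $ 1 + ?x * V $ 3 + (W $ 2 - ?a * W $ 1 + ?x * W $ 3) = 0" by simp
      then show "V + W \<in> {V. V $ 2 - ?a * V $ 1 + ?x * V $ 3 = 0}" by (simp add: algebra_simps)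
    next
      fix c and V :: "complex^3" assume "V \<in> {V. V $ 2 - ?a * V $ 1 + ?x * V $ 3 = 0}"
      then have "c * (V $ 2 - ?a * V $ 1 + ?x * V $ 3) = 0" by simp
      then show "c *s V \<in> {V. V $ 2 - ?a * V $ 1 + ?x * V $ 3 = 0}" by (simp add: algebra_simps)
    qed simp
    fix V assume "V \<in> ?T"
    then obtain js where js: "length js \<le> 2" "V = (\<chi> m. foldr dzb js (\<lambda>q. rho_grad F q $ m) p)" by blast
    consider "js = []" | k where "js = [k]" | k l where "js = [k, l]"
      using js(1) by (cases js rule: list.exhaust; cases "tl js") (auto simp: Suc_le_eq)
    then show "V $ 2 - ?a * V $ 1 + ?x * V $ 3 = 0"
    proof cases
      case 1
      then show ?thesis by (simp add: js(2) fun_cong[OF grad(1)] fun_cong[OF grad(2)] fun_cong[OF grad(3)])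
    next
      case (2 k)
      then show ?thesis by (simp add: js(2) grad dzb_eq_wirt second[OF p])
    next
      case (3 k l)
      then show ?thesis by (simp add: js(2) grad dzb_eq_wirt third)
    qed
  qed
  moreover have "axis 2 1 \<in> vec.span ?T"
    using nd unfolding nondegenerate_at_def conj_derivs_span_def by simp
  ultimately have "(axis 2 1 :: complex^3) $ 2 - ?a * (axis 2 1 :: complex^3) $ 1 + ?x * (axis 2 1 :: complex^3) $ 3 = 0"
    by blast
  then show False by (simp add: axis_def)
qed

definition base_projection :: "complex^3 \<Rightarrow> complex^2" where
  "base_projection z = vector [z $ 1, z $ 2]"

lemma bounded_linear_base_projection: "bounded_linear base_projection"
  unfolding linear_conv_bounded_linear[symmetric]
  by (rule linearI) (auto simp: base_projection_def vec_eq_iff forall_2)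

lemma norm_base_projection_le: "norm (base_projection z) \<le> norm z"
  unfolding norm_vec_def L2_set_def
  by (intro real_sqrt_le_mono) (simp add: base_projection_def sum_2 sum_3)

lemma real_analytic_base_projection:
  fixes F :: "complex^2 \<Rightarrow> real"
  assumes U: "open U" and sm: "smooth_on F U" and cb: "cauchy_bounded_on (\<lambda>p. complex_of_real (F p)) U"
  shows "real_analytic_on (\<lambda>z. F (base_projection z)) (base_projection -` U)"
proof (rule real_analytic_on_if_derivative_bounds)
  note bl = bounded_linear_base_projection
  show op: "open (base_projection -` U)"
    by (rule open_vimage[OF U]) (simp add: bl linear_continuous_on)
  show "smooth_on (\<lambda>z. F (base_projection z)) (base_projection -` U)"
    by (rule smooth_on_compose_linear[OF U sm bl])
  fix z assume z: "z \<in> base_projection -` U"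
  then have zU: "base_projection z \<in> U" by simp
  obtain r C R where r: "r > 0" and b: "\<And>q w. q \<in> ball (base_projection z) r \<Longrightarrow> (\<forall>v\<in>set w. norm v \<le> 1)
      \<Longrightarrow> cmod (dirs w (\<lambda>p. complex_of_real (F p)) q) \<le> C * R ^ length w * fact (length w)"
    using cauchy_bounded_dirs[OF U cb zU] by blast
  obtain s where s: "s > 0" "ball (base_projection z) s \<subseteq> U" using U zU open_contains_ball by blast
  have "\<bar>dirs w (\<lambda>z. F (base_projection z)) y\<bar> \<le> C * R ^ length w * fact (length w)"
    if y: "y \<in> ball z (min r s)" and w: "set w \<subseteq> Basis" for y w
  proof -
    have "dist (base_projection z) (base_projection y) = norm (base_projection (z - y))"
      by (simp add: dist_norm linear_diff[OF bounded_linear.linear[OF bl]])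
    also have "\<dots> \<le> dist z y" unfolding dist_norm by (rule norm_base_projection_le)
    finally have q: "base_projection y \<in> ball (base_projection z) r" "base_projection y \<in> U"
      using y s(2) by (auto simp: subset_iff)
    have "\<bar>dirs w (\<lambda>z. F (base_projection z)) y\<bar> = \<bar>dirs (map base_projection w) F (base_projection y)\<bar>"
      by (simp add: dirs_compose_linear[OF U sm bl q(2)])
    also have "\<dots> = cmod (dirs (map base_projection w) (\<lambda>p. complex_of_real (F p)) (base_projection y))"
      by (simp add: dirs_compose_bounded_linear[OF U sm bounded_linear_of_real q(2)])
    also have "\<dots> \<le> C * R ^ length (map base_projection w) * fact (length (map base_projection w))"
    proof (rule b[OF q(1)], clarsimp)
      fix v assume "v \<in> set w"
      then have "norm v = 1" using w by auto
      then show "norm (base_projection v) \<le> 1" using norm_base_projection_le[of v] by simp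
    qed
    finally show ?thesis by simp
  qed
  moreover have "min r s > 0" using r s by simp
  ultimately show "\<exists>r>0. \<exists>C R. \<forall>q\<in>ball z r. \<forall>w. set w \<subseteq> Basis \<longrightarrow>
      \<bar>dirs w (\<lambda>z. F (base_projection z)) q\<bar> \<le> C * R ^ length w * fact (length w)"
    by blast
qed

text \<open>The defining function \<open>F - Re z\<^sub>3\<close> has derivative \<open>-1\<close> in the direction of the real \<open>z\<^sub>3\<close>-axis.\<close>

theorem real_analytic_rigid_hypersurface:
  fixes F :: "complex^2 \<Rightarrow> real"
  assumes U: "open U" "0 \<in> U" and sm: "smooth_on F U" and F0: "F 0 = 0"
    and cb: "cauchy_bounded_on (\<lambda>p. complex_of_real (F p)) U"
  shows "real_analytic_hypersurface_germ (rigid_hypersurface U F) 0"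
proof -
  let ?\<pi> = base_projection
  let ?W = "?\<pi> -` U"
  let ?r = "\<lambda>z :: complex^3. F (?\<pi> z) + (- Re (z $ 3))"
  note bl = bounded_linear_base_projection
  have bl3: "bounded_linear (\<lambda>z :: complex^3. - Re (z $ 3))"
    by (intro bounded_linear_minus bounded_linear_compose[OF bounded_linear_Re] bounded_linear_vec_nth)
  have op: "open ?W" by (rule open_vimage[OF U(1)]) (simp add: bl linear_continuous_on)
  have \<pi>0: "?\<pi> 0 = 0" using bl by (simp add: linear_simps)
  have M: "rigid_hypersurface U F = {z. ?\<pi> z \<in> U \<and> Re (z $ 3) = F (?\<pi> z)}"
    by (simp add: rigid_hypersurface_def base_projection_def)
  have an: "real_analytic_on ?r ?W"
    by (intro real_analytic_on_add real_analytic_base_projection U sm cb real_analytic_on_linear bl3)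
  have nz: "frechet_derivative ?r (at q) (axis 3 1) \<noteq> 0" if q: "q \<in> ?W" for q
  proof -
    have "(F has_derivative frechet_derivative F (at (?\<pi> q))) (at (?\<pi> q))"
      using q by (intro smooth_on_has_derivative[OF sm]) simp
    then have d: "((\<lambda>z. F (?\<pi> z)) has_derivative (\<lambda>v. frechet_derivative F (at (?\<pi> q)) (?\<pi> v))) (at q)"
      by (rule has_derivative_compose[OF bounded_linear_imp_has_derivative[OF bl]])
    have "(?r has_derivative (\<lambda>v. frechet_derivative F (at (?\<pi> q)) (?\<pi> v) + (- Re (v $ 3)))) (at q)"
      by (rule has_derivative_add[OF d bounded_linear_imp_has_derivative[OF bl3]])
    from fun_cong[OF frechet_derivative_at[OF this, symmetric], of "axis 3 1"]
    have "frechet_derivative ?r (at q) (axis 3 1)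
      = frechet_derivative F (at (?\<pi> q)) (?\<pi> (axis 3 1)) + (- Re ((axis 3 1 :: complex^3) $ 3))"
      .
    also have "?\<pi> (axis 3 1) = 0"
      by (simp add: base_projection_def vec_eq_iff forall_2 axis_def)
    also have "frechet_derivative F (at (?\<pi> q)) 0 = 0"
      using q by (intro linear_0 linear_frechet_derivative smooth_on_differentiable[OF sm]) simp
    finally show ?thesis by simp
  qed
  show ?thesis
    unfolding real_analytic_hypersurface_germ_def
  proof (intro conjI exI[of _ ?W] exI[of _ ?r])
    show "0 \<in> rigid_hypersurface U F" by (simp add: M \<pi>0 U F0)
    show "\<forall>q\<in>?W. \<exists>v. frechet_derivative ?r (at q) v \<noteq> 0" using nz by blast
    show "rigid_hypersurface U F \<inter> ?W = {q \<in> ?W. ?r q = 0}" by (auto simp: M)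
  qed (use op an \<pi>0 U in auto)
qed

theorem corollary2p6:
  fixes U :: "(complex^2) set" and F :: "complex^2 \<Rightarrow> real"
  assumes "open U" and "0 \<in> U"
    and "smooth_on F U" and "F 0 = 0"
    and "class_C21 U F"
    and "\<forall>p\<in>U. mixed F 1 1 p \<in> \<real> \<and> Re (mixed F 1 1 p) > 0"
    and "\<forall>p\<in>U. dz 1 (S_invariant F) p = 0"
    and "\<forall>p\<in>U. dzb 1 (S_invariant F) p = 0"
    and "\<forall>p\<in>U. \<forall>q\<in>U. p $ 2 = q $ 2 \<longrightarrow> mixed F 1 1 p = mixed F 1 1 q"
  shows "real_analytic_hypersurface_germ (rigid_hypersurface U F) 0"
proof -
  define f where "f = (\<lambda>p. complex_of_real (F p))"
  have mixed: "mixed F j k = wirt (True, k) (wirt (False, j) f)" for j k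
    by (simp add: mixed_def dz_eq_wirt dzb_eq_wirt f_def)
  have smf: "smooth_on f U"
    unfolding f_def by (rule smooth_on_compose_bounded_linear[OF assms(1) bounded_linear_of_real assms(3)])
  interpret degenerate_graph U f
  proof
    fix p assume p: "p \<in> U"
    show "wirt (True, 1) (wirt (False, 1) f) p \<noteq> 0"
      using assms(6) p unfolding mixed by force
    have "rank (levi_matrix F p) = 1" using assms(5) p by (simp add: class_C21_def)
    from rank_one_imp_minor_zero[OF this]
    show "wirt (True, 1) (wirt (False, 1) f) p * wirt (True, 2) (wirt (False, 2) f) p
      = wirt (True, 2) (wirt (False, 1) f) p * wirt (True, 1) (wirt (False, 2) f) p"
      by (simp add: levi_matrix_def mixed)
  qed (use assms(1) smf in \<open>simp_all add: f_def\<close>)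
  have S: "S_invariant F = S"
    unfolding S_invariant_def S_def dz_eq_wirt mixed by (simp add: \<epsilon>_def[abs_def] g_def)
  interpret z1_independent_graph U f
  proof
    fix p b assume p: "p \<in> U"
    show "wirt (b, 1) S p = 0"
      using assms(7,8) p by (cases b) (auto simp: S dz_eq_wirt dzb_eq_wirt)
    show "wirt (b, 1) g p = 0"
    proof (rule wirt_zero_of_constant_along[OF U p diff[OF p smooth(1)]])
      fix q :: "complex^2" assume q: "q \<in> U" "\<forall>i. i \<noteq> snd (b, 1) \<longrightarrow> q $ i = p $ i"
      then have "q $ 2 = p $ 2" by simp
      then have "mixed F 1 1 q = mixed F 1 1 p" using assms(9) q(1) p by blast
      then show "g q = g p" by (simp add: mixed g_def)
    qed
  qed
  have "cauchy_bounded_on f U"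
  proof (rule f_cauchy_bounded)
    fix p assume p: "p \<in> U"
    then have "nondegenerate_at 2 F p" using assms(5) by (simp add: class_C21_def)
    then show "S p \<noteq> 0" using p by (intro S_nonzero[of F]) (simp_all add: f_def)
  qed
  then show ?thesis
    unfolding f_def by (rule real_analytic_rigid_hypersurface[OF assms(1-4)])
qed

end
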